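(* For every $\rho>0$ there is a constant $c>0$, depending on $\rho$ but independent of $N$, such that the following holds for $\sigma>0$ and every integer $N\ge 1$. Let $t_1>t_2>\cdots>t_N$ be the zeros of the Hermite polynomial $H_N$, let $r:=\rho/\sigma$, let $$\lambda_j=-\mathrm i\sqrt{\frac{2(\rho+\sigma)}{\sigma(2\rho+\sigma)}}\;t_j,\qquad j=1,\ldots,N,$$ and let $\gamma_1,\ldots,\gamma_N$ be the solution of the linear system $$\sum_{j=1}^N\mathrm e^{(\lambda_j-\lambda_k)^2\rho/2}\,\gamma_j=\sqrt{\frac{\sigma}{\sigma+\rho}}\;\mathrm e^{\frac{\sigma\rho\lambda_k^2}{2(\sigma+\rho)}},\qquad k=1,\ldots,N.$$ Then $\gamma_j=\gamma_{N+1-j}$ for $j=1,\ldots,N$, and $$\Big\|\mathrm e^{-\cdot^2/2\sigma}-\sum_{j=1}^N\gamma_j\,\mathrm e^{\lambda_j\cdot}\Big\|_{L^2(\mathbb R,\rho)}<c\left(\frac{r}{\sqrt{2(2r+1)}}\right)^{N}N^{3/4}\le c\left(\frac{3^{1/4}\,r}{\sqrt{2(2r+1)}}\right)^{N}.$$ Consequently, if $r=\rho/\sigma<2+\sqrt6$, the approximation error decays exponentially in $N$ (for fixed $\rho,\sigma$), i.e. there are $C>0$ and $q\in(0,1)$ independent of $N$ such that the error is at most $C q^N$ for all $N\ge1$.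
   Context: The weighted norm is $\|f\|_{L^2(\mathbb R,\rho)}=\Big(\int_{-\infty}^\infty|f(t)|^2\,\mathrm e^{-t^2/2\rho}\,\mathrm dt\Big)^{1/2}$. The physicist's Hermite polynomials are $H_n(t)=(-1)^n\mathrm e^{t^2}\frac{\mathrm d^n}{\mathrm dt^n}\mathrm e^{-t^2}$; $H_N$ has $N$ simple real zeros. The matrix of the linear system is real, symmetric and positive definite, so the solution $(\gamma_j)$ is unique; it is the minimizer of $\big\|\mathrm e^{-\cdot^2/2\sigma}-\sum_{j=1}^N\tilde\gamma_j\mathrm e^{\lambda_j\cdot}\big\|_{L^2(\mathbb R,\rho)}$ over $\tilde\gamma\in\mathbb C^N$ for the given $\lambda_j$. *)

theory Defs
  imports "HOL-Analysis.Analysis"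
begin

definition hermite :: "nat \<Rightarrow> real \<Rightarrow> real" where
  "hermite n t = (-1) ^ n * exp (t\<^sup>2) * (deriv ^^ n) (\<lambda>x. exp (- (x\<^sup>2))) t"

(* Finite families are functions on nat of which only the values at 1, ..., N are used. *)

definition hermite_zeros_desc :: "nat \<Rightarrow> (nat \<Rightarrow> real) \<Rightarrow> bool" where
  "hermite_zeros_desc N t \<longleftrightarrow>
     t ` {1..N} = {x. hermite N x = 0} \<and>
     (\<forall>i\<in>{1..N}. \<forall>j\<in>{1..N}. i < j \<longrightarrow> t j < t i)"

(* The norm is meaningful only for f whose weighted square is integrable, since the Bochner integral
   of a non-integrable function is 0.  It is only applied to bounded continuous f below: Gaussians
   minus finite exponential sums with purely imaginary frequencies. *)
definition weighted_norm :: "real \<Rightarrow> (real \<Rightarrow> complex) \<Rightarrow> real" where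
  "weighted_norm \<rho> f = sqrt (LINT t|lborel. (cmod (f t))\<^sup>2 * exp (- (t\<^sup>2) / (2 * \<rho>)))"

definition frequency :: "real \<Rightarrow> real \<Rightarrow> (nat \<Rightarrow> real) \<Rightarrow> nat \<Rightarrow> complex" where
  "frequency \<rho> \<sigma> t j =
     - \<i> * complex_of_real (sqrt (2 * (\<rho> + \<sigma>) / (\<sigma> * (2 * \<rho> + \<sigma>)))) * complex_of_real (t j)"

definition solves_system ::
  "real \<Rightarrow> real \<Rightarrow> nat \<Rightarrow> (nat \<Rightarrow> complex) \<Rightarrow> (nat \<Rightarrow> complex) \<Rightarrow> bool" where
  "solves_system \<rho> \<sigma> N l \<gamma> \<longleftrightarrow>
     (\<forall>k\<in>{1..N}.
        (\<Sum>j=1..N. exp ((l j - l k)\<^sup>2 * complex_of_real \<rho> / 2) * \<gamma> j) =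
        complex_of_real (sqrt (\<sigma> / (\<sigma> + \<rho>))) *
        exp (complex_of_real (\<sigma> * \<rho>) * (l k)\<^sup>2 / complex_of_real (2 * (\<sigma> + \<rho>))))"

definition approx_error ::
  "real \<Rightarrow> real \<Rightarrow> nat \<Rightarrow> (nat \<Rightarrow> complex) \<Rightarrow> (nat \<Rightarrow> complex) \<Rightarrow> real" where
  "approx_error \<rho> \<sigma> N l \<gamma> =
     weighted_norm \<rho> (\<lambda>x. complex_of_real (exp (- (x\<^sup>2) / (2 * \<sigma>)))
                          - (\<Sum>j=1..N. \<gamma> j * exp (l j * complex_of_real x)))"

end

theory Submission
  imports Defs "HOL-Complex_Analysis.Cauchy_Integral_Formula"
    "HOL-Probability.Characteristic_Functions" "HOL-Real_Asymp.Real_Asymp"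
begin

text \<open>
  The system consists of the normal equations of the least squares problem, so the error is at most
  that of any other choice of coefficients. Writing the Gaussian as a superposition of exponentials
  and applying Gauss-Hermite quadrature to it yields trial coefficients whose squared error is, by
  Mehler's formula, a constant times \<open>\<Sum>n\<ge>2*N. \<tau>^n * q n\<close> with \<open>\<tau> = \<rho> / (\<rho> + \<sigma>)\<close>, where \<open>q n\<close> is the
  square of the quadrature value of the normalized \<open>n\<close>-th Hermite polynomial.

  These values are the Taylor coefficients of \<open>\<Psi> z = (\<Sum>j. w j * exp (2 * t j * z - z^2)) - 1\<close>, and
  Cauchy's inequality reduces their estimation to \<open>norm (\<Psi> z) \<le> 2 * exp (norm z ^ 2)\<close>, which
  follows from the positivity of the weights, and \<open>norm (\<Psi> z) \<le> (23/100)^N * exp (3 * norm z ^ 2)\<close>.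
  For the latter, the quadrature errors of \<open>(x - t 1) * ... * (x - t k) * exp (2 * x * z)\<close> satisfy
  first-order linear differential equations in \<open>z\<close> that link \<open>k\<close> to \<open>k + 1\<close>, with \<open>z^N * exp (z^2)\<close> at the
  end of the chain; along every ray they are dominated by an explicit solution of the corresponding
  real differential inequalities. The better of the two resulting bounds for \<open>q n\<close> gives the rate for
  \<open>\<tau>^2 \<le> 2/3\<close>; beyond that the base of the rate is at least \<open>1\<close> and zero coefficients do.
\<close>

text \<open>The constant may depend on \<rho> only, so every estimate has to be uniform in \<tau>.
  The target for the squared error is \<open>T^N\<close> with
  \<open>T = \<tau>^2 / (2 * (1 - \<tau>^2))\<close>, which is close to
  \<open>(\<tau>^2 / 2)^N\<close> for small \<tau>. Positivity of the weights alone bounds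
  \<open>q n\<close> by a multiple of \<open>n\<close> and yields only \<open>\<tau>^(2*N)\<close>:
  a factor \<open>2^(-N)\<close> is missing. It has to come from the \<open>q n\<close> with
  \<open>n\<close> near \<open>2*N\<close>, where the second bound gives
  \<open>(3 * 23/100)^(2*N) = 0.4761^N\<close>. For large \<open>n\<close> that bound is useless,
  but there \<open>\<tau>^n\<close> is small enough for the first one. The comparisons leave a spare
  factor \<open>24/25\<close> in the base, which absorbs all powers of \<open>N\<close>. The
  differential equations bound the quadrature error at complex points without information on the
  location of the nodes: the top member of the chain contains no node, all initial values vanish by
  exactness, and a majorant can be written down because the polynomial of the rescaled nodes is
  again a Hermite polynomial.\<close>

section \<open>Hermite polynomials and Gauss quadrature\<close>

text \<open>Monic Hermite polynomials with a parameter: \<^term>\<open>s = 1\<close> gives the physicist's polynomials up to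
  the factor \<^term>\<open>2 ^ n\<close>, and for \<^term>\<open>s = -1\<close> the \<^term>\<open>n\<close>-th iterate of half the derivative maps
  \<^term>\<open>exp (x\<^sup>2)\<close> to \<^term>\<open>exp (x\<^sup>2) * he s n x\<close>.\<close>

fun he :: "'a::real_normed_field \<Rightarrow> nat \<Rightarrow> 'a \<Rightarrow> 'a" where
  "he s 0 x = 1"
| "he s (Suc 0) x = x"
| "he s (Suc (Suc n)) x = x * he s (Suc n) x - of_nat (Suc n) / 2 * s * he s n x"

text \<open>An Appell sequence for every \<open>s\<close>: after differentiating the recurrence, the
  terms with \<open>he s n\<close> and \<open>he s (n - 1)\<close> collapse by the recurrence one
  index lower.\<close>

lemma he_has_field_derivative:
  "(he s n has_field_derivative of_nat n * he s (n - 1) x) (at x)"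
proof (induction s n x rule: he.induct)
  case (1 s x)
  have "he s 0 = (\<lambda>x. 1)" by auto
  then show ?case by simp
next
  case (2 s x)
  have "he s (Suc 0) = (\<lambda>x. x)" by auto
  then show ?case by simp
next
  case (3 s n x)
  have eq: "he s (Suc (Suc n)) = (\<lambda>x. x * he s (Suc n) x - of_nat (Suc n) / 2 * s * he s n x)"
    by auto
  have "((\<lambda>x. x * he s (Suc n) x - of_nat (Suc n) / 2 * s * he s n x) has_field_derivative
      he s (Suc n) x + x * (of_nat (Suc n) * he s n x)
        - of_nat (Suc n) / 2 * s * (of_nat n * he s (n - 1) x)) (at x)"
    using 3 by (auto intro!: derivative_eq_intros)
  moreover have "he s (Suc n) x + x * (of_nat (Suc n) * he s n x)
        - of_nat (Suc n) / 2 * s * (of_nat n * he s (n - 1) x)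
      = of_nat (Suc (Suc n)) * he s (Suc n) x"
    by (cases n) (auto simp: field_simps)
  ultimately show ?case by (simp only: eq diff_Suc_1)
qed

lemma he_Suc: "he s (Suc n) x = x * he s n x - of_nat n / 2 * s * he s (n - 1) x"
  by (cases n) auto

lemma he_of_real: "he (of_real s) n (of_real x :: 'a) = (of_real (he s n x) :: 'a :: real_normed_field)"
  by (induction s n x rule: he.induct) auto

text \<open>Stretching the variable is absorbed by the parameter. The case \<open>c = -1\<close> is
  the parity of the Hermite polynomials; a general real \<open>c\<close> identifies the polynomial
  of the rescaled nodes in the majorant.\<close>

lemma he_scale: "he (c\<^sup>2) n (c * x) = c ^ n * he 1 n x"
  by (induction "1::'a" n x rule: he.induct) (auto simp: algebra_simps power2_eq_square)

lemma he_0: "he 0 n x = x ^ n"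
  by (induction "0::'a" n x rule: he.induct) auto

text \<open>A formal counterpart of \<open>he\<close>: division with remainder, degrees and linear
  functionals need polynomials, while \<open>he\<close> is also evaluated at complex points.\<close>

fun mhermite :: "real \<Rightarrow> nat \<Rightarrow> real poly" where
  "mhermite s 0 = 1"
| "mhermite s (Suc 0) = [:0, 1:]"
| "mhermite s (Suc (Suc n)) = [:0, 1:] * mhermite s (Suc n) - smult (real (Suc n) / 2 * s) (mhermite s n)"

lemma poly_mhermite: "poly (mhermite s n) x = he s n x"
  by (induction s n rule: mhermite.induct) auto

lemma degree_mhermite: "degree (mhermite s n) = n \<and> coeff (mhermite s n) n = 1"
proof (induction s n rule: mhermite.induct)
  case (3 s n)
  have d: "degree ([:0, 1:] * mhermite s (Suc n)) = Suc (Suc n)"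
    using 3 by (subst degree_mult_eq) auto
  have d2: "degree (smult (real (Suc n) / 2 * s) (mhermite s n)) < Suc (Suc n)"
    using 3 by (metis degree_smult_le le_imp_less_Suc less_SucI)
  have "degree (mhermite s (Suc (Suc n))) = Suc (Suc n)"
    using d d2 unfolding mhermite.simps by (metis (no_types) degree_add_eq_left diff_conv_add_uminus degree_minus)
  moreover have "coeff (mhermite s (Suc (Suc n))) (Suc (Suc n)) = 1"
    using 3 d2 by (simp add: coeff_eq_0)
  ultimately show ?case by blast
qed auto

lemma pderiv_mhermite: "pderiv (mhermite s n) = smult (real n) (mhermite s (n - 1))"
proof -
  have "poly (pderiv (mhermite s n)) x = real n * he s (n - 1) x" for x
  proof -
    have "((\<lambda>x. poly (mhermite s n) x) has_field_derivative poly (pderiv (mhermite s n)) x) (at x)"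
      by (rule poly_DERIV)
    moreover have "((\<lambda>x. poly (mhermite s n) x) has_field_derivative real n * he s (n - 1) x) (at x)"
      using he_has_field_derivative[of s n x] by (simp add: poly_mhermite)
    ultimately show ?thesis by (rule DERIV_unique)
  qed
  then show ?thesis
    by (intro poly_eqI_degree[where A = UNIV] poly_eq_poly_eq_iff[THEN iffD1]) (auto simp: poly_mhermite)
qed

text \<open>The raising operator \<open>x - (s/2) D\<close> replaces the two-step recurrence by a
  one-step one, so that plain induction on \<open>n\<close> works below.\<close>

lemma mhermite_Suc_pderiv:
  "mhermite s (Suc n) = [:0, 1:] * mhermite s n - smult (s / 2) (pderiv (mhermite s n))"
  by (cases n) (auto simp: pderiv_mhermite pderiv_pCons mult.commute)

lemma deriv_funpow_gaussian:
  "(deriv ^^ n) (\<lambda>x::real. exp (- (x\<^sup>2))) = (\<lambda>x. (-2) ^ n * he 1 n x * exp (- (x\<^sup>2)))"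
proof (induction n)
  case (Suc n)
  have "deriv (\<lambda>x. (-2) ^ n * he 1 n x * exp (- (x\<^sup>2))) x
      = (-2) ^ Suc n * he 1 (Suc n) x * exp (- (x\<^sup>2))" for x :: real
    by (rule DERIV_imp_deriv)
       (auto intro!: derivative_eq_intros he_has_field_derivative simp: he_Suc[of _ n] algebra_simps)
  then show ?case using Suc by auto
qed auto

lemma hermite_eq_he: "hermite n t = 2 ^ n * he 1 n t"
proof -
  have "hermite n t = ((-1) ^ n * (-2) ^ n) * he 1 n t * (exp (t\<^sup>2) * exp (- (t\<^sup>2)))"
    unfolding hermite_def deriv_funpow_gaussian by (simp add: mult_ac)
  also have "exp (t\<^sup>2) * exp (- (t\<^sup>2)) = 1" by (simp add: exp_minus)
  also have "(-1 :: real) ^ n * (-2) ^ n = 2 ^ n" by (simp flip: power_mult_distrib)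
  finally show ?thesis by simp
qed

section \<open>Umbral evaluation: linear maps on polynomials given by their values on the
  monomials\<close>

definition umbral :: "(nat \<Rightarrow> 'a::real_vector) \<Rightarrow> real poly \<Rightarrow> 'a" where
  "umbral F p = (\<Sum>i\<le>degree p. coeff p i *\<^sub>R F i)"

lemma umbral_altdef: "degree p \<le> n \<Longrightarrow> umbral F p = (\<Sum>i\<le>n. coeff p i *\<^sub>R F i)"
  unfolding umbral_def by (rule sum.mono_neutral_left) (auto simp: coeff_eq_0)

lemma umbral_0 [simp]: "umbral F 0 = 0" and umbral_1 [simp]: "umbral F 1 = F 0"
  by (auto simp: umbral_def)

lemma umbral_add: "umbral F (p + q) = umbral F p + umbral F q"
  using degree_add_le_max[of p q]
  by (simp add: umbral_altdef[of _ "max (degree p) (degree q)"] scaleR_add_left sum.distrib)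

lemma umbral_smult: "umbral F (smult c p) = c *\<^sub>R umbral F p"
  by (simp add: umbral_altdef[of _ "degree p"] scaleR_right.sum)

lemma umbral_diff: "umbral F (p - q) = umbral F p - umbral F q"
proof -
  have "p - q = p + smult (-1) q" by simp
  then show ?thesis by (simp only: umbral_add umbral_smult) simp
qed

lemma umbral_sum: "umbral F (\<Sum>i\<in>A. f i) = (\<Sum>i\<in>A. umbral F (f i))"
  by (induction A rule: infinite_finite_induct) (auto simp: umbral_add)

lemma umbral_pCons: "umbral F (pCons a p) = a *\<^sub>R F 0 + umbral (\<lambda>i. F (Suc i)) p"
proof -
  have "umbral F (pCons a p) = (\<Sum>i\<le>Suc (degree p). coeff (pCons a p) i *\<^sub>R F i)"
    by (rule umbral_altdef) (rule degree_pCons_le)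
  also have "\<dots> = a *\<^sub>R F 0 + (\<Sum>i\<le>degree p. coeff p i *\<^sub>R F (Suc i))"
    by (subst sum.atMost_Suc_shift) simp
  finally show ?thesis by (simp add: umbral_def)
qed

lemma umbral_mult_X: "umbral F ([:0, 1:] * p) = umbral (\<lambda>i. F (Suc i)) p"
  using umbral_pCons[of F 0 p] by simp


lemma umbral_linear: "umbral (\<lambda>i. a *\<^sub>R F i + b *\<^sub>R G i) p = a *\<^sub>R umbral F p + b *\<^sub>R umbral G p"
  unfolding umbral_def scaleR_right.sum sum.distrib[symmetric]
  by (intro sum.cong) (auto simp: scaleR_add_right mult_ac)

lemma umbral_pderiv: "umbral F (pderiv p) = umbral (\<lambda>i. real i *\<^sub>R F (i - 1)) p"
proof (induction p arbitrary: F rule: pCons_induct)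
  case (pCons a p)
  have "umbral F (pderiv (pCons a p)) = umbral F p + umbral (\<lambda>i. real i *\<^sub>R F (Suc (i - 1))) p"
    by (simp add: pderiv_pCons umbral_add umbral_pCons pCons.IH)
  also have "(\<lambda>i. real i *\<^sub>R F (Suc (i - 1))) = (\<lambda>i. real i *\<^sub>R F i)"
    by (rule ext, case_tac i) auto
  also have "umbral F p + umbral (\<lambda>i. real i *\<^sub>R F i) p = umbral (\<lambda>i. real (Suc i) *\<^sub>R F i) p"
    using umbral_linear[of 1 F 1 "\<lambda>i. real i *\<^sub>R F i" p] by (simp add: scaleR_add_left)
  also have "\<dots> = umbral (\<lambda>i. real i *\<^sub>R F (i - 1)) (pCons a p)"
    by (simp add: umbral_pCons)
  finally show ?case .
qed auto

text \<open>The value \<open>he (-1) i z\<close> is the \<open>i\<close>-th moment of the Gaussian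
  of variance 1/2 centred at \<open>z\<close>; this is Gaussian integration by parts in algebraic
  form.\<close>

lemma umbral_he_minus1_mult_X:
  fixes z :: "'a::real_normed_field"
  shows "umbral (\<lambda>i. he (-1) i z) ([:0, 1:] * p)
    = z * umbral (\<lambda>i. he (-1) i z) p + (1/2) *\<^sub>R umbral (\<lambda>i. he (-1) i z) (pderiv p)"
proof -
  have "umbral (\<lambda>i. he (-1) i z) ([:0, 1:] * p)
      = umbral (\<lambda>i. 1 *\<^sub>R (z * he (-1) i z) + (1/2) *\<^sub>R (real i *\<^sub>R he (-1) (i - 1) z)) p"
    unfolding umbral_mult_X by (simp add: he_Suc scaleR_conv_of_real)
  also have "\<dots> = umbral (\<lambda>i. z * he (-1) i z) p
      + (1/2) *\<^sub>R umbral (\<lambda>i. real i *\<^sub>R he (-1) (i - 1) z) p"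
    by (subst umbral_linear) simp
  also have "umbral (\<lambda>i. z * he (-1) i z) p = z * umbral (\<lambda>i. he (-1) i z) p"
    by (simp add: umbral_def sum_distrib_left)
  finally show ?thesis by (simp add: umbral_pderiv)
qed

text \<open>The raising operator subtracts half the derivative, which is just what integration by
  parts adds; only the multiplication by \<open>z\<close> remains.\<close>

lemma umbral_he_minus1_mhermite: "umbral (\<lambda>i. he (-1) i z) (mhermite 1 n) = z ^ n"
  by (induction n) (simp_all add: mhermite_Suc_pderiv umbral_diff umbral_smult umbral_he_minus1_mult_X
    del: mult_pCons_left)

text \<open>The mean of a polynomial under the probability measure with density
  \<^term>\<open>exp (- (x\<^sup>2)) / sqrt pi\<close>, given through its moments.\<close>

definition gauss_mean :: "real poly \<Rightarrow> real" where
  "gauss_mean = umbral (\<lambda>i. he (-1) i 0)"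

lemma gauss_mean_simps:
  "gauss_mean (p + q) = gauss_mean p + gauss_mean q"
  "gauss_mean (p - q) = gauss_mean p - gauss_mean q"
  "gauss_mean (smult c p) = c * gauss_mean p"
  "gauss_mean 0 = 0" "gauss_mean 1 = 1"
  by (simp_all add: gauss_mean_def umbral_add umbral_diff umbral_smult)

lemma gauss_mean_mult_X: "gauss_mean ([:0, 1:] * p) = gauss_mean (pderiv p) / 2"
  unfolding gauss_mean_def by (simp only: umbral_he_minus1_mult_X) simp

lemma gauss_mean_mhermite: "gauss_mean (mhermite 1 n) = 0 ^ n"
  by (simp add: gauss_mean_def umbral_he_minus1_mhermite)

text \<open>Integration by parts trades one raising operator for half a derivative of the other
  factor.\<close>

lemma gauss_mean_mhermite_Suc_mult:
  "gauss_mean (mhermite 1 (Suc n) * q) = gauss_mean (mhermite 1 n * pderiv q) / 2"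
proof -
  have "mhermite 1 (Suc n) * q
      = [:0, 1:] * (mhermite 1 n * q) - smult (1/2) (pderiv (mhermite 1 n) * q)"
    unfolding mhermite_Suc_pderiv by (simp only: left_diff_distrib mult.assoc mult_smult_left)
  then have "gauss_mean (mhermite 1 (Suc n) * q)
      = gauss_mean (pderiv (mhermite 1 n * q)) / 2 - gauss_mean (pderiv (mhermite 1 n) * q) / 2"
    by (simp only: gauss_mean_simps gauss_mean_mult_X mult_1 times_divide_eq_left)
  also have "pderiv (mhermite 1 n * q) = mhermite 1 n * pderiv q + pderiv (mhermite 1 n) * q"
    by (simp add: pderiv_mult mult.commute)
  finally show ?thesis by (simp only: gauss_mean_simps add_divide_distrib)
qed

text \<open>Each integration by parts lowers \<open>n\<close> by one and differentiates
  \<open>q\<close> once, until \<open>q\<close> has vanished. The alternative \<open>q = 0\<close>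
  covers \<open>n = 0\<close>, where no degree is small enough.\<close>

lemma gauss_mean_mhermite_orthogonal:
  "degree q < n \<or> q = 0 \<Longrightarrow> gauss_mean (mhermite 1 n * q) = 0"
proof (induction n arbitrary: q)
  case (Suc n)
  have "degree (pderiv q) < n \<or> pderiv q = 0"
  proof (cases "degree q = 0")
    case True
    then show ?thesis by (simp add: pderiv_eq_0_iff)
  next
    case False
    then show ?thesis using Suc.prems by (auto simp: degree_pderiv)
  qed
  then show ?case using Suc.IH by (simp add: gauss_mean_mhermite_Suc_mult)
qed (auto simp: gauss_mean_simps)

lemma gauss_mean_mhermite_square_nonneg: "gauss_mean (mhermite 1 n * mhermite 1 n) \<ge> 0"
proof (induction n)
  case (Suc n)
  then show ?case
    by (subst gauss_mean_mhermite_Suc_mult) (simp add: pderiv_mhermite gauss_mean_simps)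
qed (simp add: gauss_mean_simps)

text \<open>As \<open>gauss_mean\<close> is given by moments and not by an integral, positivity has
  to come from algebra: subtracting a multiple of a Hermite polynomial removes the leading term, and
  what is left has lower degree and is orthogonal to it.\<close>

lemma gauss_mean_square_nonneg: "gauss_mean (p * p) \<ge> 0"
proof (induction "degree p" arbitrary: p rule: less_induct)
  case less
  define c where "c = lead_coeff p"
  define q where "q = p - smult c (mhermite 1 (degree p))"
  have p: "p = q + smult c (mhermite 1 (degree p))" by (simp add: q_def)
  have dq: "degree q < degree p \<or> q = 0"
  proof (cases "q = 0")
    case False
    have "degree q \<le> degree p"
      unfolding q_def by (rule degree_diff_le) (auto simp: degree_mhermite intro: order_trans[OF degree_smult_le])
    moreover have "coeff q (degree p) = 0"
      by (simp add: q_def c_def degree_mhermite)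
    ultimately show ?thesis using False by (metis leading_coeff_0_iff le_neq_implies_less)
  qed auto
  then have q: "gauss_mean (q * q) \<ge> 0" using less by (auto simp: gauss_mean_simps)
  have o: "gauss_mean (mhermite 1 (degree p) * q) = 0"
    by (rule gauss_mean_mhermite_orthogonal) (use dq in auto)
  have "p * p = q * q + smult (2 * c) (mhermite 1 (degree p) * q)
      + smult (c\<^sup>2) (mhermite 1 (degree p) * mhermite 1 (degree p))"
  proof -
    have eq: "r * r = q * q + smult (2 * c) (h * q) + smult (c\<^sup>2) (h * h)"
      if "r = q + smult c h" for r h :: "real poly"
    proof -
      have "smult (2 * c) (h * q) = smult c (h * q) + smult c (h * q)"
        by (simp flip: smult_add_left)
      then show ?thesis unfolding that by (simp add: algebra_simps power2_eq_square)
    qed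
    show ?thesis by (rule eq) (rule p)
  qed
  then have "gauss_mean (p * p) = gauss_mean (q * q)
      + c\<^sup>2 * gauss_mean (mhermite 1 (degree p) * mhermite 1 (degree p))"
    by (simp add: gauss_mean_simps o)
  then show ?case using q gauss_mean_mhermite_square_nonneg[of "degree p"] by simp
qed


section \<open>Gauss quadrature at the zeros of the Hermite polynomial\<close>

definition node_poly :: "nat set \<Rightarrow> (nat \<Rightarrow> real) \<Rightarrow> real poly" where
  "node_poly A t = (\<Prod>i\<in>A. [:- t i, 1:])"

lemma poly_node_poly: "poly (node_poly A t) x = (\<Prod>i\<in>A. x - t i)"
  by (simp add: node_poly_def poly_prod)

lemma degree_node_poly: "finite A \<Longrightarrow> degree (node_poly A t) = card A"
  unfolding node_poly_def by (subst degree_prod_eq_sum_degree) auto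

lemma lead_coeff_node_poly: "lead_coeff (node_poly A t) = 1"
  by (simp add: node_poly_def lead_coeff_prod)

locale hermite_nodes =
  fixes N :: nat and t :: "nat \<Rightarrow> real"
  assumes N_pos: "N \<ge> 1"
    and inj_t: "inj_on t {1..N}"
    and hermite_t: "j \<in> {1..N} \<Longrightarrow> hermite N (t j) = 0"
begin

lemma mhermite_eq_node_poly: "mhermite 1 N = node_poly {1..N} t"
proof (rule poly_eqI_degree_lead_coeff[where A = "t ` {1..N}" and n = N])
  show "coeff (mhermite 1 N) N = coeff (node_poly {1..N} t) N"
    using lead_coeff_node_poly[of "{1..N}" t] by (simp add: degree_mhermite degree_node_poly)
  show "N \<le> card (t ` {1..N})" using inj_t by (simp add: card_image)
  show "poly (mhermite 1 N) z = poly (node_poly {1..N} t) z" if "z \<in> t ` {1..N}" for z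
  proof -
    from that obtain j where j: "j \<in> {1..N}" "z = t j" by auto
    then have "poly (mhermite 1 N) z = 0"
      using hermite_t[of j] by (simp add: hermite_eq_he poly_mhermite)
    moreover have "poly (node_poly {1..N} t) z = 0" using j by (auto simp: poly_node_poly)
    ultimately show ?thesis by simp
  qed
qed (auto simp: degree_mhermite degree_node_poly)

definition lagrange :: "nat \<Rightarrow> real poly" where
  "lagrange j = smult (1 / (\<Prod>i\<in>{1..N} - {j}. t j - t i)) (node_poly ({1..N} - {j}) t)"

definition weight :: "nat \<Rightarrow> real" where
  "weight j = gauss_mean (lagrange j)"

lemma poly_lagrange:
  assumes "i \<in> {1..N}" "j \<in> {1..N}"
  shows "poly (lagrange j) (t i) = (if i = j then 1 else 0)"
proof -
  have "t j - t i \<noteq> 0" if "i \<in> {1..N} - {j}" for i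
    using inj_onD[OF inj_t _ assms(2), of i] that by auto
  then have "(\<Prod>i\<in>{1..N} - {j}. t j - t i) \<noteq> 0"
    by (subst prod_zero_iff) blast+
  moreover have "(\<Prod>l\<in>{1..N} - {j}. t i - t l) = 0" if "i \<noteq> j"
    by (rule prod_zero) (use that assms(1) in \<open>blast, intro bexI[of _ i], simp, blast\<close>)
  moreover have "poly (lagrange j) (t i)
      = (\<Prod>l\<in>{1..N} - {j}. t i - t l) / (\<Prod>l\<in>{1..N} - {j}. t j - t l)"
    by (simp only: lagrange_def poly_node_poly poly_smult times_divide_eq_left mult_1)
  ultimately show ?thesis by (cases "i = j") (simp_all only: if_True if_False divide_self div_0 simp_thms)
qed

lemma degree_lagrange: "j \<in> {1..N} \<Longrightarrow> degree (lagrange j) < N"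
  using N_pos unfolding lagrange_def
  by (intro le_less_trans[OF degree_smult_le]) (auto simp: degree_node_poly)

text \<open>Gauss's argument: reducing \<open>p\<close> modulo the Hermite polynomial changes
  neither its values at the nodes nor, by orthogonality, its mean, and Lagrange interpolation
  reproduces the remainder.\<close>

lemma quadrature_exact:
  assumes "degree p < 2 * N"
  shows "(\<Sum>j=1..N. weight j * poly p (t j)) = gauss_mean p"
proof -
  define h where "h = mhermite 1 N"
  have dh: "degree h = N" "h \<noteq> 0" using degree_mhermite[of 1 N] N_pos by (auto simp: h_def)
  define r where "r = p mod h"
  define q where "q = p div h"
  have p: "p = h * q + r" by (simp add: q_def r_def mult.commute)
  have dr: "degree r < N"
    using degree_mod_less[of h p] dh N_pos by (auto simp: r_def)
  have "r = (\<Sum>j=1..N. smult (poly r (t j)) (lagrange j))"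
  proof (rule poly_eqI_degree[where A = "t ` {1..N}"])
    show "poly r x = poly (\<Sum>j=1..N. smult (poly r (t j)) (lagrange j)) x"
      if "x \<in> t ` {1..N}" for x
    proof -
      from that obtain i where i: "i \<in> {1..N}" "x = t i" by auto
      have "poly (\<Sum>j=1..N. smult (poly r (t j)) (lagrange j)) x
          = (\<Sum>j=1..N. if i = j then poly r (t j) else 0)"
        unfolding i(2) poly_sum by (intro sum.cong refl) (subst poly_smult, subst poly_lagrange[OF i(1)], auto)
      also have "\<dots> = poly r x" using i by (simp add: sum.delta)
      finally show ?thesis by simp
    qed
    have "degree (\<Sum>j=1..N. smult (poly r (t j)) (lagrange j)) \<le> N - 1"
      by (intro degree_sum_le order_trans[OF degree_smult_le]) (use degree_lagrange in fastforce)+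
    then show "degree (\<Sum>j=1..N. smult (poly r (t j)) (lagrange j)) < card (t ` {1..N})"
      using inj_t N_pos by (simp add: card_image)
    show "degree r < card (t ` {1..N})" using inj_t dr by (simp add: card_image)
  qed
  then have "gauss_mean r = (\<Sum>j=1..N. poly r (t j) * weight j)"
    unfolding weight_def by (metis (no_types, lifting) gauss_mean_def umbral_smult umbral_sum
      real_scaleR_def sum.cong)
  moreover have "gauss_mean (h * q) = 0"
  proof -
    have "degree q < N \<or> q = 0"
    proof (rule ccontr)
      assume *: "\<not> ?thesis"
      then have "degree (h * q) = N + degree q" using dh by (simp add: degree_mult_eq)
      moreover have "degree (h * q) < 2 * N"
        using degree_diff_less[of p "2 * N" r] assms dr by (simp add: p)
      ultimately show False using * by simp
    qed
    then show ?thesis unfolding h_def by (rule gauss_mean_mhermite_orthogonal)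
  qed
  moreover have "poly p (t j) = poly r (t j)" if "j \<in> {1..N}" for j
    using that hermite_t[of j] by (simp add: p h_def poly_mhermite hermite_eq_he)
  ultimately show ?thesis
    by (subst (2) p) (simp add: gauss_mean_simps mult.commute)
qed

text \<open>The square of a Lagrange polynomial still has degree below \<open>2 * N\<close>, so its
  mean is computed exactly and equals the weight.\<close>

lemma weight_nonneg:
  assumes "j \<in> {1..N}"
  shows "weight j \<ge> 0"
proof -
  have "degree (lagrange j * lagrange j) < 2 * N"
    using degree_mult_le[of "lagrange j" "lagrange j"] degree_lagrange[OF assms] by simp
  then have "gauss_mean (lagrange j * lagrange j)
      = (\<Sum>i=1..N. weight i * poly (lagrange j * lagrange j) (t i))"
    using quadrature_exact[of "lagrange j * lagrange j"] by simp
  also have "\<dots> = (\<Sum>i=1..N. if i = j then weight i else 0)"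
    by (intro sum.cong refl) (simp add: poly_lagrange[OF _ assms])
  also have "\<dots> = weight j" using assms by (simp add: sum.delta)
  finally show ?thesis using gauss_mean_square_nonneg by metis
qed

lemma sum_weight: "(\<Sum>j=1..N. weight j) = 1"
  using quadrature_exact[of 1] N_pos by (simp add: gauss_mean_simps)

lemma quadrature_he:
  assumes "1 \<le> n" "n < 2 * N"
  shows "(\<Sum>j=1..N. weight j * he 1 n (t j)) = 0"
  using quadrature_exact[of "mhermite 1 n"] assms
  by (simp add: degree_mhermite poly_mhermite gauss_mean_mhermite)

end

section \<open>Domination of the quadrature error\<close>

text \<open>Descending induction on \<open>k\<close>. The integrating factor
  \<open>exp (- 2 * t (Suc k) * x * e)\<close> removes the diagonal term of the complex equation,
  and its modulus does the same for the real one, because only \<open>Re e\<close> enters there.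
  What remains is to integrate the bound at \<open>Suc k\<close> from 0 to \<open>x\<close>.\<close>

lemma majorant:
  fixes \<phi> :: "nat \<Rightarrow> real \<Rightarrow> complex" and B :: "nat \<Rightarrow> real \<Rightarrow> real" and e :: complex
  assumes e: "cmod e = 1"
    and \<phi>': "\<And>k x. k < N \<Longrightarrow> (\<phi> k has_vector_derivative
        e * (2 * \<phi> (Suc k) x + 2 * of_real (t (Suc k)) * \<phi> k x)) (at x)"
    and B': "\<And>k x. k < N \<Longrightarrow> (B k has_real_derivative
        2 * B (Suc k) x + 2 * Re e * t (Suc k) * B k x) (at x)"
    and init: "\<And>k. k < N \<Longrightarrow> cmod (\<phi> k 0) \<le> B k 0"
    and top: "\<And>x. 0 \<le> x \<Longrightarrow> x \<le> R \<Longrightarrow> cmod (\<phi> N x) \<le> B N x"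
    and k: "k \<le> N" and x: "0 \<le> x" "x \<le> R"
  shows "cmod (\<phi> k x) \<le> B k x"
  using k x
proof (induction k arbitrary: x rule: inc_induct)
  case base
  then show ?case using top by simp
next
  case (step k)
  show ?case
  proof (cases "x = 0")
    case True
    then show ?thesis using init step.hyps by simp
  next
    case False
    then have "0 < x" using step.prems by simp
    define a where "a = - 2 * t (Suc k)"
    define f where "f y = exp (of_real y * (of_real a * e)) * \<phi> k y" for y
    define g where "g y = exp (y * (a * Re e)) * B k y" for y
    have df: "(f has_vector_derivative
        exp (of_real y * (of_real a * e)) * (e * 2 * \<phi> (Suc k) y)) (at y)" for y
    proof -
      have "((\<lambda>y. exp (of_real y * (of_real a * e))) has_vector_derivative
          of_real a * e * exp (of_real y * (of_real a * e))) (at y)"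
        by (rule has_vector_derivative_real_field) (auto intro!: derivative_eq_intros)
      from has_vector_derivative_mult[OF this \<phi>'[OF step.hyps(2)]]
      show ?thesis unfolding f_def
        by (rule has_vector_derivative_eq_rhs) (simp add: a_def algebra_simps)
    qed
    have dg: "(g has_vector_derivative exp (y * (a * Re e)) * (2 * B (Suc k) y)) (at y)" for y
      unfolding g_def has_real_derivative_iff_has_vector_derivative[symmetric]
      by (rule derivative_eq_intros B' step.hyps refl)+ (simp add: a_def algebra_simps)
    have "norm (f x - f 0) \<le> g x - g 0"
    proof (rule differentiable_bound_general[OF \<open>0 < x\<close>])
      show "continuous_on {0..x} f" "continuous_on {0..x} g"
        using df dg by (auto intro!: continuous_at_imp_continuous_on has_vector_derivative_continuous)
      show "(f has_vector_derivative exp (of_real y * (of_real a * e)) * (e * 2 * \<phi> (Suc k) y)) (at y)" for y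
        by (rule df)
      show "(g has_vector_derivative exp (y * (a * Re e)) * (2 * B (Suc k) y)) (at y)" for y
        by (rule dg)
      show "norm (exp (of_real y * (of_real a * e)) * (e * 2 * \<phi> (Suc k) y))
          \<le> exp (y * (a * Re e)) * (2 * B (Suc k) y)" if "0 < y" "y < x" for y
        using step.IH[of y] that step.prems e by (simp add: norm_mult)
    qed
    moreover have "norm (f 0) \<le> g 0" using init step.hyps by (simp add: f_def g_def)
    moreover have "norm (f x) \<le> norm (f x - f 0) + norm (f 0)" by norm
    ultimately have "norm (f x) \<le> g x" by linarith
    then show ?thesis by (simp add: f_def g_def norm_mult)
  qed
qed

section \<open>Ingredients of the explicit majorant\<close>

lemma umbral_has_field_derivative:
  fixes F :: "nat \<Rightarrow> 'a::real_normed_field \<Rightarrow> 'a"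
  assumes "\<And>i. (F i has_field_derivative 2 * F (Suc i) x) (at x)"
  shows "((\<lambda>x. umbral (\<lambda>i. F i x) p) has_field_derivative 2 * umbral (\<lambda>i. F (Suc i) x) p) (at x)"
  unfolding umbral_def scaleR_conv_of_real sum_distrib_left
  by (rule derivative_eq_intros assms refl)+ (simp add: mult_ac)

lemma node_poly_Suc: "node_poly {1..Suc k} t = [:- t (Suc k), 1:] * node_poly {1..k} t"
  by (simp add: node_poly_def prod.nat_ivl_Suc' mult.commute)

lemma umbral_node_poly_Suc:
  "umbral F (node_poly {1..Suc k} t)
    = umbral (\<lambda>i. F (Suc i)) (node_poly {1..k} t) - t (Suc k) *\<^sub>R umbral F (node_poly {1..k} t)"
proof -
  have "node_poly {1..Suc k} t = [:0, 1:] * node_poly {1..k} t - smult (t (Suc k)) (node_poly {1..k} t)"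
    unfolding node_poly_Suc by simp
  then show ?thesis by (simp only: umbral_diff umbral_smult umbral_mult_X)
qed

text \<open>\<^term>\<open>exp (s * x\<^sup>2) * gauss_leibniz s x F i m\<close> is the \<^term>\<open>i\<close>-th iterate of half the
  derivative, applied to \<^term>\<open>exp (s * x\<^sup>2) * F m\<close>, if \<^term>\<open>F (m + k)\<close> stands for the
  \<^term>\<open>k\<close>-th derivative at \<^term>\<open>x\<close> of \<^term>\<open>F m\<close>.\<close>

fun gauss_leibniz :: "real \<Rightarrow> real \<Rightarrow> (nat \<Rightarrow> real) \<Rightarrow> nat \<Rightarrow> nat \<Rightarrow> real" where
  "gauss_leibniz s x F 0 m = F m"
| "gauss_leibniz s x F (Suc 0) m = F (Suc m) / 2 + s * x * F m"
| "gauss_leibniz s x F (Suc (Suc i)) m = gauss_leibniz s x F (Suc i) (Suc m) / 2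
     + s * x * gauss_leibniz s x F (Suc i) m + real (Suc i) / 2 * s * gauss_leibniz s x F i m"

lemma gauss_leibniz_Suc:
  "gauss_leibniz s x F (Suc i) m = gauss_leibniz s x F i (Suc m) / 2
     + s * x * gauss_leibniz s x F i m + real i / 2 * s * gauss_leibniz s x F (i - 1) m"
  by (cases i) auto

lemma gauss_leibniz_eq_0: "(\<And>k. k \<le> m + i \<Longrightarrow> F k = 0) \<Longrightarrow> gauss_leibniz s x F i m = 0"
  by (induction s x F i m rule: gauss_leibniz.induct) auto

text \<open>Together with the recurrence this confirms the reading as an iterated half derivative:
  once multiplied by \<open>exp (s * x^2)\<close>, half the derivative is the step from
  \<open>i\<close> to \<open>Suc i\<close>.\<close>

lemma gauss_leibniz_has_real_derivative:
  assumes "\<And>m. (F m has_real_derivative F (Suc m) x) (at x)"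
  shows "((\<lambda>x. gauss_leibniz s x (\<lambda>k. F k x) i m) has_real_derivative
     gauss_leibniz s x (\<lambda>k. F k x) i (Suc m) + real i * s * gauss_leibniz s x (\<lambda>k. F k x) (i - 1) m) (at x)"
proof (induction i arbitrary: m rule: less_induct)
  case (less i)
  consider "i = 0" | "i = 1" | j where "i = Suc (Suc j)" by (metis One_nat_def not0_implies_Suc)
  then show ?case
  proof cases
    case 1
    then show ?thesis using assms by simp
  next
    case 2
    then show ?thesis
      by (auto intro!: derivative_eq_intros assms simp: algebra_simps)
  next
    case (3 j)
    have "((\<lambda>x. gauss_leibniz s x (\<lambda>k. F k x) (Suc j) (Suc m) / 2
     + s * x * gauss_leibniz s x (\<lambda>k. F k x) (Suc j) m + real (Suc j) / 2 * s * gauss_leibniz s x (\<lambda>k. F k x) j m)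
      has_real_derivative
      (gauss_leibniz s x (\<lambda>k. F k x) (Suc j) (Suc (Suc m)) + real (Suc j) * s * gauss_leibniz s x (\<lambda>k. F k x) j (Suc m)) / 2
      + s * gauss_leibniz s x (\<lambda>k. F k x) (Suc j) m
      + s * x * (gauss_leibniz s x (\<lambda>k. F k x) (Suc j) (Suc m) + real (Suc j) * s * gauss_leibniz s x (\<lambda>k. F k x) j m)
      + real (Suc j) / 2 * s * (gauss_leibniz s x (\<lambda>k. F k x) j (Suc m) + real j * s * gauss_leibniz s x (\<lambda>k. F k x) (j - 1) m)) (at x)"
      using less[of "Suc j" m] less[of "Suc j" "Suc m"] less[of j m] 3
      by (auto intro!: derivative_eq_intros simp: field_simps)
    then show ?thesis unfolding 3
      by (simp add: gauss_leibniz_Suc[of _ _ _ j] field_simps)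
  qed
qed

lemma umbral_gauss_leibniz_mult_X:
  "umbral (\<lambda>i. gauss_leibniz s x F i m) ([:0, 1:] * p)
    = umbral (\<lambda>i. gauss_leibniz s x F i (Suc m)) p / 2 + s * x * umbral (\<lambda>i. gauss_leibniz s x F i m) p
      + s / 2 * umbral (\<lambda>i. gauss_leibniz s x F i m) (pderiv p)"
  unfolding umbral_mult_X umbral_pderiv gauss_leibniz_Suc
  by (simp add: umbral_def sum_distrib_left sum.distrib sum_divide_distrib algebra_simps)

text \<open>Normal ordering: all the terms that half the derivative contributes besides \<^term>\<open>F (m + n)\<close>
  are nonnegative.\<close>

lemma umbral_gauss_leibniz_mhermite_ge:
  assumes "\<And>m. F m \<ge> 0" "s \<ge> 0" "x \<ge> 0"
  shows "umbral (\<lambda>i. gauss_leibniz s x F i m) (mhermite s n) \<ge> F (m + n) / 2 ^ n"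
proof (induction n arbitrary: m)
  case (Suc n)
  have eq: "umbral (\<lambda>i. gauss_leibniz s x F i m) (mhermite s (Suc n))
      = umbral (\<lambda>i. gauss_leibniz s x F i (Suc m)) (mhermite s n) / 2
        + s * x * umbral (\<lambda>i. gauss_leibniz s x F i m) (mhermite s n)"
    unfolding mhermite_Suc_pderiv by (simp only: umbral_diff umbral_smult umbral_gauss_leibniz_mult_X) simp
  have "0 \<le> F (m + n) / 2 ^ n" using assms by simp
  also have "\<dots> \<le> umbral (\<lambda>i. gauss_leibniz s x F i m) (mhermite s n)" by (rule Suc)
  finally have "0 \<le> s * x * umbral (\<lambda>i. gauss_leibniz s x F i m) (mhermite s n)" using assms by simp
  then show ?case unfolding eq using Suc[of "Suc m"] by simp
qed simp

text \<open>The Taylor remainder of \<open>exp\<close> vanishes to order \<open>n\<close> at 0, and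
  its derivatives are again such remainders, hence nonnegative on the half-line. The majorant needs
  the former for its initial values and the latter for normal ordering.\<close>

definition exp_tail :: "nat \<Rightarrow> real \<Rightarrow> real" where
  "exp_tail n x = exp x - (\<Sum>k<n. x ^ k / fact k)"

lemma exp_tail_0: "exp_tail 0 x = exp x"
  by (simp add: exp_tail_def)

lemma exp_tail_at_0: "n > 0 \<Longrightarrow> exp_tail n 0 = 0"
  by (simp add: exp_tail_def power_0_left if_distrib[of "\<lambda>x. x / _"] sum.delta cong: if_cong)

lemma exp_tail_has_real_derivative:
  "(exp_tail n has_real_derivative exp_tail (n - 1) x) (at x)"
proof (cases n)
  case 0
  then show ?thesis unfolding exp_tail_def by (auto intro!: derivative_eq_intros)
next
  case (Suc m)
  have "((\<lambda>x. exp x - (\<Sum>k<n. x ^ k / fact k)) has_real_derivative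
      exp x - (\<Sum>k<n. (real k * x ^ (k - 1)) / fact k)) (at x)"
    by (auto intro!: derivative_eq_intros)
  also have "(\<Sum>k<n. (real k * x ^ (k - 1)) / fact k) = (\<Sum>k<m. x ^ k / fact k)"
    unfolding Suc sum.lessThan_Suc_shift by (simp add: fact_Suc del: of_nat_Suc)
  finally show ?thesis using Suc by (simp add: exp_tail_def[abs_def])
qed

lemma exp_tail_nonneg: "x \<ge> 0 \<Longrightarrow> exp_tail n x \<ge> 0"
proof (induction n arbitrary: x)
  case (Suc n)
  have "exp_tail (Suc n) 0 \<le> exp_tail (Suc n) x"
    by (rule DERIV_nonneg_imp_nondecreasing[OF Suc.prems])
      (use exp_tail_has_real_derivative[of "Suc n"] Suc.IH in \<open>auto intro!: exI\<close>)
  then show ?case by (simp add: exp_tail_at_0)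
qed (simp add: exp_tail_0)

lemma exp_tail_le_exp: "x \<ge> 0 \<Longrightarrow> exp_tail n x \<le> exp x"
  by (simp add: exp_tail_def sum_nonneg)

text \<open>With \<open>s = x / R\<close> this is what remains of the comparison at the top of the
  chain once \<open>R\<close> and \<open>N\<close> are eliminated. The number 20/11 is the growth
  rate of the majorant in units of \<open>N / R\<close>; 23/100 is small enough for both
  \<open>(3 * 23/100)^2 < 24/50\<close> and \<open>(23/100)^6 * 3^8 < 1\<close>, which are used in
  the summation.\<close>

lemma cubic_bound:
  assumes "0 \<le> s" "s \<le> (1::real)"
  shows "2 * s * exp (20 / 11 * (1 - s) - 1) \<le> 23 / 100 * (20 / 11) * (2 + s\<^sup>2)"
proof -
  define d where "d = 20 / 11 * (1 - s) - 1"
  have pos: "1 - d > 0" using assms by (simp add: d_def field_simps)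
  have "1 + (- d) \<le> exp (- d)" by (rule exp_ge_add_one_self)
  then have "exp d * (1 - d) \<le> exp d * exp (- d)" by (intro mult_left_mono) auto
  also have "exp d * exp (- d) = 1" by (simp add: exp_minus)
  finally have "exp d \<le> 1 / (1 - d)" using pos by (simp add: field_simps)
  then have "2 * s * exp d \<le> 2 * s / (1 - d)" using assms mult_left_mono[of "exp d" "1 / (1 - d)" "2 * s"] by simp
  also have "\<dots> \<le> 23 / 100 * (20 / 11) * (2 + s\<^sup>2)"
  proof -
    have "2 * s \<le> 23 / 100 * (20 / 11) * (2 + s\<^sup>2) * (1 - d)"
    proof -
      \<comment> \<open>A cubic has to be nonnegative whose minimum on the interval is small and
        lies near 43/100. Twice this product plus a fifth of the next square stays below it.\<close>
      have "0 \<le> (s - 43/100)\<^sup>2 * (s + 86/100)" using assms by simp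
      moreover have "0 \<le> (s - 43/100)\<^sup>2" by simp
      moreover have "23 / 100 * (20 / 11) * (2 + s\<^sup>2) * (1 - d)
          = 46/121 * (2 * s ^ 3 + s\<^sup>2 / 5 + 2 / 5 + 4 * s)"
        by (simp add: d_def field_simps power2_eq_square power3_eq_cube)
      ultimately show ?thesis using assms
        by (simp add: power2_eq_square power3_eq_cube field_simps)
    qed
    then show ?thesis using pos by (simp add: field_simps)
  qed
  finally show ?thesis unfolding d_def .
qed


section \<open>The chain of quadrature errors and the two bounds on the generating function\<close>

context hermite_nodes
begin

text \<open>The error of the quadrature rule for \<^term>\<open>\<lambda>x. poly (node_poly {1..k} t) x * exp (2 * x * z)\<close>:
  the Gaussian mean of \<^term>\<open>x ^ i * exp (2 * x * z)\<close> is \<^term>\<open>exp (z\<^sup>2) * he (-1) i z\<close>.\<close>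

definition quad_err :: "nat \<Rightarrow> 'a::{real_normed_field,banach} \<Rightarrow> 'a" where
  "quad_err k z = umbral (\<lambda>i. exp (z\<^sup>2) * he (-1) i z) (node_poly {1..k} t)
     - (\<Sum>j=1..N. of_real (weight j * poly (node_poly {1..k} t) (t j)) * exp (2 * of_real (t j) * z))"

lemma exp_he_has_field_derivative:
  fixes z :: "'a::{real_normed_field,banach}"
  shows "((\<lambda>z. exp (z\<^sup>2) * he (-1) i z) has_field_derivative
    2 * (exp (z\<^sup>2) * he (-1) (Suc i) z)) (at z)"
  by (auto intro!: derivative_eq_intros he_has_field_derivative simp: he_Suc[of _ i] field_simps)

text \<open>Differentiating \<open>exp (2 * x * z)\<close> produces the factor
  \<open>2 * x = 2 * (x - t (Suc k)) + 2 * t (Suc k)\<close>: the first part appends the next node,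
  the second returns the same error.\<close>

lemma quad_err_has_field_derivative:
  fixes z :: "'a::{real_normed_field,banach}"
  shows "(quad_err k has_field_derivative
    2 * quad_err (Suc k) z + 2 * of_real (t (Suc k)) * quad_err k z) (at z)"
proof -
  have "((\<lambda>z. umbral (\<lambda>i. exp (z\<^sup>2) * he (-1) i z) (node_poly {1..k} t)) has_field_derivative
      2 * umbral (\<lambda>i. exp (z\<^sup>2) * he (-1) (Suc i) z) (node_poly {1..k} t)) (at z)"
    by (rule umbral_has_field_derivative) (rule exp_he_has_field_derivative)
  moreover have "((\<lambda>z. \<Sum>j=1..N. of_real (weight j * poly (node_poly {1..k} t) (t j)) * exp (2 * of_real (t j) * z))
    has_field_derivative (\<Sum>j=1..N. of_real (weight j * poly (node_poly {1..k} t) (t j)) *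
       (2 * of_real (t j) * exp (2 * of_real (t j) * z)))) (at z)"
    by (auto intro!: derivative_eq_intros simp: mult_ac)
  ultimately have "(quad_err k has_field_derivative
      2 * umbral (\<lambda>i. exp (z\<^sup>2) * he (-1) (Suc i) z) (node_poly {1..k} t)
      - (\<Sum>j=1..N. of_real (weight j * poly (node_poly {1..k} t) (t j)) *
       (2 * of_real (t j) * exp (2 * of_real (t j) * z)))) (at z)"
    unfolding quad_err_def by (rule DERIV_diff)
  moreover have "2 * quad_err (Suc k) z + 2 * of_real (t (Suc k)) * quad_err k z
    = 2 * umbral (\<lambda>i. exp (z\<^sup>2) * he (-1) (Suc i) z) (node_poly {1..k} t)
      - (\<Sum>j=1..N. of_real (weight j * poly (node_poly {1..k} t) (t j)) *
       (2 * of_real (t j) * exp (2 * of_real (t j) * z)))"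
  proof -
    define a where "a j = (of_real (weight j * poly (node_poly {1..k} t) (t j)) * exp (2 * of_real (t j) * z) :: 'a)" for j
    have 1: "(\<Sum>j=1..N. of_real (weight j * poly (node_poly {1..Suc k} t) (t j)) * exp (2 * of_real (t j) * z))
        = (\<Sum>j=1..N. of_real (t j) * a j) - of_real (t (Suc k)) * (\<Sum>j=1..N. a j)"
      unfolding node_poly_Suc sum_distrib_left sum_subtractf[symmetric] a_def
      by (intro sum.cong refl) (simp add: algebra_simps)
    have 2: "(\<Sum>j=1..N. of_real (weight j * poly (node_poly {1..k} t) (t j)) *
       (2 * of_real (t j) * exp (2 * of_real (t j) * z))) = 2 * (\<Sum>j=1..N. of_real (t j) * a j)"
      unfolding sum_distrib_left a_def by (intro sum.cong refl) (simp add: mult_ac)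
    show ?thesis
      unfolding quad_err_def umbral_node_poly_Suc 1 2 a_def[symmetric] scaleR_conv_of_real
      by (simp add: algebra_simps)
  qed
  ultimately show ?thesis by simp
qed

text \<open>Exactness up to degree \<open>2 * N - 1\<close> gives zero initial values to the whole
  chain and not only to its first member.\<close>

lemma quad_err_0:
  assumes "k < 2 * N"
  shows "quad_err k 0 = (0 :: 'a::{real_normed_field,banach})"
proof -
  have "he (-1) i (0::'a) = of_real (he (-1) i 0)" for i
    using he_of_real[of "-1" i 0, where 'a = 'a] by simp
  then have "umbral (\<lambda>i. exp (0\<^sup>2) * he (-1) i 0) (node_poly {1..k} t)
      = (of_real (gauss_mean (node_poly {1..k} t)) :: 'a)"
    by (simp add: gauss_mean_def umbral_def scaleR_conv_of_real)
  moreover have "gauss_mean (node_poly {1..k} t)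
      = (\<Sum>j=1..N. weight j * poly (node_poly {1..k} t) (t j))"
    by (rule quadrature_exact[symmetric]) (use assms in \<open>simp add: degree_node_poly\<close>)
  ultimately show ?thesis by (simp add: quad_err_def)
qed

text \<open>The polynomial of all nodes kills the quadrature sum and is the Hermite polynomial,
  whose mean against the exponential is explicit.\<close>

lemma quad_err_N: "quad_err N z = exp (z\<^sup>2) * z ^ N"
proof -
  have "umbral (\<lambda>i. exp (z\<^sup>2) * he (-1) i z) (node_poly {1..N} t)
      = exp (z\<^sup>2) * umbral (\<lambda>i. he (-1) i z) (mhermite 1 N)"
    unfolding mhermite_eq_node_poly by (simp add: umbral_def sum_distrib_left)
  moreover have "poly (node_poly {1..N} t) (t j) = 0" if "j \<in> {1..N}" for j
    using that by (auto simp: poly_node_poly)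
  ultimately show ?thesis by (simp add: quad_err_def umbral_he_minus1_mhermite)
qed

lemma quad_err_zeroth:
  "quad_err 0 z = exp (z\<^sup>2) - (\<Sum>j=1..N. of_real (weight j) * exp (2 * of_real (t j) * z))"
  by (simp add: quad_err_def node_poly_def)

text \<open>This says \<open>quad_err 0 u \<ge> 0\<close>. In \<open>majorant\<close> the dominated
  family is zero and the quadrature errors themselves form \<open>B\<close>. For negative
  \<open>u\<close> the ray is reflected, and the sign \<open>e ^ k\<close> restores the form of the
  equations and the sign at the top.\<close>

lemma quadrature_exp_le:
  fixes u :: real
  shows "(\<Sum>j=1..N. weight j * exp (2 * t j * u)) \<le> exp (u\<^sup>2)"
proof -
  define e :: real where "e = (if u \<ge> 0 then 1 else -1)"
  have e: "e * e = 1" "Re (of_real e) = e" "cmod (of_real e) = 1" "u = e * \<bar>u\<bar>" by (auto simp: e_def)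
  define B where "B k x = e ^ k * quad_err k (e * x)" for k x
  have "cmod 0 \<le> B 0 \<bar>u\<bar>"
  proof (rule majorant[where e = "of_real e" and \<phi> = "\<lambda>_ _. 0" and B = B and N = N and R = "\<bar>u\<bar>" and t = t])
    show "(B k has_real_derivative 2 * B (Suc k) x + 2 * Re (of_real e) * t (Suc k) * B k x) (at x)" for k x
    proof -
      have "((\<lambda>x. quad_err k (e * x)) has_real_derivative
          (2 * quad_err (Suc k) (e * x) + 2 * t (Suc k) * quad_err k (e * x)) * e) (at x)"
        using quad_err_has_field_derivative[of k "e * x"]
        by (intro DERIV_chain2) (auto intro!: derivative_eq_intros)
      from DERIV_cmult[OF this, of "e ^ k"] show ?thesis
        unfolding B_def by (rule DERIV_cong) (simp add: e algebra_simps)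
    qed
    show "cmod 0 \<le> B k 0" if "k < N" for k using that by (simp add: B_def quad_err_0)
    show "cmod 0 \<le> B N x" if "0 \<le> x" for x
    proof -
      have "B N x = (e * e) ^ N * x ^ N * exp ((e * x)\<^sup>2)"
        by (simp add: B_def quad_err_N power_mult_distrib)
      then show ?thesis using that e by simp
    qed
  qed (use e in auto)
  then show ?thesis using e(4) by (simp add: B_def quad_err_zeroth)
qed

text \<open>As \<open>exp (2 * t * z - z^2)\<close> generates the numbers
  \<open>2^n * he 1 n t / fact n\<close>, and the weights sum to 1, subtracting 1 removes exactly
  the constant coefficient.\<close>

definition gen_dev :: "complex \<Rightarrow> complex" where
  "gen_dev z = (\<Sum>j=1..N. of_real (weight j) * exp (2 * of_real (t j) * z - z\<^sup>2)) - 1"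

lemma gen_dev_eq: "gen_dev z = - exp (- (z\<^sup>2)) * quad_err 0 z"
  by (simp add: gen_dev_def quad_err_zeroth exp_diff exp_minus field_simps sum_distrib_left)

text \<open>With nonnegative weights, taking moduli inside the sum gives the same quadrature sum at
  the real point \<open>Re z\<close>.\<close>

lemma norm_gen_dev_le_two_exp: "cmod (gen_dev z) \<le> 2 * exp ((cmod z)\<^sup>2)"
proof -
  have z2: "Re (z\<^sup>2) = (Re z)\<^sup>2 - (Im z)\<^sup>2" by (simp add: power2_eq_square)
  have "cmod (gen_dev z) \<le> cmod (\<Sum>j=1..N. of_real (weight j) * exp (2 * of_real (t j) * z - z\<^sup>2)) + 1"
    unfolding gen_dev_def by (rule order_trans[OF norm_triangle_ineq4]) simp
  also have "cmod (\<Sum>j=1..N. of_real (weight j) * exp (2 * of_real (t j) * z - z\<^sup>2))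
      \<le> (\<Sum>j=1..N. weight j * exp (2 * t j * Re z - Re (z\<^sup>2)))"
    by (rule sum_norm_le) (auto simp: norm_mult weight_nonneg)
  also have "\<dots> = exp (- Re (z\<^sup>2)) * (\<Sum>j=1..N. weight j * exp (2 * t j * Re z))"
    by (simp add: sum_distrib_left exp_diff exp_minus field_simps)
  also have "\<dots> \<le> exp (- Re (z\<^sup>2)) * exp ((Re z)\<^sup>2)"
    by (intro mult_left_mono quadrature_exp_le) auto
  also have "\<dots> = exp ((Im z)\<^sup>2)" by (simp add: z2 flip: exp_add)
  also have "\<dots> \<le> exp ((cmod z)\<^sup>2)" by (simp add: cmod_power2)
  also have "1 \<le> exp ((cmod z)\<^sup>2)" by simp
  finally show ?thesis by simp
qed

text \<open>Only \<open>c = Re e\<close> of the direction \<open>e\<close> of the ray enters the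
  real chain, whose nodes are the \<open>c * t j\<close>. Any \<open>V\<close> for which the
  derivative of \<open>V i\<close> is \<open>2 * V (Suc i)\<close> yields a solution
  \<open>B\<close>; here \<open>V i\<close> is the iterated half derivative of
  \<open>exp (c^2 * x^2) * F 0\<close>. At the top the node polynomial is the Hermite polynomial
  with parameter \<open>c^2\<close>, so normal ordering bounds \<open>B N\<close> from below by the
  explicit \<open>exp (c^2 * x^2) * F N / 2^N\<close>.\<close>

lemma norm_gen_dev_le:
  assumes "z \<noteq> 0"
  shows "cmod (gen_dev z) \<le> (23/100) ^ N * exp (3 * (cmod z)\<^sup>2)"
proof -
  define R where "R = cmod z"
  define e where "e = z / of_real R"
  define c where "c = Re e"
  define p where "p = 20 / 11 * real N / R"
  \<comment> \<open>This choice makes the final value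
    \<open>exp (c^2 * R^2) * K * exp (p * R)\<close> equal to
    \<open>(23/100)^N * exp ((2 + 2 * c^2) * R^2)\<close>. Division by the modulus
    \<open>exp ((2 * c^2 - 1) * R^2)\<close> of \<open>exp (z^2)\<close> then leaves
    \<open>exp (3 * R^2)\<close> in every direction.\<close>
  define K where "K = (23/100) ^ N * exp ((2 + c\<^sup>2) * R\<^sup>2 - p * R)"
  have R: "R > 0" using assms by (simp add: R_def)
  have p: "p > 0" using R N_pos by (simp add: p_def)
  have K: "K > 0" by (simp add: K_def)
  have e: "cmod e = 1" "z = of_real R * e" using R by (auto simp: e_def norm_divide R_def)
  have c: "c\<^sup>2 \<le> 1" using abs_Re_le_cmod[of e] e by (simp add: c_def abs_square_le_1)
  have e2: "Re (e\<^sup>2) = 2 * c\<^sup>2 - 1"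
    using cmod_power2[of e] e(1) by (simp add: c_def power2_eq_square)
  define F where "F m x = K * p ^ m * exp_tail (N - m) (p * x)" for m x
  have F': "(F m has_real_derivative F (Suc m) x) (at x)" for m x
  proof -
    have "((\<lambda>x. exp_tail (N - m) (p * x)) has_real_derivative exp_tail (N - m - 1) (p * x) * p) (at x)"
      by (rule DERIV_chain2[OF exp_tail_has_real_derivative]) (auto intro!: derivative_eq_intros)
    from DERIV_cmult[OF this, of "K * p ^ m"] show ?thesis
      unfolding F_def by (rule DERIV_cong) (simp add: algebra_simps)
  qed
  define V where "V i x = exp (c\<^sup>2 * x\<^sup>2) * gauss_leibniz (c\<^sup>2) x (\<lambda>m. F m x) i 0" for i x
  have V': "(V i has_real_derivative 2 * V (Suc i) x) (at x)" for i x
    unfolding V_def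
    by (rule derivative_eq_intros gauss_leibniz_has_real_derivative F' refl)+
      (simp add: gauss_leibniz_Suc[of _ _ _ i] algebra_simps)
  define B where "B k x = umbral (\<lambda>i. V i x) (node_poly {1..k} (\<lambda>j. c * t j))" for k x
  have "cmod (quad_err 0 (of_real R * e)) \<le> B 0 R"
  proof (rule majorant[where e = e and \<phi> = "\<lambda>k x. quad_err k (of_real x * e)" and B = B and N = N and R = R and t = t])
    show "((\<lambda>x. quad_err k (of_real x * e)) has_vector_derivative
        e * (2 * quad_err (Suc k) (of_real x * e) + 2 * of_real (t (Suc k)) * quad_err k (of_real x * e))) (at x)" for k x
    proof -
      have "((\<lambda>x. quad_err k (x * e)) has_field_derivative
          (2 * quad_err (Suc k) (of_real x * e) + 2 * of_real (t (Suc k)) * quad_err k (of_real x * e)) * e) (at (of_real x))"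
        by (rule DERIV_chain2[OF quad_err_has_field_derivative]) (auto intro!: derivative_eq_intros)
      from has_vector_derivative_real_field[OF this] show ?thesis by (simp add: mult.commute)
    qed
    show "(B k has_real_derivative 2 * B (Suc k) x + 2 * Re e * t (Suc k) * B k x) (at x)" for k x
      unfolding B_def umbral_node_poly_Suc
      by (rule DERIV_cong, rule umbral_has_field_derivative, rule V') (simp add: c_def algebra_simps)
    show "cmod (quad_err k (of_real 0 * e)) \<le> B k 0" if "k < N" for k
    proof -
      \<comment> \<open>At 0, \<open>V i\<close> involves only \<open>F m\<close> with
        \<open>m \<le> i < N\<close>, and these are remainders of positive order.\<close>
      have "V i 0 = 0" if "i \<le> k" for i
        unfolding V_def using that \<open>k < N\<close>
        by (subst gauss_leibniz_eq_0) (auto simp: F_def exp_tail_at_0)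
      then have "B k 0 = 0" by (simp add: B_def umbral_def degree_node_poly)
      then show ?thesis using that by (simp add: quad_err_0)
    qed
    show "cmod (quad_err N (of_real x * e)) \<le> B N x" if x: "0 \<le> x" "x \<le> R" for x
    proof -
      have np: "node_poly {1..N} (\<lambda>j. c * t j) = mhermite (c\<^sup>2) N"
      proof -
        have "poly (node_poly {1..N} (\<lambda>j. c * t j)) y = poly (mhermite (c\<^sup>2) N) y" for y
        proof (cases "c = 0")
          case True
          then show ?thesis by (simp add: poly_node_poly poly_mhermite he_0)
        next
          case False
          have "(\<Prod>i = 1..N. y - c * t i) = (\<Prod>i = 1..N. c * (y / c - t i))"
            using False by (intro prod.cong) (auto simp: field_simps)
          also have "\<dots> = c ^ N * poly (node_poly {1..N} t) (y / c)"
            by (simp add: prod.distrib poly_node_poly)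
          also have "\<dots> = he (c\<^sup>2) N (c * (y / c))"
            unfolding mhermite_eq_node_poly[symmetric] poly_mhermite by (rule he_scale[symmetric])
          finally show ?thesis using False by (simp add: poly_node_poly poly_mhermite)
        qed
        then show ?thesis by (simp add: poly_eq_poly_eq_iff[symmetric] fun_eq_iff)
      qed
      define s where "s = x / R"
      have s: "0 \<le> s" "s \<le> 1" "x = s * R" using x R by (auto simp: s_def)
      define k where "k = R\<^sup>2 / real N"
      have k: "k > 0" "R\<^sup>2 = k * real N" using R N_pos by (auto simp: k_def)
      have "cmod (quad_err N (of_real x * e)) = exp (x\<^sup>2 * (2 * c\<^sup>2 - 1)) * x ^ N"
        using x e by (simp add: quad_err_N norm_mult norm_power power_mult_distrib e2 del: Re_power2 flip: of_real_power)
      also have "\<dots> = exp (x\<^sup>2 * (2 * c\<^sup>2 - 1)) * ((x / p) ^ N * p ^ N)"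
        using p by (simp add: power_divide)
      also have "\<dots> \<le> exp (x\<^sup>2 * (2 * c\<^sup>2 - 1)) * ((23/200) ^ N * exp (2 * R\<^sup>2 + x\<^sup>2 - p * (R - x)) * p ^ N)"
      proof (intro mult_left_mono mult_right_mono)
        show "(x / p) ^ N \<le> (23/200) ^ N * exp (2 * R\<^sup>2 + x\<^sup>2 - p * (R - x))"
        proof -
        \<comment> \<open>The \<open>N\<close>-th root of the claim. Since \<open>x / p\<close> is
          \<open>11/20 * k * s\<close>, the tangent bound \<open>y \<le> exp (y - 1)\<close> at
          \<open>y = k * (2 + s^2)\<close> eliminates \<open>k\<close> and leaves
          \<open>cubic_bound\<close>. The denominator 200 anticipates the division by
          \<open>2 ^ N\<close> in normal ordering.\<close>
        have "x / p \<le> 23/200 * exp (k * (2 + s\<^sup>2) - 20/11 * (1 - s))"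
        proof -
          have "20 / 11 * (x / p) * exp (20/11 * (1 - s) - 1) = k * (s * exp (20/11 * (1 - s) - 1))"
            using R N_pos by (simp add: p_def s(3) k_def power2_eq_square field_simps)
          also have "\<dots> \<le> k * (23/200 * (20/11) * (2 + s\<^sup>2))"
            using cubic_bound[OF s(1,2)] k by (intro mult_left_mono) auto
          also have "\<dots> = 23/200 * (20/11) * (k * (2 + s\<^sup>2))" by simp
          also have "\<dots> \<le> 23/200 * (20/11) * exp (k * (2 + s\<^sup>2) - 1)"
            using exp_ge_add_one_self[of "k * (2 + s\<^sup>2) - 1"] by simp
          finally have "20 / 11 * (x / p * exp (20/11 * (1 - s) - 1)) \<le> 20 / 11 * (23/200 * exp (k * (2 + s\<^sup>2) - 1))"
            by (simp only: mult.assoc mult.left_commute)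
          then have "x / p * exp (20/11 * (1 - s) - 1) \<le> 23/200 * exp (k * (2 + s\<^sup>2) - 1)"
            by (rule mult_left_le_imp_le) simp
          then have "x / p * exp (20/11 * (1 - s) - 1) * exp (1 - 20/11 * (1 - s))
              \<le> 23/200 * exp (k * (2 + s\<^sup>2) - 1) * exp (1 - 20/11 * (1 - s))"
            by (rule mult_right_mono) simp
          then show ?thesis by (simp only: mult.assoc exp_add[symmetric]) simp
        qed
        then have "(x / p) ^ N \<le> (23/200 * exp (k * (2 + s\<^sup>2) - 20/11 * (1 - s))) ^ N"
          using x p by (intro power_mono) auto
        also have "\<dots> = (23/200) ^ N * exp (real N * (k * (2 + s\<^sup>2) - 20/11 * (1 - s)))"
          by (simp only: power_mult_distrib exp_of_nat_mult)
        also have "real N * (k * (2 + s\<^sup>2) - 20/11 * (1 - s)) = 2 * R\<^sup>2 + x\<^sup>2 - p * (R - x)"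
        proof -
          have pR: "p * R = 20 / 11 * real N" using R by (simp add: p_def)
          have "real N * (k * (2 + s\<^sup>2) - 20/11 * (1 - s))
              = (k * real N) * (2 + s\<^sup>2) - (20 / 11 * real N) * (1 - s)"
            by (simp add: algebra_simps)
          also have "\<dots> = R\<^sup>2 * (2 + s\<^sup>2) - p * R * (1 - s)"
            unfolding k(2)[symmetric] pR ..
          finally show ?thesis by (simp add: s(3) algebra_simps power_mult_distrib)
        qed
        finally show ?thesis .
        qed
      qed (use p in auto)
      also have "\<dots> \<le> exp (c\<^sup>2 * x\<^sup>2) * (F N x / 2 ^ N)"
      proof -
        \<comment> \<open>After cancellation the two exponents below differ exactly by
          \<open>c^2 * (R^2 - x^2)\<close>.\<close>
        have "c\<^sup>2 * x\<^sup>2 \<le> c\<^sup>2 * R\<^sup>2" using x by (intro mult_left_mono power_mono) auto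
        then have "exp (x\<^sup>2 * (2 * c\<^sup>2 - 1) + (2 * R\<^sup>2 + x\<^sup>2 - p * (R - x)))
            \<le> exp (c\<^sup>2 * x\<^sup>2 + ((2 + c\<^sup>2) * R\<^sup>2 - p * R + p * x))"
          by (simp add: algebra_simps)
        then have "((23/100) ^ N / 2 ^ N * p ^ N) * exp (x\<^sup>2 * (2 * c\<^sup>2 - 1) + (2 * R\<^sup>2 + x\<^sup>2 - p * (R - x)))
            \<le> ((23/100) ^ N / 2 ^ N * p ^ N) * exp (c\<^sup>2 * x\<^sup>2 + ((2 + c\<^sup>2) * R\<^sup>2 - p * R + p * x))"
          using p by (intro mult_left_mono) auto
        moreover have "(23/200 :: real) ^ N = (23/100) ^ N / 2 ^ N" by (simp flip: power_divide)
        ultimately show ?thesis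
          by (simp only: F_def K_def exp_tail_0 diff_self_eq_0 exp_add) (simp add: mult_ac)
      qed
      also have "exp (c\<^sup>2 * x\<^sup>2) * (F N x / 2 ^ N)
          \<le> exp (c\<^sup>2 * x\<^sup>2) * umbral (\<lambda>i. gauss_leibniz (c\<^sup>2) x (\<lambda>m. F m x) i 0) (mhermite (c\<^sup>2) N)"
        using umbral_gauss_leibniz_mhermite_ge[of "\<lambda>m. F m x" "c\<^sup>2" x 0 N] x p K
        by (intro mult_left_mono) (auto simp: F_def exp_tail_nonneg)
      also have "\<dots> = B N x"
        unfolding B_def np V_def umbral_def by (simp add: sum_distrib_left mult_ac)
      finally show ?thesis .
    qed
  qed (simp_all add: e(1) R less_imp_le)
  also have "B 0 R = exp (c\<^sup>2 * R\<^sup>2) * F 0 R" by (simp add: B_def node_poly_def V_def)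
  also have "\<dots> \<le> exp (c\<^sup>2 * R\<^sup>2) * (K * exp (p * R))"
    using K p R by (intro mult_left_mono) (auto simp: F_def exp_tail_le_exp)
  also have "\<dots> = (23/100) ^ N * exp ((2 + 2 * c\<^sup>2) * R\<^sup>2)"
    by (simp add: K_def algebra_simps flip: exp_add)
  finally have "cmod (quad_err 0 z) \<le> (23/100) ^ N * exp ((2 + 2 * c\<^sup>2) * R\<^sup>2)"
    unfolding e(2)[symmetric] .
  then have "exp (- (R\<^sup>2 * (2 * c\<^sup>2 - 1))) * cmod (quad_err 0 z)
      \<le> exp (- (R\<^sup>2 * (2 * c\<^sup>2 - 1))) * ((23/100) ^ N * exp ((2 + 2 * c\<^sup>2) * R\<^sup>2))"
    by (intro mult_left_mono) auto
  also have "\<dots> = (23/100) ^ N * exp (3 * R\<^sup>2)"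
    by (simp add: algebra_simps flip: exp_add)
  also have "exp (- (R\<^sup>2 * (2 * c\<^sup>2 - 1))) * cmod (quad_err 0 z) = cmod (gen_dev z)"
  proof -
    have "Re (z\<^sup>2) = R\<^sup>2 * (2 * c\<^sup>2 - 1)"
      by (simp add: e(2) power_mult_distrib e2 del: Re_power2 flip: of_real_power)
    then show ?thesis by (simp add: gen_dev_eq norm_mult del: Re_power2)
  qed
  finally show ?thesis by (simp add: R_def)
qed

end

section \<open>Quadrature values of Hermite polynomials\<close>

lemma deriv_funpow_hermite_gen:
  fixes x :: complex
  shows "(deriv ^^ n) (\<lambda>z. exp (2 * x * z - z\<^sup>2)) = (\<lambda>z. 2 ^ n * he 1 n (x - z) * exp (2 * x * z - z\<^sup>2))"
proof (induction n)
  case (Suc n)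
  have "deriv (\<lambda>z. 2 ^ n * he 1 n (x - z) * exp (2 * x * z - z\<^sup>2)) z
      = 2 ^ Suc n * he 1 (Suc n) (x - z) * exp (2 * x * z - z\<^sup>2)" for z
    by (rule DERIV_imp_deriv)
       (auto intro!: derivative_eq_intros DERIV_chain2[OF he_has_field_derivative]
         simp: he_Suc[of _ n] algebra_simps)
  then show ?case using Suc by auto
qed auto

text \<open>Stirling's bound with a linear factor in place of the square root; the induction step
  amounts to \<open>(n / (n+1))^(n+1) \<le> exp (-1)\<close>.\<close>

lemma fact_mult_exp_le:
  assumes "n \<ge> 1"
  shows "fact n * exp (real n) \<le> exp 1 * real n * real n ^ n"
  using assms
proof (induction n rule: dec_induct)
  case (step n)
  have "real n / real (Suc n) \<le> exp (- (1 / real (Suc n)))"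
    using exp_ge_add_one_self[of "- (1 / real (Suc n))"] by (simp add: field_simps)
  then have "(real n / real (Suc n)) ^ Suc n \<le> exp (- (1 / real (Suc n))) ^ Suc n"
    by (intro power_mono) auto
  also have "\<dots> = exp (- 1)"
    by (simp only: exp_of_nat_mult[symmetric]) (simp del: of_nat_Suc)
  finally have *: "(real n / real (Suc n)) ^ Suc n \<le> exp (- 1)" .
  have "exp 1 * real n ^ Suc n \<le> real (Suc n) ^ Suc n"
  proof -
    have "exp 1 * a \<le> b" if "a / b \<le> exp (- 1)" "b > 0" for a b :: real
      using that by (simp add: exp_minus field_simps)
    then show ?thesis using * unfolding power_divide by simp
  qed
  then have "exp 1 * real (Suc n) * (exp 1 * real n ^ Suc n) \<le> exp 1 * real (Suc n) * real (Suc n) ^ Suc n"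
    by (intro mult_left_mono) auto
  moreover have "fact (Suc n) * exp (real (Suc n)) = real (Suc n) * exp 1 * (fact n * exp (real n))"
    by (simp add: exp_add algebra_simps)
  moreover have "\<dots> \<le> real (Suc n) * exp 1 * (exp 1 * real n * real n ^ n)"
    using step.IH by (intro mult_left_mono) auto
  ultimately show ?case by (simp add: algebra_simps)
qed simp

text \<open>Cauchy's inequality on the circle of radius \<^term>\<open>sqrt (r * real n)\<close>.\<close>

lemma coeff_bound_circle:
  fixes f :: "complex \<Rightarrow> complex"
  assumes "f holomorphic_on UNIV" "n \<ge> 1" "r > 0" "B \<ge> 0"
    and le: "\<And>z. (cmod z)\<^sup>2 = r * real n \<Longrightarrow> cmod (f z) \<le> B * exp ((1/2) * real n)"
  shows "(cmod ((deriv ^^ n) f 0))\<^sup>2 / (2 ^ n * fact n) \<le> B\<^sup>2 / (2 * r) ^ n * exp 1 * real n"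
proof -
  define R where "R = sqrt (r * real n)"
  have R: "R > 0" "R\<^sup>2 = r * real n" using assms by (auto simp: R_def)
  have "cmod ((deriv ^^ n) f 0) \<le> fact n * (B * exp ((1/2) * real n)) / R ^ n"
  proof (rule Cauchy_inequality)
    show "f holomorphic_on ball 0 R" "continuous_on (cball 0 R) f"
      using assms(1) by (auto intro: holomorphic_on_subset holomorphic_on_imp_continuous_on)
    show "cmod (f x) \<le> B * exp ((1/2) * real n)" if "cmod (0 - x) = R" for x
      using that R by (intro le) simp
  qed (use R in auto)
  then have "(cmod ((deriv ^^ n) f 0))\<^sup>2 \<le> (fact n * (B * exp ((1/2) * real n)) / R ^ n)\<^sup>2"
    by (intro power_mono) auto
  also have "\<dots> = (fact n)\<^sup>2 * B\<^sup>2 * exp (real n) / (r * real n) ^ n"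
  proof -
    have "(exp ((1/2) * real n))\<^sup>2 = exp (real n)" by (simp flip: exp_double)
    moreover have "(R ^ n)\<^sup>2 = (r * real n) ^ n" 
      by (simp only: R(2)[symmetric] power_mult[symmetric] mult.commute)
    ultimately show ?thesis by (simp add: power_mult_distrib power_divide)
  qed
  finally have "(cmod ((deriv ^^ n) f 0))\<^sup>2 / (2 ^ n * fact n)
      \<le> (fact n)\<^sup>2 * B\<^sup>2 * exp (real n) / (r * real n) ^ n / (2 ^ n * fact n)"
    by (rule divide_right_mono) simp
  also have "\<dots> = (B\<^sup>2 / (2 * r) ^ n) / real n ^ n * (fact n * exp (real n))"
    using assms by (simp add: field_simps power2_eq_square power_mult_distrib)
  also have "\<dots> \<le> (B\<^sup>2 / (2 * r) ^ n) / real n ^ n * (exp 1 * real n * real n ^ n)"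
    using assms fact_mult_exp_le[of n] by (intro mult_left_mono) auto
  also have "\<dots> = B\<^sup>2 / (2 * r) ^ n * exp 1 * real n"
    using assms by simp
  finally show ?thesis .
qed

text \<open>Cauchy's inequality for the generating function gives growth like
  \<open>exp (2 * |x| * sqrt (2 * n))\<close>. Completing a square trades this for an arbitrarily
  small exponential rate, enough for the convergence of Mehler's series.\<close>

lemma he_square_bound:
  fixes x :: real
  assumes "\<epsilon> > 0"
  shows "2 ^ n / fact n * (he 1 n x)\<^sup>2 \<le> exp 1 * exp (2 * x\<^sup>2 / \<epsilon>) * ((real n + 1) * exp \<epsilon> ^ n)"
proof (cases "n = 0")
  case True
  then show ?thesis using assms by (simp flip: exp_add)
next
  case False
  define f where "f z = exp (2 * of_real x * z - z\<^sup>2)" for z :: complex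
  define B where "B = exp (\<bar>x\<bar> * sqrt (2 * real n))"
  have "(deriv ^^ n) f 0 = of_real (2 ^ n * he 1 n x)"
    unfolding f_def deriv_funpow_hermite_gen using he_of_real[of 1 n x, where 'a = complex] by simp
  then have "(2 ^ n * he 1 n x)\<^sup>2 / (2 ^ n * fact n) = (cmod ((deriv ^^ n) f 0))\<^sup>2 / (2 ^ n * fact n)"
    by (simp add: norm_mult power_mult_distrib norm_power)
  also have "\<dots> \<le> B\<^sup>2 / (2 * (1/2)) ^ n * exp 1 * real n"
  proof (rule coeff_bound_circle)
    show "f holomorphic_on UNIV" unfolding f_def by (intro holomorphic_intros)
    show "cmod (f z) \<le> B * exp (1/2 * real n)" if "(cmod z)\<^sup>2 = 1/2 * real n" for z
    proof -
      have cz: "2 * cmod z = sqrt (2 * real n)"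
        by (rule real_sqrt_unique[symmetric]) (use that in \<open>auto simp: power_mult_distrib\<close>)
      have "cmod (f z) = exp (Re (2 * of_real x * z) - Re (z\<^sup>2))"
        by (simp only: f_def norm_exp_eq_Re minus_complex.sel)
      moreover have "Re (2 * of_real x * z) \<le> \<bar>x\<bar> * (2 * cmod z)"
        using complex_Re_le_cmod[of "2 * of_real x * z"] by (simp add: norm_mult mult_ac)
      moreover have "- Re (z\<^sup>2) \<le> (cmod z)\<^sup>2"
        using abs_Re_le_cmod[of "z\<^sup>2"] by (simp add: norm_power del: Re_power2)
      ultimately have "cmod (f z) \<le> exp (\<bar>x\<bar> * (2 * cmod z) + (cmod z)\<^sup>2)" by (simp del: Re_power2)
      then show ?thesis by (simp only: cz that exp_add B_def)
    qed
  qed (use False in \<open>auto simp: B_def\<close>)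
  also have "(2 ^ n * he 1 n x)\<^sup>2 / (2 ^ n * fact n) = 2 ^ n / fact n * (he 1 n x)\<^sup>2"
    by (simp add: power2_eq_square)
  finally have 1: "2 ^ n / fact n * (he 1 n x)\<^sup>2 \<le> B\<^sup>2 * exp 1 * real n" by simp
  have "2 * (\<bar>x\<bar> * sqrt (2 * real n)) \<le> 2 * x\<^sup>2 / \<epsilon> + \<epsilon> * real n"
  proof -
    have "0 \<le> (sqrt 2 * \<bar>x\<bar> / sqrt \<epsilon> - sqrt \<epsilon> * sqrt (real n))\<^sup>2" by simp
    also have "\<dots> = 2 * x\<^sup>2 / \<epsilon> + \<epsilon> * real n - 2 * (\<bar>x\<bar> * sqrt (2 * real n))"
      using assms by (simp add: power2_diff power_divide power_mult_distrib real_sqrt_mult)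
    finally show ?thesis by simp
  qed
  then have "B\<^sup>2 \<le> exp (2 * x\<^sup>2 / \<epsilon>) * exp \<epsilon> ^ n"
    unfolding B_def by (simp add: mult.commute flip: exp_double exp_of_nat_mult exp_add)
  then have "B\<^sup>2 * exp 1 * real n \<le> exp (2 * x\<^sup>2 / \<epsilon>) * exp \<epsilon> ^ n * exp 1 * (real n + 1)"
    by (intro mult_mono) auto
  with 1 have "2 ^ n / fact n * (he 1 n x)\<^sup>2
      \<le> exp (2 * x\<^sup>2 / \<epsilon>) * exp \<epsilon> ^ n * exp 1 * (real n + 1)"
    by (rule order_trans)
  then show ?thesis by (simp only: mult_ac)
qed

context hermite_nodes
begin

definition quad_coeff :: "nat \<Rightarrow> real" where
  "quad_coeff n = 2 ^ n / fact n * (\<Sum>j=1..N. weight j * he 1 n (t j))\<^sup>2"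

lemma deriv_funpow_gen_dev:
  assumes "n \<ge> 1"
  shows "(deriv ^^ n) gen_dev 0 = of_real (2 ^ n * (\<Sum>j=1..N. weight j * he 1 n (t j)))"
proof -
  define g where "g n z = (\<Sum>j=1..N. of_real (weight j) * (2 ^ n * he 1 n (of_real (t j) - z) * exp (2 * of_real (t j) * z - z\<^sup>2)))" for n and z :: complex
  have g': "(g n has_field_derivative g (Suc n) z) (at z)" for n z
    unfolding g_def
    by (rule DERIV_sum) (auto intro!: derivative_eq_intros DERIV_chain2[OF he_has_field_derivative]
         simp: he_Suc[of _ n] algebra_simps)
  have "(deriv ^^ n) gen_dev = g n"
    using assms
  proof (induction n rule: dec_induct)
    case base
    have "(gen_dev has_field_derivative g 1 z) (at z)" for z
    proof -
      have "gen_dev = (\<lambda>z. g 0 z - 1)" by (simp add: gen_dev_def[abs_def] g_def)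
      then show ?thesis using DERIV_diff[OF g'[of 0 z] DERIV_const[of 1]] by simp
    qed
    then show ?case by (auto intro!: DERIV_imp_deriv)
  next
    case (step n)
    then show ?case using g' by (auto intro!: DERIV_imp_deriv)
  qed
  then show ?thesis
    using he_of_real[of 1 n, where 'a = complex] by (simp add: g_def sum_distrib_left mult_ac)
qed

lemma gen_dev_holomorphic: "gen_dev holomorphic_on UNIV"
  unfolding gen_dev_def[abs_def] by (intro holomorphic_intros)

lemma quad_coeff_eq:
  assumes "n \<ge> 1"
  shows "quad_coeff n = (cmod ((deriv ^^ n) gen_dev 0))\<^sup>2 / (2 ^ n * fact n)"
  unfolding deriv_funpow_gen_dev[OF assms] quad_coeff_def norm_of_real
  by (simp add: power2_eq_square)

text \<open>For a bound of the form \<open>exp (a * |z|^2)\<close> the best circle is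
  \<open>|z|^2 = n / (2 * a)\<close>, where it equals \<open>exp (n / 2)\<close>; here
  \<open>a = 1\<close>.\<close>

lemma quad_coeff_le:
  assumes "n \<ge> 1"
  shows "quad_coeff n \<le> 4 * exp 1 * real n"
proof -
  have "quad_coeff n \<le> 2\<^sup>2 / (2 * (1/2)) ^ n * exp 1 * real n"
    unfolding quad_coeff_eq[OF assms]
  proof (rule coeff_bound_circle[OF gen_dev_holomorphic assms])
    show "cmod (gen_dev z) \<le> 2 * exp (1/2 * real n)" if "(cmod z)\<^sup>2 = 1/2 * real n" for z
      using norm_gen_dev_le_two_exp[of z] by (simp add: that)
  qed auto
  then show ?thesis by simp
qed

text \<open>Now \<open>a = 3\<close>, so the best circle has \<open>r = 1/6\<close>, and the
  denominator \<open>(2 * r)^n\<close> turns into the factor \<open>3^n\<close>.\<close>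

lemma quad_coeff_le_power:
  assumes "n \<ge> 1"
  shows "quad_coeff n \<le> (23/100) ^ (2 * N) * 3 ^ n * exp 1 * real n"
proof -
  have "quad_coeff n \<le> ((23/100) ^ N)\<^sup>2 / (2 * (1/6)) ^ n * exp 1 * real n"
    unfolding quad_coeff_eq[OF assms]
  proof (rule coeff_bound_circle[OF gen_dev_holomorphic assms])
    show "cmod (gen_dev z) \<le> (23/100) ^ N * exp (1/2 * real n)" if "(cmod z)\<^sup>2 = 1/6 * real n" for z
    proof -
      have "z \<noteq> 0" using that assms by auto
      from norm_gen_dev_le[OF this] show ?thesis by (simp add: that)
    qed
  qed auto
  then show ?thesis by (simp add: power_divide power_mult[symmetric] mult.commute)
qed

lemma quad_coeff_0: "quad_coeff 0 = 1"
  using sum_weight by (simp add: quad_coeff_def)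

lemma quad_coeff_eq_0: "1 \<le> n \<Longrightarrow> n < 2 * N \<Longrightarrow> quad_coeff n = 0"
  using quadrature_he by (simp add: quad_coeff_def)

lemma quad_coeff_nonneg: "quad_coeff n \<ge> 0"
  by (simp add: quad_coeff_def)

end

section \<open>Mehler's formula\<close>

lemma summable_Suc_mult_power:
  fixes r :: real
  assumes "\<bar>r\<bar> < 1"
  shows "summable (\<lambda>n. (real n + 1) * r ^ n)"
proof -
  have "summable (\<lambda>n. diffs (\<lambda>_. 1) n * r ^ n)"
    by (rule termdiff_converges[where K = 1]) (use assms in \<open>auto intro: summable_geometric\<close>)
  then show ?thesis by (simp add: diffs_def add.commute)
qed

lemma summable_he_square:
  fixes s x :: real
  assumes "\<bar>s\<bar> < 1"
  shows "summable (\<lambda>n. (2 ^ n / fact n * (he 1 n x)\<^sup>2) * s ^ n)"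
proof -
  define r where "r = (\<bar>s\<bar> + 1) / 2"
  \<comment> \<open>Then \<open>exp \<epsilon> * |s|\<close> is the harmonic mean of
    \<open>r\<close> and \<open>|s|\<close> and hence at most \<open>r\<close>; unlike the quotient
    of \<open>r\<close> and \<open>|s|\<close>, this also makes sense for
    \<open>s = 0\<close>.\<close>
  define \<epsilon> where "\<epsilon> = ln (2 * r / (r + \<bar>s\<bar>))"
  have r: "\<bar>s\<bar> < r" "r < 1" "r > 0" using assms by (auto simp: r_def)
  have e: "exp \<epsilon> = 2 * r / (r + \<bar>s\<bar>)" unfolding \<epsilon>_def using r by (intro exp_ln) auto
  have "\<epsilon> > 0" unfolding \<epsilon>_def using r by (intro ln_gt_zero) (auto simp: field_simps)
  have "exp \<epsilon> * \<bar>s\<bar> \<le> r"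
  proof -
    have "2 * \<bar>s\<bar> \<le> r + \<bar>s\<bar>" using r by simp
    then have "r * (2 * \<bar>s\<bar>) \<le> r * (r + \<bar>s\<bar>)" using r by (intro mult_left_mono) auto
    then show ?thesis unfolding e using r by (simp add: field_simps)
  qed
  define K where "K = exp 1 * exp (2 * x\<^sup>2 / \<epsilon>)"
  have "K \<ge> 0" by (simp add: K_def)
  show ?thesis
  proof (rule summable_comparison_test')
    show "summable (\<lambda>n. K * ((real n + 1) * r ^ n))"
      by (intro summable_mult summable_Suc_mult_power) (use r in auto)
    show "norm ((2 ^ n / fact n * (he 1 n x)\<^sup>2) * s ^ n) \<le> K * ((real n + 1) * r ^ n)" for n
    proof -
      have "norm ((2 ^ n / fact n * (he 1 n x)\<^sup>2) * s ^ n) = (2 ^ n / fact n * (he 1 n x)\<^sup>2) * \<bar>s\<bar> ^ n"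
        by (simp add: abs_mult power_abs)
      also have "\<dots> \<le> K * ((real n + 1) * exp \<epsilon> ^ n) * \<bar>s\<bar> ^ n"
        using he_square_bound[OF \<open>\<epsilon> > 0\<close>] unfolding K_def by (intro mult_right_mono) auto
      also have "\<dots> = K * ((real n + 1) * (exp \<epsilon> * \<bar>s\<bar>) ^ n)"
        by (simp add: power_mult_distrib)
      also have "\<dots> \<le> K * ((real n + 1) * r ^ n)"
        using \<open>exp \<epsilon> * \<bar>s\<bar> \<le> r\<close> \<open>K \<ge> 0\<close> by (intro mult_left_mono power_mono) auto
      finally show ?thesis .
    qed
  qed
qed

lemma power_fact_Suc: "2 ^ Suc n / fact (Suc n) * (real n + 1) = 2 * (2 ^ n / fact n :: real)"
proof -
  have "2 ^ Suc n / fact (Suc n) * real (Suc n) = 2 * (2 ^ n / fact n :: real)"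
    unfolding fact_Suc power_Suc by (simp del: of_nat_Suc)
  then show ?thesis by (simp add: add.commute)
qed

text \<open>Mixed products are dominated by squares. In the second series the raised index is
  compensated by a factor \<open>n + 1\<close>, that is, by termwise differentiation of the series
  of squares.\<close>

lemma summable_he_mult_he:
  fixes s x y :: real
  assumes "\<bar>s\<bar> < 1"
  shows "summable (\<lambda>n. (2 ^ n / fact n * (he 1 n x * he 1 n y)) * s ^ n)"
    and "summable (\<lambda>n. (2 ^ Suc n / fact n * (he 1 (Suc n) x * he 1 n y)) * s ^ n)"
proof -
  define A where "A x n = 2 ^ n / fact n * (he 1 n x)\<^sup>2" for x :: real and n
  have A: "summable (\<lambda>n. A x n * \<bar>s\<bar> ^ n)" for x
    unfolding A_def by (rule summable_he_square) (use assms in simp)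
  have A': "summable (\<lambda>n. (real n + 1) * A x (Suc n) * \<bar>s\<bar> ^ n)" for x
  proof -
    have "summable (\<lambda>n. diffs (A x) n * \<bar>s\<bar> ^ n)"
    proof (rule termdiff_converges[where K = 1])
      show "summable (\<lambda>n. A x n * y ^ n)" if "norm y < 1" for y
        unfolding A_def by (rule summable_he_square) (use that in simp)
    qed (use assms in simp)
    then show ?thesis by (simp add: diffs_def add.commute)
  qed
  have uv: "2 * \<bar>u * v\<bar> \<le> u\<^sup>2 + v\<^sup>2" for u v :: real
    using sum_squares_bound[of "\<bar>u\<bar>" "\<bar>v\<bar>"] by (simp add: abs_mult)
  show "summable (\<lambda>n. (2 ^ n / fact n * (he 1 n x * he 1 n y)) * s ^ n)"
  proof (rule summable_comparison_test')
    show "summable (\<lambda>n. A x n * \<bar>s\<bar> ^ n + A y n * \<bar>s\<bar> ^ n)" by (intro summable_add A)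
    show "norm ((2 ^ n / fact n * (he 1 n x * he 1 n y)) * s ^ n) \<le> A x n * \<bar>s\<bar> ^ n + A y n * \<bar>s\<bar> ^ n" for n
    proof -
      have "norm ((2 ^ n / fact n * (he 1 n x * he 1 n y)) * s ^ n)
          = 2 ^ n / fact n * \<bar>s\<bar> ^ n * \<bar>he 1 n x * he 1 n y\<bar>"
        by (simp add: abs_mult power_abs)
      also have "\<dots> \<le> 2 ^ n / fact n * \<bar>s\<bar> ^ n * ((he 1 n x)\<^sup>2 + (he 1 n y)\<^sup>2)"
        using uv[of "he 1 n x" "he 1 n y"] by (intro mult_left_mono) auto
      finally show ?thesis by (simp add: A_def algebra_simps)
    qed
  qed
  show "summable (\<lambda>n. (2 ^ Suc n / fact n * (he 1 (Suc n) x * he 1 n y)) * s ^ n)"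
  proof (rule summable_comparison_test')
    show "summable (\<lambda>n. (real n + 1) * A x (Suc n) * \<bar>s\<bar> ^ n + A y n * \<bar>s\<bar> ^ n)" by (intro summable_add A A')
    show "norm ((2 ^ Suc n / fact n * (he 1 (Suc n) x * he 1 n y)) * s ^ n)
        \<le> (real n + 1) * A x (Suc n) * \<bar>s\<bar> ^ n + A y n * \<bar>s\<bar> ^ n" for n
    proof -
      have "norm ((2 ^ Suc n / fact n * (he 1 (Suc n) x * he 1 n y)) * s ^ n)
          = 2 ^ n / fact n * \<bar>s\<bar> ^ n * (2 * \<bar>he 1 (Suc n) x * he 1 n y\<bar>)"
        by (simp add: abs_mult power_abs)
      also have "\<dots> \<le> 2 ^ n / fact n * \<bar>s\<bar> ^ n * ((he 1 (Suc n) x)\<^sup>2 + (he 1 n y)\<^sup>2)"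
        using uv[of "he 1 (Suc n) x" "he 1 n y"] by (intro mult_left_mono) auto
      also have "\<dots> \<le> 2 ^ n / fact n * \<bar>s\<bar> ^ n * (2 * (he 1 (Suc n) x)\<^sup>2 + (he 1 n y)\<^sup>2)"
        by (intro mult_left_mono) auto
      also have "\<dots> = (real n + 1) * A x (Suc n) * \<bar>s\<bar> ^ n + A y n * \<bar>s\<bar> ^ n"
      proof -
        have "(real n + 1) * (2 ^ Suc n / fact (Suc n)) = 2 * (2 ^ n / fact n :: real)"
          by (subst mult.commute) (rule power_fact_Suc)
        then have "(real n + 1) * A x (Suc n) = 2 * (2 ^ n / fact n) * (he 1 (Suc n) x)\<^sup>2"
          unfolding A_def by (simp only: mult.assoc[symmetric])
        then show ?thesis by (simp add: A_def algebra_simps)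
      qed
      finally show ?thesis .
    qed
  qed
qed

text \<open>Both sides satisfy the same linear differential equation in \<^term>\<open>s\<close>.\<close>

lemma mehler:
  fixes s x y :: real
  assumes s: "\<bar>s\<bar> < 1"
  shows "(\<lambda>n. 2 ^ n / fact n * (he 1 n x * he 1 n y) * s ^ n) sums
    (exp ((2 * x * y * s - s\<^sup>2 * (x\<^sup>2 + y\<^sup>2)) / (1 - s\<^sup>2)) / sqrt (1 - s\<^sup>2))"
proof -
  define a where "a n = 2 ^ n / fact n * (he 1 n x * he 1 n y)" for n
  \<comment> \<open>The mixed series with one of the two indices raised: the three-term recurrences
    in \<open>x\<close> and \<open>y\<close> express the derivative of the Mehler series through it
    and these two.\<close>
  define b where "b n = 2 ^ Suc n / fact n * (he 1 (Suc n) x * he 1 n y)" for n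
  define c where "c n = 2 ^ Suc n / fact n * (he 1 (Suc n) y * he 1 n x)" for n
  define A where "A s = (\<Sum>n. a n * s ^ n)" for s
  define A' where "A' s = (\<Sum>n. diffs a n * s ^ n)" for s
  define B where "B s = (\<Sum>n. b n * s ^ n)" for s
  define C where "C s = (\<Sum>n. c n * s ^ n)" for s
  have sa: "summable (\<lambda>n. a n * s ^ n)" if "\<bar>s\<bar> < 1" for s
    unfolding a_def by (rule summable_he_mult_he(1)[OF that])
  have sb: "summable (\<lambda>n. b n * s ^ n)" if "\<bar>s\<bar> < 1" for s
    unfolding b_def by (rule summable_he_mult_he(2)[OF that])
  have sc: "summable (\<lambda>n. c n * s ^ n)" if "\<bar>s\<bar> < 1" for s
    unfolding c_def by (rule summable_he_mult_he(2)[OF that])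
  have sa': "summable (\<lambda>n. diffs a n * s ^ n)" if "\<bar>s\<bar> < 1" for s
    by (rule termdiff_converges[where K = 1]) (use that sa in auto)
  have shift: "(\<Sum>n. f n * s ^ n) = f 0 + s * (\<Sum>n. f (Suc n) * s ^ n)"
    if "summable (\<lambda>n. f (Suc n) * s ^ n)" for f :: "nat \<Rightarrow> real" and s
  proof -
    have "(\<lambda>n. s * (f (Suc n) * s ^ n)) sums (s * (\<Sum>n. f (Suc n) * s ^ n))"
      by (intro sums_mult summable_sums that)
    then have "(\<lambda>n. f (Suc n) * s ^ Suc n) sums (s * (\<Sum>n. f (Suc n) * s ^ n))"
      by (simp add: mult_ac)
    then have "(\<lambda>n. f n * s ^ n) sums (s * (\<Sum>n. f (Suc n) * s ^ n) + f 0 * s ^ 0)"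
      by (rule sums_Suc)
    then show ?thesis by (simp add: sums_iff)
  qed
  define w :: "nat \<Rightarrow> real" where "w n = 2 ^ n / fact n" for n
  define u where "u n = he 1 n x" for n
  define v where "v n = he 1 n y" for n
  have w: "w (Suc n) * (real n + 1) = 2 * w n" for n
    unfolding w_def by (rule power_fact_Suc)
  have u: "u (Suc (Suc n)) = x * u (Suc n) - (real n + 1) / 2 * u n" for n
    by (simp add: u_def add.commute)
  have v: "v (Suc (Suc n)) = y * v (Suc n) - (real n + 1) / 2 * v n" for n
    by (simp add: v_def add.commute)
  have a: "a n = w n * (u n * v n)" and b: "b n = 2 * w n * (u (Suc n) * v n)"
    and c: "c n = 2 * w n * (v (Suc n) * u n)" for n
    by (simp_all add: a_def b_def c_def w_def u_def v_def del: he.simps)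
  have b_Suc: "b (Suc n) = 2 * x * a (Suc n) - c n" for n
  proof -
    have "b (Suc n) = 2 * x * a (Suc n) - w (Suc n) * (real n + 1) * (u n * v (Suc n))"
      unfolding a b u by (simp add: algebra_simps)
    then show ?thesis unfolding w c by (simp add: mult_ac)
  qed
  have c_Suc: "c (Suc n) = 2 * y * a (Suc n) - b n" for n
  proof -
    have "c (Suc n) = 2 * y * a (Suc n) - w (Suc n) * (real n + 1) * (u (Suc n) * v n)"
      unfolding a c v by (simp add: algebra_simps)
    then show ?thesis unfolding w b by (simp add: mult_ac)
  qed
  have da: "diffs a n = 2 * w n * (u (Suc n) * v (Suc n))" for n
  proof -
    have "diffs a n = w (Suc n) * (real n + 1) * (u (Suc n) * v (Suc n))"
      unfolding diffs_def a by (simp add: algebra_simps)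
    then show ?thesis unfolding w .
  qed
  have da_Suc: "diffs a (Suc n) = y * b (Suc n) - x * b n + (real n + 1) * a n" for n
  proof -
    have "diffs a (Suc n) = y * b (Suc n) - w (Suc n) * (real n + 1) * (u (Suc (Suc n)) * v n)"
      unfolding da b v by (simp add: algebra_simps)
    also have "w (Suc n) * (real n + 1) * (u (Suc (Suc n)) * v n) = x * b n - (real n + 1) * a n"
      unfolding w u a b by (simp add: algebra_simps)
    finally show ?thesis by simp
  qed
  have B: "B s = 2 * x * A s - s * C s" if "\<bar>s\<bar> < 1" for s
  proof -
    have ss: "summable (\<lambda>n. b (Suc n) * s ^ n)" "summable (\<lambda>n. a (Suc n) * s ^ n)"
      using sb[OF that] sa[OF that] by (simp_all add: summable_powser_split_head)
    have "(\<Sum>n. b (Suc n) * s ^ n) = 2 * x * (\<Sum>n. a (Suc n) * s ^ n) - C s"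
      unfolding b_Suc left_diff_distrib mult.assoc C_def
      by (simp only: suminf_diff[OF summable_mult[OF summable_mult[OF ss(2)]] sc[OF that], symmetric]
         suminf_mult[OF ss(2)] suminf_mult[OF summable_mult[OF ss(2)]] mult.assoc)
    moreover have "b 0 = 2 * x * a 0" by (simp add: a b u_def)
    ultimately show ?thesis
      using shift[OF ss(1), folded B_def] shift[OF ss(2), folded A_def] by algebra
  qed
  have C: "C s = 2 * y * A s - s * B s" if "\<bar>s\<bar> < 1" for s
  proof -
    have ss: "summable (\<lambda>n. c (Suc n) * s ^ n)" "summable (\<lambda>n. a (Suc n) * s ^ n)"
      using sc[OF that] sa[OF that] by (simp_all add: summable_powser_split_head)
    have "(\<Sum>n. c (Suc n) * s ^ n) = 2 * y * (\<Sum>n. a (Suc n) * s ^ n) - B s"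
      unfolding c_Suc left_diff_distrib mult.assoc B_def
      by (simp only: suminf_diff[OF summable_mult[OF summable_mult[OF ss(2)]] sb[OF that], symmetric]
         suminf_mult[OF ss(2)] suminf_mult[OF summable_mult[OF ss(2)]] mult.assoc)
    moreover have "c 0 = 2 * y * a 0" by (simp add: a c v_def)
    ultimately show ?thesis
      using shift[OF ss(1), folded C_def] shift[OF ss(2), folded A_def] by algebra
  qed
  have A'_eq: "A' s = y * B s - x * s * B s + s * A s + s\<^sup>2 * A' s" if s: "\<bar>s\<bar> < 1" for s
  proof -
    have ss: "summable (\<lambda>n. b (Suc n) * s ^ n)" "summable (\<lambda>n. a (Suc n) * s ^ n)"
      "summable (\<lambda>n. diffs a (Suc n) * s ^ n)"
      using sb[OF s] sa[OF s] sa'[OF s] by (simp_all add: summable_powser_split_head)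
    have sna: "(\<lambda>n. (real n + 1) * a n * s ^ n) sums (A s + s * A' s)"
    proof -
      have "(\<lambda>n. s * (diffs a n * s ^ n)) sums (s * A' s)"
        unfolding A'_def by (intro sums_mult summable_sums sa' s)
      then have "(\<lambda>n. real (Suc n) * a (Suc n) * s ^ Suc n) sums (s * A' s)"
        by (simp add: diffs_def mult_ac)
      then have "(\<lambda>n. real n * a n * s ^ n) sums (s * A' s + real 0 * a 0 * s ^ 0)"
        by (rule sums_Suc)
      moreover have "(\<lambda>n. a n * s ^ n) sums A s" unfolding A_def by (intro summable_sums sa s)
      ultimately have "(\<lambda>n. real n * a n * s ^ n + a n * s ^ n) sums (s * A' s + real 0 * a 0 * s ^ 0 + A s)"
        by (rule sums_add)
      then show ?thesis by (simp add: algebra_simps)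
    qed
    have "(\<lambda>n. y * (b (Suc n) * s ^ n) - x * (b n * s ^ n) + (real n + 1) * a n * s ^ n) sums
       (y * (\<Sum>n. b (Suc n) * s ^ n) - x * B s + (A s + s * A' s))"
      unfolding B_def by (intro sums_add sums_diff sums_mult summable_sums ss sb s sna)
    then have "(\<Sum>n. diffs a (Suc n) * s ^ n) = y * (\<Sum>n. b (Suc n) * s ^ n) - x * B s + (A s + s * A' s)"
      unfolding da_Suc by (simp add: sums_iff algebra_simps)
    moreover have "diffs a 0 = y * b 0" by (simp add: da b v_def)
    ultimately show ?thesis
      using shift[OF ss(1), folded B_def] shift[OF ss(3), folded A'_def] by algebra
  qed
  \<comment> \<open>The relations between \<open>B\<close> and \<open>C\<close> form a linear system
    with determinant \<open>1 - s^2\<close>; solving it for \<open>B\<close> turns the relation for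
    \<open>A'\<close> into a first-order equation for \<open>A\<close> alone.\<close>
  have ode: "A' s * (1 - s\<^sup>2)\<^sup>2 = ((y - x * s) * (2 * x - 2 * y * s) + s * (1 - s\<^sup>2)) * A s" if s: "\<bar>s\<bar> < 1" for s
  proof -
    have 1: "B s * (1 - s\<^sup>2) = (2 * x - 2 * y * s) * A s"
      using B[OF s] C[OF s] by algebra
    have 2: "A' s * (1 - s\<^sup>2) = (y - x * s) * B s + s * A s"
      using A'_eq[OF s] by algebra
    show ?thesis using 1 2 by algebra
  qed
  have dA: "(A has_real_derivative A' s) (at s)" if "\<bar>s\<bar> < 1" for s
    unfolding A_def A'_def
    by (rule termdiffs_strong'[where K = 1])
       (use that sa in auto)
  define h where "h s = (2 * x * y * s - s\<^sup>2 * (x\<^sup>2 + y\<^sup>2)) / (1 - s\<^sup>2)" for s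
  \<comment> \<open>The quotient of the series by the claimed closed form; the differential equation
    makes it constant.\<close>
  define G where "G s = sqrt (1 - s\<^sup>2) * exp (- h s) * A s" for s
  have "G s = G 0"
  proof (rule has_field_derivative_zero_constant[THEN exE, of "{-1<..<1}" G])
    show "(G has_field_derivative 0) (at s within {-1<..<1})" if "s \<in> {-1<..<1}" for s
    proof -
      have s: "\<bar>s\<bar> < 1" using that by auto
      then have pos: "1 - s\<^sup>2 > 0" by (simp add: abs_square_less_1)
      define h' where "h' = ((y - x * s) * (2 * x - 2 * y * s)) / (1 - s\<^sup>2)\<^sup>2"
      have dh: "(h has_real_derivative h') (at s)"
        unfolding h_def h'_def
        apply (rule derivative_eq_intros refl)+
        using pos by (auto simp: field_simps power2_eq_square)
      have A'2: "A' s = (h' + s / (1 - s\<^sup>2)) * A s"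
      proof -
        have "A' s = A' s * (1 - s\<^sup>2)\<^sup>2 / (1 - s\<^sup>2)\<^sup>2" using pos by simp
        also have "\<dots> = (h' + s / (1 - s\<^sup>2)) * A s"
        proof -
          have "(P + s * D) * r / D\<^sup>2 = (P / D\<^sup>2 + s / D) * r" if "D \<noteq> 0" for P D r
            using that by (simp add: add_divide_distrib distrib_right power2_eq_square)
          then show ?thesis unfolding ode[OF s] h'_def using pos by simp
        qed
        finally show ?thesis .
      qed
      have dq: "((\<lambda>s. sqrt (1 - s\<^sup>2)) has_real_derivative - s / (1 - s\<^sup>2) * sqrt (1 - s\<^sup>2)) (at s)"
      proof (rule DERIV_cong)
        show "((\<lambda>s. sqrt (1 - s\<^sup>2)) has_real_derivative (- (2 * s)) * (inverse (sqrt (1 - s\<^sup>2)) / 2)) (at s)"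
          using pos by (auto intro!: derivative_eq_intros)
        have "sqrt (1 - s\<^sup>2) * sqrt (1 - s\<^sup>2) = 1 - s\<^sup>2" "sqrt (1 - s\<^sup>2) > 0" using pos by auto
        then have q: "sqrt (1 - s\<^sup>2) / (1 - s\<^sup>2) = inverse (sqrt (1 - s\<^sup>2))"
          by (metis divide_inverse less_irrefl mult.commute nonzero_divide_mult_cancel_left
              inverse_eq_divide)
        show "(- (2 * s)) * (inverse (sqrt (1 - s\<^sup>2)) / 2) = - s / (1 - s\<^sup>2) * sqrt (1 - s\<^sup>2)"
        proof -
          have "(- (2 * s)) * (r / D / 2) = - s / D * r" for r D :: real by simp
          then show ?thesis unfolding q[symmetric] .
        qed
      qed
      have "(G has_real_derivative 0) (at s)"
        unfolding G_def
        by (rule derivative_eq_intros dq dh dA s refl)+ (simp add: A'2 algebra_simps)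
      then show ?thesis by (rule has_field_derivative_at_within)
    qed
    fix k assume "\<forall>s\<in>{-1<..<1}. G s = k"
    then show ?thesis using s by (auto simp: abs_less_iff)
  qed auto
  also have "G 0 = 1"
  proof -
    have "A 0 = a 0" unfolding A_def by (rule powser_zero)
    then show ?thesis by (simp add: G_def h_def a_def)
  qed
  finally have "sqrt (1 - s\<^sup>2) * exp (- h s) * A s = 1" by (simp add: G_def)
  moreover have "sqrt (1 - s\<^sup>2) > 0" using s by (simp add: abs_square_less_1)
  ultimately have "A s = exp (h s) / sqrt (1 - s\<^sup>2)"
    by (simp add: exp_minus field_simps)
  moreover have "(\<lambda>n. a n * s ^ n) sums A s" unfolding A_def by (intro summable_sums sa s)
  ultimately show ?thesis unfolding a_def h_def by simp
qed

section \<open>Summation of the squared quadrature values\<close>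

text \<open>The maximum is attained at \<open>y = 1/4\<close>, which is a double root of the
  difference.\<close>

lemma quartic_bound:
  fixes y :: real
  shows "8 * y * (1 - y) ^ 3 \<le> 27 / 32"
proof -
  have "0 \<le> (y - 1/4)\<^sup>2 * (8 * (y - 5/4)\<^sup>2 + 1)" by simp
  also have "\<dots> = 27 / 32 - 8 * y * (1 - y) ^ 3"
    by (simp add: power2_eq_square power3_eq_cube algebra_simps)
  finally show ?thesis by simp
qed

text \<open>The exponent \<^term>\<open>8/3\<close> is where the two bounds on the coefficients cross:
  \<^term>\<open>(23/100) ^ 6 * 3 ^ 8\<close> is just below \<^term>\<open>1\<close>.\<close>

lemma power_le_rate:
  fixes \<tau> :: real
  assumes \<tau>: "0 < \<tau>" "\<tau> < 1" and n: "8 * N \<le> 3 * n"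
  shows "\<tau> ^ n \<le> (24/25 * (\<tau>\<^sup>2 / (2 * (1 - \<tau>\<^sup>2)))) ^ N"
\<comment> \<open>Cubing clears the denominator of the exponent 8/3.\<close>
proof (rule power_le_imp_le_base)
  define T where "T = \<tau>\<^sup>2 / (2 * (1 - \<tau>\<^sup>2))"
  have pos: "1 - \<tau>\<^sup>2 > 0" using \<tau> by (simp add: abs_square_less_1)
  have "\<tau> ^ 8 * (8 * (1 - \<tau>\<^sup>2) ^ 3) = \<tau> ^ 6 * (8 * \<tau>\<^sup>2 * (1 - \<tau>\<^sup>2) ^ 3)"
    by (simp add: power_add[symmetric] mult_ac flip: power_add)
  \<comment> \<open>The gap \<open>27/32 < (24/25)^3\<close> provides the spare factor
    \<open>24/25\<close>.\<close>
  also have "\<dots> \<le> \<tau> ^ 6 * (24/25) ^ 3"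
    using quartic_bound[of "\<tau>\<^sup>2"] \<tau> by (intro mult_left_mono) (auto simp: power3_eq_cube)
  finally have "\<tau> ^ 8 \<le> \<tau> ^ 6 * (24/25) ^ 3 / (8 * (1 - \<tau>\<^sup>2) ^ 3)"
    using pos by (subst pos_le_divide_eq) auto
  also have "\<dots> = (24/25 * T) ^ 3"
  proof -
    have "x ^ 6 * (24/25) ^ 3 / (8 * D ^ 3) = (24/25 * (x\<^sup>2 / (2 * D))) ^ 3" for x D :: real
      by (simp add: power_mult_distrib power_divide)
    then show ?thesis unfolding T_def .
  qed
  finally have 8: "\<tau> ^ 8 \<le> (24/25 * T) ^ 3" .
  have "(\<tau> ^ n) ^ Suc 2 = \<tau> ^ (3 * n)" by (simp add: mult.commute flip: power_mult)
  also have "\<dots> \<le> \<tau> ^ (8 * N)" using \<tau> n by (intro power_decreasing) auto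
  also have "\<dots> = (\<tau> ^ 8) ^ N" by (simp add: power_mult)
  also have "\<dots> \<le> ((24/25 * T) ^ 3) ^ N" using 8 \<tau> by (intro power_mono) auto
  also have "\<dots> = ((24/25 * T) ^ N) ^ Suc 2" by (simp add: mult.commute flip: power_mult)
  finally show "(\<tau> ^ n) ^ Suc 2 \<le> ((24/25 * (\<tau>\<^sup>2 / (2 * (1 - \<tau>\<^sup>2)))) ^ N) ^ Suc 2" by (simp add: T_def)
  show "0 \<le> (24/25 * (\<tau>\<^sup>2 / (2 * (1 - \<tau>\<^sup>2)))) ^ N" using pos by simp
qed

text \<open>The left-hand side is geometric in \<open>n\<close> with ratio
  \<open>3 * \<tau>\<close>, so it is largest at an end of the range: at \<open>n = 2 * N\<close> if
  the ratio is at most 1, and otherwise at \<open>n = 8 * N / 3\<close>, where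
  \<open>power_le_rate\<close> applies.\<close>

lemma power_le_rate':
  fixes \<tau> :: real
  assumes \<tau>: "0 < \<tau>" "\<tau> < 1" and n: "2 * N \<le> n" "3 * n \<le> 8 * N"
  shows "\<tau> ^ n * ((23/100) ^ (2 * N) * 3 ^ n) \<le> (24/25 * (\<tau>\<^sup>2 / (2 * (1 - \<tau>\<^sup>2)))) ^ N"
proof (cases "3 * \<tau> \<le> 1")
  case True
  have pos: "1 - \<tau>\<^sup>2 > 0" using \<tau> by (simp add: abs_square_less_1)
  have "\<tau> ^ n * ((23/100) ^ (2 * N) * 3 ^ n) = (23/100) ^ (2 * N) * (3 * \<tau>) ^ n"
    by (simp add: power_mult_distrib)
  also have "\<dots> \<le> (23/100) ^ (2 * N) * (3 * \<tau>) ^ (2 * N)"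
    using True \<tau> n by (intro mult_left_mono power_decreasing) auto
  also have "\<dots> = ((23/100 * (3 * \<tau>))\<^sup>2) ^ N" by (simp only: power_mult power_mult_distrib)
  also have "\<dots> \<le> (24/25 * (\<tau>\<^sup>2 / (2 * (1 - \<tau>\<^sup>2)))) ^ N"
  proof (rule power_mono)
    \<comment> \<open>Numerically \<open>0.4761 \<le> 0.48\<close>; this is where 23/100 has to beat
      the factor 1/2 in the rate.\<close>
    have "(23/100 * (3 * \<tau>))\<^sup>2 \<le> 24/25 * (\<tau>\<^sup>2 / 2)"
      by (simp add: power_mult_distrib power2_eq_square)
    moreover have "\<tau>\<^sup>2 / 2 \<le> \<tau>\<^sup>2 / (2 * (1 - \<tau>\<^sup>2))" using pos by (intro divide_left_mono) auto
    then have "24/25 * (\<tau>\<^sup>2 / 2) \<le> 24/25 * (\<tau>\<^sup>2 / (2 * (1 - \<tau>\<^sup>2)))"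
      by (rule mult_left_mono) simp
    ultimately show "(23/100 * (3 * \<tau>))\<^sup>2 \<le> 24/25 * (\<tau>\<^sup>2 / (2 * (1 - \<tau>\<^sup>2)))"
      by (rule order_trans)
  qed auto
  finally show ?thesis .
next
  case False
  show ?thesis
  proof (rule power_le_imp_le_base)
    have "(\<tau> ^ n * ((23/100) ^ (2 * N) * 3 ^ n)) ^ Suc 2 = (23/100) ^ (6 * N) * (3 * \<tau>) ^ (3 * n)"
      by (simp add: power_mult_distrib mult.commute flip: power_mult)
    also have "\<dots> \<le> (23/100) ^ (6 * N) * (3 * \<tau>) ^ (8 * N)"
      using False n by (intro mult_left_mono power_increasing) auto
    also have "\<dots> = ((23/100) ^ 6 * 3 ^ 8) ^ N * \<tau> ^ (8 * N)"
      by (simp add: power_mult power_mult_distrib)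
    also have "\<dots> \<le> 1 * \<tau> ^ (8 * N)"
      using \<tau> by (intro mult_right_mono power_le_one) (auto simp: power_divide)
    also have "\<dots> = (\<tau> ^ 8) ^ N" by (simp add: power_mult)
    finally have 1: "(\<tau> ^ n * ((23/100) ^ (2 * N) * 3 ^ n)) ^ Suc 2 \<le> (\<tau> ^ 8) ^ N" .
    have "\<tau> ^ 8 \<le> (24/25 * (\<tau>\<^sup>2 / (2 * (1 - \<tau>\<^sup>2)))) ^ 3"
      using power_le_rate[OF \<tau>, of 3 8] by simp
    then have "(\<tau> ^ 8) ^ N \<le> ((24/25 * (\<tau>\<^sup>2 / (2 * (1 - \<tau>\<^sup>2)))) ^ 3) ^ N"
      using \<tau> by (intro power_mono) auto
    also have "\<dots> = ((24/25 * (\<tau>\<^sup>2 / (2 * (1 - \<tau>\<^sup>2)))) ^ N) ^ Suc 2"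
      by (simp only: power_mult[symmetric] mult.commute) simp
    finally show "(\<tau> ^ n * ((23/100) ^ (2 * N) * 3 ^ n)) ^ Suc 2
        \<le> ((24/25 * (\<tau>\<^sup>2 / (2 * (1 - \<tau>\<^sup>2)))) ^ N) ^ Suc 2"
      using 1 by linarith
    show "0 \<le> (24/25 * (\<tau>\<^sup>2 / (2 * (1 - \<tau>\<^sup>2)))) ^ N"
      using \<tau> by (simp add: abs_square_le_1)
  qed
qed

text \<open>The series is split at \<open>3 * N\<close>, above the crossing point. Beyond it a
  factor \<open>\<tau>^j\<close> is left over, at most \<open>(5/6)^j\<close> because
  \<open>\<tau>^2 \<le> 2/3 < (5/6)^2\<close>, and the series in \<open>j\<close> sums to 36. Below
  it there are \<open>3 * N\<close> terms of size at most \<open>12 * exp 1 * N * T^N\<close>, apart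
  from the 1 at index 0. This accounts for \<open>468 = 12 * 36 + 36\<close>; \<open>K\<close> takes
  the factor \<open>N^2\<close> together with \<open>(24/25)^N\<close>.\<close>

lemma (in hermite_nodes) suminf_quad_coeff_le:
  assumes \<tau>: "0 < \<tau>" "\<tau>\<^sup>2 \<le> 2 / 3" and K: "real N ^ 2 * (24/25) ^ N \<le> K"
  shows "(\<Sum>n. \<tau> ^ n * quad_coeff n) \<le> 1 + 468 * exp 1 * K * (\<tau>\<^sup>2 / (2 * (1 - \<tau>\<^sup>2))) ^ N"
proof -
  define T where "T = 24/25 * (\<tau>\<^sup>2 / (2 * (1 - \<tau>\<^sup>2)))"
  have "\<tau>\<^sup>2 \<le> (5/6)\<^sup>2" using \<tau> by (simp add: power2_eq_square)
  then have \<tau>56: "\<tau> \<le> 5/6" by (rule power2_le_imp_le) simp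
  then have \<tau>1: "\<tau> < 1" by simp
  have T: "T \<ge> 0" using \<tau> by (simp add: T_def)
  have s0: "(\<lambda>j. real (Suc j) * (5/6) ^ j) sums 36"
    using geometric_deriv_sums[of "5/6 :: real"] by (simp add: power2_eq_square)
  have trm: "\<tau> ^ n * quad_coeff n \<le> 4 * exp 1 * real n * T ^ N" if "2 * N \<le> n" for n
  proof -
    have n1: "n \<ge> 1" using that N_pos by simp
    show ?thesis
    proof (cases "8 * N \<le> 3 * n")
      case True
      have "\<tau> ^ n * quad_coeff n \<le> T ^ N * (4 * exp 1 * real n)"
        unfolding T_def using \<tau> \<tau>1 power_le_rate[OF \<tau>(1) \<tau>1 True] quad_coeff_le[OF n1] quad_coeff_nonneg
        by (intro mult_mono) auto
      then show ?thesis by (simp add: mult_ac)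
    next
      case False
      have "\<tau> ^ n * quad_coeff n \<le> \<tau> ^ n * ((23/100) ^ (2 * N) * 3 ^ n * exp 1 * real n)"
        using \<tau> quad_coeff_le_power[OF n1] by (intro mult_left_mono) auto
      also have "\<dots> = \<tau> ^ n * ((23/100) ^ (2 * N) * 3 ^ n) * (exp 1 * real n)" by simp
      also have "\<dots> \<le> T ^ N * (exp 1 * real n)"
        unfolding T_def using False that by (intro mult_right_mono power_le_rate' \<tau> \<tau>1) auto
      also have "\<dots> \<le> T ^ N * (4 * exp 1 * real n)"
        using T by (intro mult_left_mono) auto
      finally show ?thesis by (simp add: mult_ac)
    qed
  qed
  have tail: "\<tau> ^ (j + 3 * N) * quad_coeff (j + 3 * N)
      \<le> 12 * exp 1 * real N * T ^ N * (real (Suc j) * (5/6) ^ j)" for j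
  proof -
    have "\<tau> ^ (j + 3 * N) * quad_coeff (j + 3 * N)
        \<le> (5/6) ^ j * T ^ N * (4 * exp 1 * real (j + 3 * N))"
    proof -
      have "\<tau> ^ j \<le> (5/6) ^ j" using \<tau> \<tau>56 by (intro power_mono) auto
      moreover have "\<tau> ^ (3 * N) \<le> T ^ N" unfolding T_def by (rule power_le_rate[OF \<tau>(1) \<tau>1]) simp
      moreover have "quad_coeff (j + 3 * N) \<le> 4 * exp 1 * real (j + 3 * N)"
        by (rule quad_coeff_le) (use N_pos in simp)
      ultimately show ?thesis
        unfolding power_add using \<tau> T by (intro mult_mono) (auto simp: quad_coeff_nonneg)
    qed
    also have "\<dots> \<le> (5/6) ^ j * T ^ N * (4 * exp 1 * (3 * real N * real (Suc j)))"
    proof (intro mult_left_mono)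
      have "j * 1 \<le> j * (3 * N)" using N_pos by (intro mult_left_mono) auto
      then have "j + 3 * N \<le> 3 * N * Suc j" by (simp add: algebra_simps)
      then have "real (j + 3 * N) \<le> real (3 * N * Suc j)" by (rule of_nat_mono)
      then show "real (j + 3 * N) \<le> 3 * real N * real (Suc j)" by (simp only: of_nat_mult of_nat_numeral)
    qed (use T in auto)
    finally show ?thesis by (simp only: mult_ac)
  qed
  have sm: "summable (\<lambda>j. \<tau> ^ (j + 3 * N) * quad_coeff (j + 3 * N))"
  proof (rule summable_comparison_test')
    show "summable (\<lambda>j. 12 * exp 1 * real N * T ^ N * (real (Suc j) * (5/6) ^ j))"
      using s0 by (intro summable_mult) (auto simp: sums_iff)
    show "norm (\<tau> ^ (j + 3 * N) * quad_coeff (j + 3 * N))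
        \<le> 12 * exp 1 * real N * T ^ N * (real (Suc j) * (5/6) ^ j)" for j
      using tail[of j] \<tau> quad_coeff_nonneg[of "j + 3 * N"] by simp
  qed
  then have sm': "summable (\<lambda>n. \<tau> ^ n * quad_coeff n)"
    using summable_iff_shift[of "\<lambda>n. \<tau> ^ n * quad_coeff n" "3 * N"] by simp
  have "(\<Sum>n. \<tau> ^ n * quad_coeff n)
      = (\<Sum>j. \<tau> ^ (j + 3 * N) * quad_coeff (j + 3 * N)) + (\<Sum>n<3 * N. \<tau> ^ n * quad_coeff n)"
    by (rule suminf_split_initial_segment[OF sm'])
  moreover have "(\<Sum>j. \<tau> ^ (j + 3 * N) * quad_coeff (j + 3 * N))
      \<le> 12 * exp 1 * real N * T ^ N * 36"
    by (rule sums_le[OF tail summable_sums[OF sm] sums_mult[OF s0]])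
  moreover have "(\<Sum>n<3 * N. \<tau> ^ n * quad_coeff n)
      \<le> (\<Sum>n<3 * N. (if n = 0 then 1 else 0) + 12 * exp 1 * real N * T ^ N)"
  proof (rule sum_mono)
    fix n assume n: "n \<in> {..<3 * N}"
    have p: "0 \<le> 12 * exp 1 * real N * T ^ N" using T by simp
    consider "n = 0" | "1 \<le> n" "n < 2 * N" | "2 * N \<le> n" by linarith
    then show "\<tau> ^ n * quad_coeff n \<le> (if n = 0 then 1 else 0) + 12 * exp 1 * real N * T ^ N"
    proof cases
      case 3
      have "4 * exp 1 * real n * T ^ N \<le> 4 * exp 1 * (3 * real N) * T ^ N"
        using n T by (intro mult_right_mono mult_left_mono) auto
      also have "\<dots> = 12 * exp 1 * real N * T ^ N" by simp
      finally have "\<tau> ^ n * quad_coeff n \<le> 12 * exp 1 * real N * T ^ N"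
        using trm[OF 3] by linarith
      moreover have "n \<noteq> 0" using 3 N_pos by simp
      ultimately show ?thesis by (simp only: if_False add_0_left)
    qed (use p in \<open>auto simp: quad_coeff_0 quad_coeff_eq_0\<close>)
  qed
  moreover have "(\<Sum>n<3 * N. (if n = 0 then 1 else 0) + 12 * exp 1 * real N * T ^ N)
      = 1 + 36 * exp 1 * (real N ^ 2 * T ^ N)"
    using N_pos by (simp add: sum.distrib power2_eq_square)
  moreover have "12 * exp 1 * real N * T ^ N * 36 \<le> 432 * exp 1 * (real N ^ 2 * T ^ N)"
  proof -
    have "real N * T ^ N \<le> real N ^ 2 * T ^ N"
      using N_pos T by (intro mult_right_mono) (auto simp: power2_eq_square)
    then show ?thesis by simp
  qed
  ultimately have main: "(\<Sum>n. \<tau> ^ n * quad_coeff n) \<le> 1 + 468 * exp 1 * (real N ^ 2 * T ^ N)" by linarith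
  have "real N ^ 2 * T ^ N \<le> K * (\<tau>\<^sup>2 / (2 * (1 - \<tau>\<^sup>2))) ^ N"
  proof -
    have "real N ^ 2 * T ^ N = (real N ^ 2 * (24/25) ^ N) * (\<tau>\<^sup>2 / (2 * (1 - \<tau>\<^sup>2))) ^ N"
      unfolding T_def by (simp only: power_mult_distrib mult.assoc)
    also have "\<dots> \<le> K * (\<tau>\<^sup>2 / (2 * (1 - \<tau>\<^sup>2))) ^ N"
      using K \<tau> by (intro mult_right_mono zero_le_power) auto
    finally show ?thesis .
  qed
  then have "468 * exp 1 * (real N ^ 2 * T ^ N) \<le> 468 * exp 1 * (K * (\<tau>\<^sup>2 / (2 * (1 - \<tau>\<^sup>2))) ^ N)"
    by (rule mult_left_mono) simp
  with main show ?thesis by (simp only: mult.assoc)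
qed

lemma bounded_square_mult_power: "\<exists>K. \<forall>N. real N ^ 2 * (24/25) ^ N \<le> K"
proof -
  have "(\<lambda>N. real N ^ 2 * (24/25) ^ N) \<longlonglongrightarrow> 0" by real_asymp
  then have "Bseq (\<lambda>N. real N ^ 2 * (24/25) ^ N)" by (intro convergent_imp_Bseq) (auto simp: convergent_def)
  then obtain K where "\<And>N. norm (real N ^ 2 * (24/25) ^ N) \<le> K" by (auto simp: Bseq_def)
  then show ?thesis by (intro exI[of _ K] allI) (metis abs_le_D1 real_norm_def)
qed

section \<open>Gaussian integrals and least squares\<close>

text \<open>The characteristic function of the standard normal distribution, rescaled by
  \<open>sqrt A\<close>.\<close>

lemma gaussian_fourier:
  fixes A b :: real
  assumes "A > 0"
  shows "has_bochner_integral lborel (\<lambda>s. exp (complex_of_real (- (A * s\<^sup>2 / 2)) + \<i> * complex_of_real (b * s)))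
    (complex_of_real (sqrt (2 * pi / A) * exp (- (b\<^sup>2 / (2 * A)))))"
proof -
  define u where "u = b / sqrt A"
  define f where "f x = std_normal_density x *\<^sub>R exp (\<i> * complex_of_real (u * x))" for x
  have "integrable lborel f"
  proof (rule Bochner_Integration.integrable_bound)
    show "integrable lborel std_normal_density" by (rule integrable_normal_density) simp
    show "f \<in> borel_measurable lborel" unfolding f_def by measurable
    show "AE x in lborel. norm (f x) \<le> norm (std_normal_density x)"
      by (simp add: f_def norm_exp_eq_Re)
  qed
  moreover have "integral\<^sup>L lborel f = complex_of_real (exp (- (u\<^sup>2) / 2))"
  proof -
    have "char std_normal_distribution u = integral\<^sup>L lborel f"
      unfolding char_def f_def by (subst integral_density) auto
    then show ?thesis by (simp add: char_std_normal_distribution)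
  qed
  ultimately have "has_bochner_integral lborel f (complex_of_real (exp (- (u\<^sup>2) / 2)))"
    by (simp add: has_bochner_integral_iff)
  then have "has_bochner_integral lborel (\<lambda>x. f (0 + sqrt A * x)) (complex_of_real (exp (- (u\<^sup>2) / 2)) /\<^sub>R \<bar>sqrt A\<bar>)"
    by (subst lborel_has_bochner_integral_real_affine_iff[symmetric]) (use assms in auto)
  then have "has_bochner_integral lborel (\<lambda>x. complex_of_real (sqrt (2 * pi)) * f (0 + sqrt A * x))
      (complex_of_real (sqrt (2 * pi)) * (complex_of_real (exp (- (u\<^sup>2) / 2)) /\<^sub>R \<bar>sqrt A\<bar>))"
    by (rule has_bochner_integral_mult_right) 
  also have "(\<lambda>x. complex_of_real (sqrt (2 * pi)) * f (0 + sqrt A * x))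
      = (\<lambda>s. exp (complex_of_real (- (A * s\<^sup>2 / 2)) + \<i> * complex_of_real (b * s)))"
  proof
    fix s
    have "u * (sqrt A * s) = b * s" using assms by (simp add: u_def)
    moreover have "sqrt (2 * pi) * std_normal_density (sqrt A * s) = exp (- (A * s\<^sup>2 / 2))"
      using assms by (simp add: std_normal_density_def power_mult_distrib)
    ultimately show "complex_of_real (sqrt (2 * pi)) * f (0 + sqrt A * s)
      = exp (complex_of_real (- (A * s\<^sup>2 / 2)) + \<i> * complex_of_real (b * s))"
      unfolding f_def exp_add exp_of_real
      by (simp only: add_0_left scaleR_conv_of_real mult.assoc[symmetric] of_real_mult[symmetric])
  qed
  also have "complex_of_real (sqrt (2 * pi)) * (complex_of_real (exp (- (u\<^sup>2) / 2)) /\<^sub>R \<bar>sqrt A\<bar>)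
      = complex_of_real (sqrt (2 * pi / A) * exp (- (b\<^sup>2 / (2 * A))))"
    using assms by (simp add: u_def power_divide real_sqrt_divide scaleR_conv_of_real field_simps)
  finally show ?thesis .
qed

text \<open>The kernel factors into \<open>exp (- \<kappa> * x^2) * exp (- \<kappa> * y^2) * exp (2
  * \<kappa> * x * y)\<close>. Expanding the last exponential writes the Hermitian form as a series
  of squared moduli, which yields both semidefiniteness and definiteness.\<close>

lemma gaussian_kernel_sums:
  fixes \<theta> :: "nat \<Rightarrow> real" and d :: "nat \<Rightarrow> complex" and \<kappa> :: real
  shows "(\<lambda>n. (2 * \<kappa>) ^ n / fact n * (cmod (\<Sum>j\<in>J. d j * of_real (exp (- (\<kappa> * (\<theta> j)\<^sup>2)) * \<theta> j ^ n)))\<^sup>2) sums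
    Re (\<Sum>j\<in>J. \<Sum>k\<in>J. d j * cnj (d k) * of_real (exp (- (\<kappa> * (\<theta> j - \<theta> k)\<^sup>2))))"
proof -
  define e where "e j = exp (- (\<kappa> * (\<theta> j)\<^sup>2))" for j
  have "(\<lambda>n. \<Sum>j\<in>J. \<Sum>k\<in>J. d j * cnj (d k) * of_real (e j * e k * ((2 * \<kappa> * \<theta> j * \<theta> k) ^ n /\<^sub>R fact n))) sums
     (\<Sum>j\<in>J. \<Sum>k\<in>J. d j * cnj (d k) * of_real (e j * e k * exp (2 * \<kappa> * \<theta> j * \<theta> k)))"
    by (intro sums_sum sums_mult sums_of_real exp_converges)
  also have "(\<lambda>n. \<Sum>j\<in>J. \<Sum>k\<in>J. d j * cnj (d k) * of_real (e j * e k * ((2 * \<kappa> * \<theta> j * \<theta> k) ^ n /\<^sub>R fact n)))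
    = (\<lambda>n. of_real ((2 * \<kappa>) ^ n / fact n * (cmod (\<Sum>j\<in>J. d j * of_real (e j * \<theta> j ^ n)))\<^sup>2))"
  proof
    fix n
    define S where "S = (\<Sum>j\<in>J. d j * of_real (e j * \<theta> j ^ n))"
    have "of_real ((cmod S)\<^sup>2) = S * cnj S" by (rule complex_norm_square)
    also have "\<dots> = (\<Sum>j\<in>J. \<Sum>k\<in>J. d j * of_real (e j * \<theta> j ^ n) * (cnj (d k) * of_real (e k * \<theta> k ^ n)))"
      by (simp add: S_def sum_product)
    finally show "(\<Sum>j\<in>J. \<Sum>k\<in>J. d j * cnj (d k) * of_real (e j * e k * ((2 * \<kappa> * \<theta> j * \<theta> k) ^ n /\<^sub>R fact n)))
      = of_real ((2 * \<kappa>) ^ n / fact n * (cmod S)\<^sup>2)"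
      by (simp add: sum_distrib_left power_mult_distrib divide_inverse mult_ac)
  qed
  finally have sums1: "(\<lambda>n. Re (of_real ((2 * \<kappa>) ^ n / fact n * (cmod (\<Sum>j\<in>J. d j * of_real (e j * \<theta> j ^ n)))\<^sup>2))) sums
     Re (\<Sum>j\<in>J. \<Sum>k\<in>J. d j * cnj (d k) * of_real (e j * e k * exp (2 * \<kappa> * \<theta> j * \<theta> k)))"
    by (rule sums_Re)
  have eq: "e j * e k * exp (2 * \<kappa> * \<theta> j * \<theta> k) = exp (- (\<kappa> * (\<theta> j - \<theta> k)\<^sup>2))" for j k
    unfolding e_def exp_add[symmetric] by (simp add: power2_eq_square algebra_simps)
  show ?thesis using sums1 by (simp only: Re_complex_of_real eq e_def[symmetric])
qed

lemma gaussian_kernel_nonneg: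
  fixes \<theta> :: "nat \<Rightarrow> real" and d :: "nat \<Rightarrow> complex"
  assumes "\<kappa> \<ge> 0"
  shows "Re (\<Sum>j\<in>J. \<Sum>k\<in>J. d j * cnj (d k) * of_real (exp (- (\<kappa> * (\<theta> j - \<theta> k)\<^sup>2)))) \<ge> 0"
proof -
  have "0 \<le> (2 * \<kappa>) ^ n / fact n * (cmod (\<Sum>j\<in>J. d j * of_real (exp (- (\<kappa> * (\<theta> j)\<^sup>2)) * \<theta> j ^ n)))\<^sup>2" for n
    using assms by simp
  from sums_le[OF this sums_zero gaussian_kernel_sums[of \<kappa> d \<theta> J]] show ?thesis .
qed

text \<open>If the quadratic form vanishes, so do all the moments of the weighted coefficients; hence
  these are orthogonal to all polynomials.\<close>

lemma gaussian_kernel_definite: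
  fixes \<theta> :: "nat \<Rightarrow> real" and d :: "nat \<Rightarrow> complex"
  assumes "\<kappa> > 0" "finite J" "inj_on \<theta> J" "i \<in> J"
    and 0: "(\<Sum>j\<in>J. \<Sum>k\<in>J. d j * cnj (d k) * of_real (exp (- (\<kappa> * (\<theta> j - \<theta> k)\<^sup>2)))) = 0"
  shows "d i = 0"
proof -
  define y where "y j = d j * of_real (exp (- (\<kappa> * (\<theta> j)\<^sup>2)))" for j
  have s: "(\<lambda>n. (2 * \<kappa>) ^ n / fact n * (cmod (\<Sum>j\<in>J. y j * of_real (\<theta> j ^ n)))\<^sup>2) sums 0"
    using gaussian_kernel_sums[of \<kappa> d \<theta> J] unfolding 0 y_def by (simp add: mult_ac)
  have "(2 * \<kappa>) ^ n / fact n * (cmod (\<Sum>j\<in>J. y j * of_real (\<theta> j ^ n)))\<^sup>2 = 0" for n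
  proof -
    have "\<forall>n. (2 * \<kappa>) ^ n / fact n * (cmod (\<Sum>j\<in>J. y j * of_real (\<theta> j ^ n)))\<^sup>2 = 0"
      using s assms(1) by (subst suminf_eq_zero_iff[symmetric]) (auto simp: sums_iff)
    then show ?thesis by blast
  qed
  then have m: "(\<Sum>j\<in>J. y j * of_real (\<theta> j ^ n)) = 0" for n using assms(1) by simp
  have "(\<Sum>j\<in>J. y j * of_real (poly p (\<theta> j))) = 0" for p
  proof -
    have "(\<Sum>j\<in>J. y j * of_real (poly p (\<theta> j)))
        = (\<Sum>n\<le>degree p. of_real (coeff p n) * (\<Sum>j\<in>J. y j * of_real (\<theta> j ^ n)))"
      unfolding poly_altdef of_real_sum sum_distrib_left
      by (subst sum.swap) (simp add: mult_ac)
    then show ?thesis by (simp only: m) simp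
  qed
  \<comment> \<open>The polynomial that vanishes at all the other points isolates the index
    \<open>i\<close>.\<close>
  from this[of "node_poly (J - {i}) \<theta>"]
  have "(\<Sum>j\<in>J. y j * of_real (\<Prod>l\<in>J - {i}. \<theta> j - \<theta> l)) = 0" by (simp only: poly_node_poly)
  also have "(\<Sum>j\<in>J. y j * of_real (\<Prod>l\<in>J - {i}. \<theta> j - \<theta> l))
      = (\<Sum>j\<in>J. if j = i then y i * of_real (\<Prod>l\<in>J - {i}. \<theta> i - \<theta> l) else 0)"
  proof (rule sum.cong)
    fix j assume j: "j \<in> J"
    have "(\<Prod>l\<in>J - {i}. \<theta> j - \<theta> l) = 0" if "j \<noteq> i"
      by (rule prod_zero) (use assms(2) j that in auto)
    then show "y j * of_real (\<Prod>l\<in>J - {i}. \<theta> j - \<theta> l)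
      = (if j = i then y i * of_real (\<Prod>l\<in>J - {i}. \<theta> i - \<theta> l) else 0)" by (auto simp del: of_real_prod)
  qed simp
  also have "\<dots> = y i * of_real (\<Prod>l\<in>J - {i}. \<theta> i - \<theta> l)" using assms by (simp del: of_real_prod)
  finally have "y i = 0 \<or> (\<Prod>l\<in>J - {i}. \<theta> i - \<theta> l) = 0" by (simp del: of_real_prod)
  moreover have "(\<Prod>l\<in>J - {i}. \<theta> i - \<theta> l) \<noteq> 0"
  proof -
    have "\<theta> i - \<theta> l \<noteq> 0" if "l \<in> J - {i}" for l
      using inj_onD[OF assms(3) _ assms(4), of l] that by auto
    then show ?thesis using assms(2) by (subst prod_zero_iff) blast+
  qed
  ultimately show ?thesis by (simp add: y_def)
qed

text \<open>The square of the error of an exponential sum with frequencies \<^term>\<open>- \<i> * \<theta> j\<close>, expanded into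
  inner products.\<close>

definition exp_sum_error_square ::
  "real \<Rightarrow> real \<Rightarrow> nat \<Rightarrow> (nat \<Rightarrow> real) \<Rightarrow> (nat \<Rightarrow> complex) \<Rightarrow> complex" where
  "exp_sum_error_square \<rho> \<sigma> N \<theta> x =
     of_real (sqrt (2 * pi * \<rho> * \<sigma> / (2 * \<rho> + \<sigma>)))
     - (\<Sum>j=1..N. x j * of_real (sqrt (2 * pi * \<rho> * \<sigma> / (\<rho> + \<sigma>)) * exp (- (\<rho> * \<sigma> * (\<theta> j)\<^sup>2 / (2 * (\<rho> + \<sigma>))))))
     - (\<Sum>j=1..N. cnj (x j) * of_real (sqrt (2 * pi * \<rho> * \<sigma> / (\<rho> + \<sigma>)) * exp (- (\<rho> * \<sigma> * (\<theta> j)\<^sup>2 / (2 * (\<rho> + \<sigma>))))))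
     + (\<Sum>j=1..N. \<Sum>k=1..N. x j * cnj (x k) * of_real (sqrt (2 * pi * \<rho>) * exp (- (\<rho> / 2 * (\<theta> j - \<theta> k)\<^sup>2))))"

lemma has_bochner_integral_gaussian_products:
  fixes \<rho> \<sigma> b :: real
  assumes "\<rho> > 0" "\<sigma> > 0"
  defines "w \<equiv> \<lambda>s. complex_of_real (exp (- (s\<^sup>2) / (2 * \<rho>)))"
    and "g \<equiv> \<lambda>s. complex_of_real (exp (- (s\<^sup>2) / (2 * \<sigma>)))"
    and "e \<equiv> \<lambda>b s. exp (\<i> * complex_of_real (b * s))"
  shows "has_bochner_integral lborel (\<lambda>s. g s * g s * w s) (of_real (sqrt (2 * pi * \<rho> * \<sigma> / (2 * \<rho> + \<sigma>))))"
    and "has_bochner_integral lborel (\<lambda>s. e b s * (g s * w s))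
      (of_real (sqrt (2 * pi * \<rho> * \<sigma> / (\<rho> + \<sigma>)) * exp (- (\<rho> * \<sigma> * b\<^sup>2 / (2 * (\<rho> + \<sigma>))))))"
    and "has_bochner_integral lborel (\<lambda>s. e b s * w s) (of_real (sqrt (2 * pi * \<rho>) * exp (- (\<rho> / 2 * b\<^sup>2))))"
proof -
  have pos: "2 / \<sigma> + 1 / \<rho> > 0" "1 / \<sigma> + 1 / \<rho> > 0" "1 / \<rho> > 0" using assms(1,2) by (auto intro: add_pos_pos)
  have eq: "exp (complex_of_real (- (A * s\<^sup>2 / 2)) + \<i> * complex_of_real (b * s)) = e b s * complex_of_real (exp (- (A * s\<^sup>2 / 2)))" for A b s
    unfolding exp_add e_def exp_of_real by (rule mult.commute)
  have "2 * pi / (2 / \<sigma> + 1 / \<rho>) = 2 * pi * \<rho> * \<sigma> / (2 * \<rho> + \<sigma>)"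
    using assms(1,2) by (simp add: field_simps)
  moreover have "e 0 s * complex_of_real (exp (- ((2 / \<sigma> + 1 / \<rho>) * s\<^sup>2 / 2))) = g s * g s * w s" for s
  proof -
    have "exp (- ((2 / \<sigma> + 1 / \<rho>) * s\<^sup>2 / 2)) = exp (- (s\<^sup>2) / (2 * \<sigma>)) * exp (- (s\<^sup>2) / (2 * \<sigma>)) * exp (- (s\<^sup>2) / (2 * \<rho>))"
      unfolding exp_add[symmetric] using assms(1,2) by (simp add: field_simps)
    then show ?thesis by (simp add: e_def g_def w_def)
  qed
  ultimately show "has_bochner_integral lborel (\<lambda>s. g s * g s * w s) (of_real (sqrt (2 * pi * \<rho> * \<sigma> / (2 * \<rho> + \<sigma>))))"
    using gaussian_fourier[OF pos(1), of 0, unfolded eq] by simp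
  have "2 * pi / (1 / \<sigma> + 1 / \<rho>) = 2 * pi * \<rho> * \<sigma> / (\<rho> + \<sigma>)"
    "b\<^sup>2 / (2 * (1 / \<sigma> + 1 / \<rho>)) = \<rho> * \<sigma> * b\<^sup>2 / (2 * (\<rho> + \<sigma>))"
    using assms(1,2) by (simp_all add: field_simps)
  moreover have "e b s * complex_of_real (exp (- ((1 / \<sigma> + 1 / \<rho>) * s\<^sup>2 / 2))) = e b s * (g s * w s)" for s
  proof -
    have "exp (- ((1 / \<sigma> + 1 / \<rho>) * s\<^sup>2 / 2)) = exp (- (s\<^sup>2) / (2 * \<sigma>)) * exp (- (s\<^sup>2) / (2 * \<rho>))"
      unfolding exp_add[symmetric] using assms(1,2) by (simp add: field_simps)
    then show ?thesis by (simp add: g_def w_def)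
  qed
  ultimately show "has_bochner_integral lborel (\<lambda>s. e b s * (g s * w s))
      (of_real (sqrt (2 * pi * \<rho> * \<sigma> / (\<rho> + \<sigma>)) * exp (- (\<rho> * \<sigma> * b\<^sup>2 / (2 * (\<rho> + \<sigma>))))))"
    using gaussian_fourier[OF pos(2), of b, unfolded eq] by (simp only:)
  have "2 * pi / (1 / \<rho>) = 2 * pi * \<rho>" "b\<^sup>2 / (2 * (1 / \<rho>)) = \<rho> / 2 * b\<^sup>2"
    by simp_all
  moreover have "complex_of_real (exp (- (1 / \<rho> * s\<^sup>2 / 2))) = w s" for s
    by (simp add: w_def mult.commute)
  ultimately show "has_bochner_integral lborel (\<lambda>s. e b s * w s) (of_real (sqrt (2 * pi * \<rho>) * exp (- (\<rho> / 2 * b\<^sup>2))))"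
    using gaussian_fourier[OF pos(3), of b, unfolded eq] by (simp only:)
qed

lemma weighted_norm_exp_sum:
  fixes \<rho> \<sigma> :: real and x :: "nat \<Rightarrow> complex" and \<theta> :: "nat \<Rightarrow> real" and N :: nat
  assumes "\<rho> > 0" "\<sigma> > 0"
  defines "I \<equiv> (weighted_norm \<rho> (\<lambda>s. complex_of_real (exp (- (s\<^sup>2) / (2 * \<sigma>)))
      - (\<Sum>j=1..N. x j * exp (- \<i> * complex_of_real (\<theta> j) * complex_of_real s))))\<^sup>2"
  shows "complex_of_real I = exp_sum_error_square \<rho> \<sigma> N \<theta> x"
proof -
  define w where "w s = complex_of_real (exp (- (s\<^sup>2) / (2 * \<rho>)))" for s
  define g where "g s = complex_of_real (exp (- (s\<^sup>2) / (2 * \<sigma>)))" for s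
  define e where "e b s = exp (\<i> * complex_of_real (b * s))" for b s
  define f where "f s = g s - (\<Sum>j=1..N. x j * e (- \<theta> j) s)" for s
  have int: "has_bochner_integral lborel (\<lambda>s. g s * g s * w s) (of_real (sqrt (2 * pi * \<rho> * \<sigma> / (2 * \<rho> + \<sigma>))))"
    "has_bochner_integral lborel (\<lambda>s. e b s * (g s * w s))
      (of_real (sqrt (2 * pi * \<rho> * \<sigma> / (\<rho> + \<sigma>)) * exp (- (\<rho> * \<sigma> * b\<^sup>2 / (2 * (\<rho> + \<sigma>))))))"
    "has_bochner_integral lborel (\<lambda>s. e b s * w s) (of_real (sqrt (2 * pi * \<rho>) * exp (- (\<rho> / 2 * b\<^sup>2))))" for b
    using has_bochner_integral_gaussian_products[OF assms(1,2)] unfolding w_def g_def e_def by blast+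
  have cnj_e: "cnj (e b s) = e (- b) s" for b s by (simp add: e_def exp_cnj)
  have e_mult: "e b s * e c s = e (b + c) s" for b c s
    by (simp add: e_def exp_add[symmetric] algebra_simps)
  have ff: "complex_of_real ((cmod (f s))\<^sup>2 * exp (- (s\<^sup>2) / (2 * \<rho>)))
      = g s * g s * w s - (\<Sum>j=1..N. x j * (e (- \<theta> j) s * (g s * w s)))
        - (\<Sum>j=1..N. cnj (x j) * (e (\<theta> j) s * (g s * w s)))
        + (\<Sum>j=1..N. \<Sum>k=1..N. x j * cnj (x k) * (e (\<theta> k - \<theta> j) s * w s))" for s
  proof -
    have 1: "complex_of_real ((cmod (f s))\<^sup>2) = f s * cnj (f s)" by (rule complex_norm_square)
    have 2: "cnj (f s) = g s - (\<Sum>j=1..N. cnj (x j) * e (\<theta> j) s)"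
      by (simp add: f_def cnj_e g_def)
    have 3: "(\<Sum>j=1..N. x j * e (- \<theta> j) s) * (\<Sum>j=1..N. cnj (x j) * e (\<theta> j) s) * w s
        = (\<Sum>j=1..N. \<Sum>k=1..N. x j * cnj (x k) * (e (\<theta> k - \<theta> j) s * w s))"
      unfolding sum_product
      unfolding sum_distrib_right
    proof (intro sum.cong refl)
      fix j k
      have "e (\<theta> k - \<theta> j) s = e (- \<theta> j) s * e (\<theta> k) s" by (simp add: e_mult)
      then show "x j * e (- \<theta> j) s * (cnj (x k) * e (\<theta> k) s) * w s
        = x j * cnj (x k) * (e (\<theta> k - \<theta> j) s * w s)" by simp
    qed
    have 4: "(\<Sum>j=1..N. x j * e (- \<theta> j) s) * (g s * w s) = (\<Sum>j=1..N. x j * (e (- \<theta> j) s * (g s * w s)))"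
      "(\<Sum>j=1..N. cnj (x j) * e (\<theta> j) s) * (g s * w s) = (\<Sum>j=1..N. cnj (x j) * (e (\<theta> j) s * (g s * w s)))"
      by (simp_all add: sum_distrib_right mult.assoc)
    have "complex_of_real ((cmod (f s))\<^sup>2 * exp (- (s\<^sup>2) / (2 * \<rho>))) = f s * cnj (f s) * w s"
      unfolding of_real_mult 1 w_def by simp
    also have "\<dots> = g s * g s * w s - (\<Sum>j=1..N. x j * e (- \<theta> j) s) * (g s * w s)
       - (\<Sum>j=1..N. cnj (x j) * e (\<theta> j) s) * (g s * w s)
       + (\<Sum>j=1..N. x j * e (- \<theta> j) s) * (\<Sum>j=1..N. cnj (x j) * e (\<theta> j) s) * w s"
      unfolding 2 unfolding f_def by (simp add: algebra_simps)
    finally show ?thesis unfolding 3 4 .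
  qed
  have "has_bochner_integral lborel (\<lambda>s. complex_of_real ((cmod (f s))\<^sup>2 * exp (- (s\<^sup>2) / (2 * \<rho>))))
     (of_real (sqrt (2 * pi * \<rho> * \<sigma> / (2 * \<rho> + \<sigma>)))
     - (\<Sum>j=1..N. x j * of_real (sqrt (2 * pi * \<rho> * \<sigma> / (\<rho> + \<sigma>)) * exp (- (\<rho> * \<sigma> * (- \<theta> j)\<^sup>2 / (2 * (\<rho> + \<sigma>))))))
     - (\<Sum>j=1..N. cnj (x j) * of_real (sqrt (2 * pi * \<rho> * \<sigma> / (\<rho> + \<sigma>)) * exp (- (\<rho> * \<sigma> * (\<theta> j)\<^sup>2 / (2 * (\<rho> + \<sigma>))))))
     + (\<Sum>j=1..N. \<Sum>k=1..N. x j * cnj (x k) * of_real (sqrt (2 * pi * \<rho>) * exp (- (\<rho> / 2 * (\<theta> k - \<theta> j)\<^sup>2)))))"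
    unfolding ff
    by (intro has_bochner_integral_add has_bochner_integral_diff has_bochner_integral_sum
        has_bochner_integral_mult_right int)
  then have "complex_of_real (LINT s|lborel. (cmod (f s))\<^sup>2 * exp (- (s\<^sup>2) / (2 * \<rho>)))
      = exp_sum_error_square \<rho> \<sigma> N \<theta> x"
    unfolding exp_sum_error_square_def
    by (simp add: has_bochner_integral_iff power2_commute del: of_real_mult of_real_power flip: integral_complex_of_real)
  moreover have "I = (LINT s|lborel. (cmod (f s))\<^sup>2 * exp (- (s\<^sup>2) / (2 * \<rho>)))"
  proof -
    have "f = (\<lambda>s. complex_of_real (exp (- (s\<^sup>2) / (2 * \<sigma>)))
      - (\<Sum>j=1..N. x j * exp (- \<i> * complex_of_real (\<theta> j) * complex_of_real s)))"
      by (rule ext) (simp add: f_def g_def e_def mult_ac)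
    then show ?thesis unfolding I_def weighted_norm_def
      by (simp add: integral_nonneg_AE)
  qed
  ultimately show ?thesis by simp
qed

text \<open>Completing the square: by the linear equations the cross terms cancel against the change
  of the linear terms, so the excess over the solution is exactly the form evaluated at
  \<open>y - x\<close>.\<close>

lemma quadratic_form_minimizer:
  fixes K :: "nat \<Rightarrow> nat \<Rightarrow> real" and b :: "nat \<Rightarrow> real" and x y :: "nat \<Rightarrow> complex"
  assumes sym: "\<And>j k. K j k = K k j"
    and sys: "\<And>k. k \<in> J \<Longrightarrow> (\<Sum>j\<in>J. x j * of_real (K j k)) = of_real (b k)"
  shows "(\<Sum>j\<in>J. \<Sum>k\<in>J. y j * cnj (y k) * of_real (K j k))
      - (\<Sum>j\<in>J. y j * of_real (b j)) - (\<Sum>j\<in>J. cnj (y j) * of_real (b j))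
    = (\<Sum>j\<in>J. \<Sum>k\<in>J. x j * cnj (x k) * of_real (K j k))
      - (\<Sum>j\<in>J. x j * of_real (b j)) - (\<Sum>j\<in>J. cnj (x j) * of_real (b j))
      + (\<Sum>j\<in>J. \<Sum>k\<in>J. (y j - x j) * cnj (y k - x k) * of_real (K j k))"
proof -
  define d where "d j = y j - x j" for j
  have y: "y j = x j + d j" for j by (simp add: d_def)
  have 1: "(\<Sum>j\<in>J. \<Sum>k\<in>J. x j * cnj (d k) * of_real (K j k)) = (\<Sum>j\<in>J. cnj (d j) * of_real (b j))"
  proof -
    have "(\<Sum>j\<in>J. \<Sum>k\<in>J. x j * cnj (d k) * of_real (K j k)) = (\<Sum>k\<in>J. cnj (d k) * (\<Sum>j\<in>J. x j * of_real (K j k)))"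
      by (subst sum.swap) (simp add: sum_distrib_left mult_ac)
    then show ?thesis using sys by simp
  qed
  have 2: "(\<Sum>j\<in>J. \<Sum>k\<in>J. d j * cnj (x k) * of_real (K j k)) = (\<Sum>j\<in>J. d j * of_real (b j))"
  proof (intro sum.cong refl)
    fix j assume j: "j \<in> J"
    have "(\<Sum>k\<in>J. d j * cnj (x k) * of_real (K j k)) = d j * cnj (\<Sum>k\<in>J. x k * of_real (K k j))"
      unfolding cnj_sum sum_distrib_left
      by (intro sum.cong refl) (subst sym, simp)
    then show "(\<Sum>k\<in>J. d j * cnj (x k) * of_real (K j k)) = d j * of_real (b j)"
      unfolding sys[OF j] by simp
  qed
  have "(\<Sum>j\<in>J. \<Sum>k\<in>J. y j * cnj (y k) * of_real (K j k))
    = (\<Sum>j\<in>J. \<Sum>k\<in>J. x j * cnj (x k) * of_real (K j k))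
      + (\<Sum>j\<in>J. \<Sum>k\<in>J. x j * cnj (d k) * of_real (K j k))
      + (\<Sum>j\<in>J. \<Sum>k\<in>J. d j * cnj (x k) * of_real (K j k))
      + (\<Sum>j\<in>J. \<Sum>k\<in>J. d j * cnj (d k) * of_real (K j k))"
    unfolding y sum.distrib[symmetric]
    by (intro sum.cong refl) (simp add: algebra_simps)
  moreover have "(\<Sum>j\<in>J. y j * of_real (b j)) = (\<Sum>j\<in>J. x j * of_real (b j)) + (\<Sum>j\<in>J. d j * of_real (b j))"
    unfolding y sum.distrib[symmetric] by (intro sum.cong refl) (simp add: algebra_simps)
  moreover have "(\<Sum>j\<in>J. cnj (y j) * of_real (b j)) = (\<Sum>j\<in>J. cnj (x j) * of_real (b j)) + (\<Sum>j\<in>J. cnj (d j) * of_real (b j))"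
    unfolding y sum.distrib[symmetric] by (intro sum.cong refl) (simp add: algebra_simps)
  ultimately show ?thesis unfolding 1 2 d_def[symmetric] by simp
qed

section \<open>The linear system as normal equations\<close>

definition freq_scale :: "real \<Rightarrow> real \<Rightarrow> real" where
  "freq_scale \<rho> \<sigma> = sqrt (2 * (\<rho> + \<sigma>) / (\<sigma> * (2 * \<rho> + \<sigma>)))"

lemma freq_scale_pos: "\<rho> > 0 \<Longrightarrow> \<sigma> > 0 \<Longrightarrow> freq_scale \<rho> \<sigma> > 0"
  by (simp add: freq_scale_def)

lemma freq_scale_square:
  "\<rho> > 0 \<Longrightarrow> \<sigma> > 0 \<Longrightarrow> (freq_scale \<rho> \<sigma>)\<^sup>2 = 2 * (\<rho> + \<sigma>) / (\<sigma> * (2 * \<rho> + \<sigma>))"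
  unfolding freq_scale_def by (intro real_sqrt_pow2) simp

lemma frequency_eq: "frequency \<rho> \<sigma> t j = - \<i> * complex_of_real (freq_scale \<rho> \<sigma> * t j)"
  by (simp add: frequency_def freq_scale_def)

text \<open>Multiplication by \<open>sqrt (2 * pi * \<rho>)\<close> turns the coefficients and
  right-hand sides into the weighted inner products that occur in
  \<open>exp_sum_error_square\<close>.\<close>

lemma solves_system_iff:
  fixes t :: "nat \<Rightarrow> real"
  assumes "\<rho> > 0" "\<sigma> > 0"
  defines "\<theta> \<equiv> \<lambda>j. freq_scale \<rho> \<sigma> * t j"
  shows "solves_system \<rho> \<sigma> N (frequency \<rho> \<sigma> t) \<gamma> \<longleftrightarrow>
    (\<forall>k\<in>{1..N}. (\<Sum>j=1..N. \<gamma> j * of_real (sqrt (2 * pi * \<rho>) * exp (- (\<rho> / 2 * (\<theta> j - \<theta> k)\<^sup>2))))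
      = of_real (sqrt (2 * pi * \<rho> * \<sigma> / (\<rho> + \<sigma>)) * exp (- (\<rho> * \<sigma> * (\<theta> k)\<^sup>2 / (2 * (\<rho> + \<sigma>))))))"
proof -
  define q where "q = complex_of_real (sqrt (2 * pi * \<rho>))"
  have q: "q \<noteq> 0" using assms by (simp add: q_def)
  have l: "frequency \<rho> \<sigma> t j = - \<i> * complex_of_real (\<theta> j)" for j
    by (simp add: frequency_eq \<theta>_def)
  have 1: "exp ((frequency \<rho> \<sigma> t j - frequency \<rho> \<sigma> t k)\<^sup>2 * complex_of_real \<rho> / 2)
      = of_real (exp (- (\<rho> / 2 * (\<theta> j - \<theta> k)\<^sup>2)))" for j k
  proof -
    have "(frequency \<rho> \<sigma> t j - frequency \<rho> \<sigma> t k)\<^sup>2 * complex_of_real \<rho> / 2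
        = of_real (- (\<rho> / 2 * (\<theta> j - \<theta> k)\<^sup>2))"
      unfolding l by (simp add: power2_eq_square field_simps)
    then show ?thesis by (simp only: exp_of_real)
  qed
  have 2: "complex_of_real (sqrt (\<sigma> / (\<sigma> + \<rho>))) *
        exp (complex_of_real (\<sigma> * \<rho>) * (frequency \<rho> \<sigma> t k)\<^sup>2 / complex_of_real (2 * (\<sigma> + \<rho>)))
     = of_real (sqrt (\<sigma> / (\<sigma> + \<rho>)) * exp (- (\<rho> * \<sigma> * (\<theta> k)\<^sup>2 / (2 * (\<rho> + \<sigma>)))))" for k
  proof -
    have "complex_of_real (\<sigma> * \<rho>) * (frequency \<rho> \<sigma> t k)\<^sup>2 / complex_of_real (2 * (\<sigma> + \<rho>))
        = of_real (- (\<rho> * \<sigma> * (\<theta> k)\<^sup>2 / (2 * (\<rho> + \<sigma>))))"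
      unfolding l by (simp add: power_mult_distrib add.commute mult_ac)
    then show ?thesis by (simp only: exp_of_real of_real_mult)
  qed
  have 3: "sqrt (2 * pi * \<rho>) * sqrt (\<sigma> / (\<sigma> + \<rho>)) = sqrt (2 * pi * \<rho> * \<sigma> / (\<rho> + \<sigma>))"
    by (simp add: real_sqrt_mult[symmetric] add.commute)
  have "(\<Sum>j=1..N. exp ((frequency \<rho> \<sigma> t j - frequency \<rho> \<sigma> t k)\<^sup>2 * complex_of_real \<rho> / 2) * \<gamma> j)
      = complex_of_real (sqrt (\<sigma> / (\<sigma> + \<rho>))) *
        exp (complex_of_real (\<sigma> * \<rho>) * (frequency \<rho> \<sigma> t k)\<^sup>2 / complex_of_real (2 * (\<sigma> + \<rho>)))
    \<longleftrightarrow> (\<Sum>j=1..N. \<gamma> j * of_real (sqrt (2 * pi * \<rho>) * exp (- (\<rho> / 2 * (\<theta> j - \<theta> k)\<^sup>2))))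
      = of_real (sqrt (2 * pi * \<rho> * \<sigma> / (\<rho> + \<sigma>)) * exp (- (\<rho> * \<sigma> * (\<theta> k)\<^sup>2 / (2 * (\<rho> + \<sigma>)))))" for k
  proof -
    define A where "A = (\<Sum>j=1..N. of_real (exp (- (\<rho> / 2 * (\<theta> j - \<theta> k)\<^sup>2))) * \<gamma> j)"
    define B where "B = complex_of_real (sqrt (\<sigma> / (\<sigma> + \<rho>)) * exp (- (\<rho> * \<sigma> * (\<theta> k)\<^sup>2 / (2 * (\<rho> + \<sigma>)))))"
    have "(\<Sum>j=1..N. \<gamma> j * of_real (sqrt (2 * pi * \<rho>) * exp (- (\<rho> / 2 * (\<theta> j - \<theta> k)\<^sup>2)))) = q * A"
      by (simp add: A_def q_def sum_distrib_left mult_ac)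
    moreover have "of_real (sqrt (2 * pi * \<rho> * \<sigma> / (\<rho> + \<sigma>)) * exp (- (\<rho> * \<sigma> * (\<theta> k)\<^sup>2 / (2 * (\<rho> + \<sigma>))))) = q * B"
      unfolding 3[symmetric] B_def q_def by (simp only: of_real_mult mult.assoc)
    ultimately show ?thesis unfolding 1 2 A_def[symmetric] B_def[symmetric] using q by simp
  qed
  then show ?thesis unfolding solves_system_def by blast
qed

lemma approx_error_square:
  assumes "\<rho> > 0" "\<sigma> > 0"
  shows "complex_of_real ((approx_error \<rho> \<sigma> N (frequency \<rho> \<sigma> t) x)\<^sup>2)
    = exp_sum_error_square \<rho> \<sigma> N (\<lambda>j. freq_scale \<rho> \<sigma> * t j) x"
  unfolding approx_error_def frequency_eq by (rule weighted_norm_exp_sum[OF assms])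

lemma approx_error_minimal:
  assumes "\<rho> > 0" "\<sigma> > 0" "solves_system \<rho> \<sigma> N (frequency \<rho> \<sigma> t) \<gamma>"
  shows "(approx_error \<rho> \<sigma> N (frequency \<rho> \<sigma> t) \<gamma>)\<^sup>2 \<le> (approx_error \<rho> \<sigma> N (frequency \<rho> \<sigma> t) y)\<^sup>2"
proof -
  define \<theta> where "\<theta> j = freq_scale \<rho> \<sigma> * t j" for j
  define K where "K j k = sqrt (2 * pi * \<rho>) * exp (- (\<rho> / 2 * (\<theta> j - \<theta> k)\<^sup>2))" for j k
  define b where "b k = sqrt (2 * pi * \<rho> * \<sigma> / (\<rho> + \<sigma>)) * exp (- (\<rho> * \<sigma> * (\<theta> k)\<^sup>2 / (2 * (\<rho> + \<sigma>))))" for k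
  define Q where "Q = (\<Sum>j=1..N. \<Sum>k=1..N. (y j - \<gamma> j) * cnj (y k - \<gamma> k) * of_real (exp (- (\<rho> / 2 * (\<theta> j - \<theta> k)\<^sup>2))))"
  have sys: "(\<Sum>j=1..N. \<gamma> j * of_real (K j k)) = of_real (b k)" if "k \<in> {1..N}" for k
    using assms(3) that unfolding solves_system_iff[OF assms(1,2)] K_def b_def \<theta>_def by blast
  have sym: "K j k = K k j" for j k by (simp add: K_def power2_commute)
  have "complex_of_real ((approx_error \<rho> \<sigma> N (frequency \<rho> \<sigma> t) y)\<^sup>2)
      = complex_of_real ((approx_error \<rho> \<sigma> N (frequency \<rho> \<sigma> t) \<gamma>)\<^sup>2)
        + (\<Sum>j=1..N. \<Sum>k=1..N. (y j - \<gamma> j) * cnj (y k - \<gamma> k) * of_real (K j k))"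
    using quadratic_form_minimizer[of K "{1..N}" \<gamma> b y, OF sym sys]
    unfolding approx_error_square[OF assms(1,2)] exp_sum_error_square_def
      \<theta>_def[symmetric] K_def[symmetric] b_def[symmetric]
    by (simp add: algebra_simps)
  also have "(\<Sum>j=1..N. \<Sum>k=1..N. (y j - \<gamma> j) * cnj (y k - \<gamma> k) * of_real (K j k))
      = of_real (sqrt (2 * pi * \<rho>)) * Q"
    unfolding Q_def K_def sum_distrib_left by (intro sum.cong refl) (simp add: mult_ac)
  finally have "(approx_error \<rho> \<sigma> N (frequency \<rho> \<sigma> t) y)\<^sup>2
      = Re (complex_of_real ((approx_error \<rho> \<sigma> N (frequency \<rho> \<sigma> t) \<gamma>)\<^sup>2) + of_real (sqrt (2 * pi * \<rho>)) * Q)"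
    by (metis Re_complex_of_real)
  moreover have "Re Q \<ge> 0"
    unfolding Q_def by (rule gaussian_kernel_nonneg) (use assms in simp)
  ultimately show ?thesis using assms(1) by simp
qed

text \<open>Pairing the homogeneous equations for the difference with its conjugate gives a
  vanishing Gaussian kernel form, which is definite at distinct points.\<close>

lemma solves_system_unique:
  assumes "\<rho> > 0" "\<sigma> > 0" "inj_on t {1..N}" "i \<in> {1..N}"
    and "solves_system \<rho> \<sigma> N (frequency \<rho> \<sigma> t) \<gamma>" "solves_system \<rho> \<sigma> N (frequency \<rho> \<sigma> t) \<gamma>'"
  shows "\<gamma> i = \<gamma>' i"
proof -
  define \<theta> where "\<theta> j = freq_scale \<rho> \<sigma> * t j" for j
  define d where "d j = \<gamma> j - \<gamma>' j" for j
  define E where "E j k = complex_of_real (exp (- (\<rho> / 2 * (\<theta> j - \<theta> k)\<^sup>2)))" for j k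
  have "(\<Sum>j=1..N. d j * E j k) = 0" if k: "k \<in> {1..N}" for k
  proof -
    have "of_real (sqrt (2 * pi * \<rho>)) * (\<Sum>j=1..N. d j * E j k)
      = (\<Sum>j=1..N. \<gamma> j * of_real (sqrt (2 * pi * \<rho>) * exp (- (\<rho> / 2 * (\<theta> j - \<theta> k)\<^sup>2))))
       - (\<Sum>j=1..N. \<gamma>' j * of_real (sqrt (2 * pi * \<rho>) * exp (- (\<rho> / 2 * (\<theta> j - \<theta> k)\<^sup>2))))"
      unfolding sum_distrib_left sum_subtractf[symmetric] E_def d_def
      by (intro sum.cong refl) (simp add: algebra_simps)
    also have "\<dots> = 0"
      using assms(5,6) k unfolding solves_system_iff[OF assms(1,2)] \<theta>_def by simp
    finally show ?thesis using assms(1) by simp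
  qed
  then have "(\<Sum>k=1..N. cnj (d k) * (\<Sum>j=1..N. d j * E j k)) = 0" by simp
  moreover have "(\<Sum>j=1..N. \<Sum>k=1..N. d j * cnj (d k) * E j k) = (\<Sum>k=1..N. cnj (d k) * (\<Sum>j=1..N. d j * E j k))"
    by (subst sum.swap) (simp add: sum_distrib_left mult_ac)
  ultimately have z: "(\<Sum>j=1..N. \<Sum>k=1..N. d j * cnj (d k) * E j k) = 0" by simp
  have inj: "inj_on \<theta> {1..N}"
  proof (rule inj_onI)
    fix a b assume ab: "a \<in> {1..N}" "b \<in> {1..N}" "\<theta> a = \<theta> b"
    then have "t a = t b" using freq_scale_pos[OF assms(1,2)] by (simp add: \<theta>_def)
    then show "a = b" using ab(1,2) by (rule inj_onD[OF assms(3)])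
  qed
  have "d i = 0"
    by (rule gaussian_kernel_definite[OF _ finite_atLeastAtMost inj assms(4) z[unfolded E_def]])
      (use assms(1) in simp)
  then show ?thesis by (simp add: d_def)
qed

section \<open>Symmetry of the nodes and of the coefficients\<close>

lemma hermite_minus: "hermite n (- x) = (-1) ^ n * hermite n x"
  using he_scale[of "-1" n x] by (simp add: hermite_eq_he)

lemma hermite_zeros_desc_inj: "hermite_zeros_desc N t \<Longrightarrow> inj_on t {1..N}"
  unfolding hermite_zeros_desc_def inj_on_def by (metis less_irrefl linorder_neqE_nat)

text \<open>In either enumeration exactly \<open>j - 1\<close> elements of the common range exceed
  the \<open>j\<close>-th entry, and the number of larger elements determines an element.\<close>

lemma strict_decreasing_enumeration_unique:
  fixes s t :: "nat \<Rightarrow> real"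
  assumes im: "s ` {1..N} = t ` {1..N}"
    and s: "\<forall>i\<in>{1..N}. \<forall>j\<in>{1..N}. i < j \<longrightarrow> s j < s i"
    and t: "\<forall>i\<in>{1..N}. \<forall>j\<in>{1..N}. i < j \<longrightarrow> t j < t i"
    and j: "j \<in> {1..N}"
  shows "s j = t j"
proof -
  define Z where "Z = t ` {1..N}"
  have card: "card {x \<in> Z. u j < x} = j - 1"
    if u: "u ` {1..N} = Z" "\<forall>i\<in>{1..N}. \<forall>j\<in>{1..N}. i < j \<longrightarrow> u j < u i" for u :: "nat \<Rightarrow> real"
  proof -
    have "{x \<in> Z. u j < x} = u ` {1..<j}"
    proof (intro equalityI subsetI)
      fix x assume "x \<in> {x \<in> Z. u j < x}"
      then obtain i where i: "i \<in> {1..N}" "x = u i" "u j < u i" unfolding u(1)[symmetric] by blast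
      have "i < j" using u(2) i j by (metis less_asym less_irrefl linorder_neqE_nat)
      then show "x \<in> u ` {1..<j}" using i by auto
    next
      fix x assume "x \<in> u ` {1..<j}"
      then obtain i where i: "1 \<le> i" "i < j" "x = u i" by auto
      then have "i \<in> {1..N}" using j by auto
      moreover have "u j < u i" using u(2) \<open>i \<in> {1..N}\<close> j i by blast
      ultimately show "x \<in> {x \<in> Z. u j < x}" using i u(1) by blast
    qed
    moreover have "inj_on u {1..<j}"
    proof (rule inj_onI)
      fix a b assume ab: "a \<in> {1..<j}" "b \<in> {1..<j}" "u a = u b"
      then have "a \<in> {1..N}" "b \<in> {1..N}" using j by auto
      then show "a = b" using u(2) ab(3) by (metis less_irrefl linorder_neqE_nat)
    qed
    ultimately show ?thesis by (simp add: card_image)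
  qed
  have no: "\<not> u j < v j" if "u ` {1..N} = Z" "\<forall>i\<in>{1..N}. \<forall>j\<in>{1..N}. i < j \<longrightarrow> u j < u i"
      "v ` {1..N} = Z" "\<forall>i\<in>{1..N}. \<forall>j\<in>{1..N}. i < j \<longrightarrow> v j < v i" for u v :: "nat \<Rightarrow> real"
  proof
    assume lt: "u j < v j"
    have "v j \<in> Z" using that(3) j by blast
    then have "{x \<in> Z. v j < x} \<subset> {x \<in> Z. u j < x}" using lt by auto
    moreover have "finite {x \<in> Z. u j < x}" by (simp add: Z_def)
    ultimately have "card {x \<in> Z. v j < x} < card {x \<in> Z. u j < x}" by (rule psubset_card_mono[rotated])
    then show False using card[OF that(1,2)] card[OF that(3,4)] by simp
  qed
  have "\<not> s j < t j" using no[of s t] im s t by (simp add: Z_def)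
  moreover have "\<not> t j < s j" using no[of t s] im s t by (simp add: Z_def)
  ultimately show ?thesis by simp
qed

text \<open>By parity, negating and reversing the list gives another decreasing enumeration of the
  same zeros.\<close>

lemma hermite_zeros_symmetric:
  assumes "hermite_zeros_desc N t" "j \<in> {1..N}"
  shows "t (N + 1 - j) = - t j"
proof -
  define s where "s j = - t (N + 1 - j)" for j
  have Z: "t ` {1..N} = {x. hermite N x = 0}" and t: "\<forall>i\<in>{1..N}. \<forall>j\<in>{1..N}. i < j \<longrightarrow> t j < t i"
    using assms(1) by (auto simp: hermite_zeros_desc_def)
  have refl: "(\<lambda>j. N + 1 - j) ` {1..N} = {1..N}"
  proof (intro equalityI subsetI)
    fix i assume "i \<in> {1..N}"
    then have "i = N + 1 - (N + 1 - i)" "N + 1 - i \<in> {1..N}" by auto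
    then show "i \<in> (\<lambda>j. N + 1 - j) ` {1..N}" by blast
  qed auto
  have "s j = t j"
  proof (rule strict_decreasing_enumeration_unique[OF _ _ t assms(2)])
    have "s ` {1..N} = uminus ` t ` (\<lambda>j. N + 1 - j) ` {1..N}"
      by (simp add: s_def image_image)
    also have "\<dots> = uminus ` {x. hermite N x = 0}" by (simp only: refl Z)
    also have "\<dots> = {x. hermite N x = 0}"
    proof (intro equalityI subsetI)
      fix x assume "x \<in> {x. hermite N x = 0}"
      then have "x = - (- x)" "- x \<in> {x. hermite N x = 0}" by (simp_all add: hermite_minus)
      then show "x \<in> uminus ` {x. hermite N x = 0}" by blast
    qed (auto simp: hermite_minus)
    finally show "s ` {1..N} = t ` {1..N}" by (simp only: Z)
    show "\<forall>i\<in>{1..N}. \<forall>j\<in>{1..N}. i < j \<longrightarrow> s j < s i"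
    proof (intro ballI impI)
      fix i j assume "i \<in> {1..N}" "j \<in> {1..N}" "i < j"
      then have "N + 1 - j \<in> {1..N}" "N + 1 - i \<in> {1..N}" "N + 1 - j < N + 1 - i" by auto
      then have "t (N + 1 - i) < t (N + 1 - j)" using t by blast
      then show "s j < s i" by (simp add: s_def)
    qed
  qed
  then show ?thesis by (simp add: s_def)
qed

text \<open>Reversing the indices changes the sign of all frequencies, and the system contains only
  squares of frequencies and of their differences. The reversed coefficients therefore solve it too,
  and uniqueness applies.\<close>

lemma solution_symmetric:
  assumes "\<rho> > 0" "\<sigma> > 0" "hermite_zeros_desc N t" "j \<in> {1..N}"
    and sol: "solves_system \<rho> \<sigma> N (frequency \<rho> \<sigma> t) \<gamma>"
  shows "\<gamma> j = \<gamma> (N + 1 - j)"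
proof (rule solves_system_unique[OF assms(1,2) hermite_zeros_desc_inj[OF assms(3)] assms(4) sol])
  have fr: "frequency \<rho> \<sigma> t (N + 1 - i) = - frequency \<rho> \<sigma> t i" if "i \<in> {1..N}" for i
    using hermite_zeros_symmetric[OF assms(3) that] by (simp add: frequency_def)
  show "solves_system \<rho> \<sigma> N (frequency \<rho> \<sigma> t) (\<lambda>j. \<gamma> (N + 1 - j))"
    unfolding solves_system_def
  proof
    fix k assume k: "k \<in> {1..N}"
    have k': "N + 1 - k \<in> {1..N}" using k by auto
    have "(\<Sum>j=1..N. exp ((frequency \<rho> \<sigma> t j - frequency \<rho> \<sigma> t k)\<^sup>2 * complex_of_real \<rho> / 2) * \<gamma> (N + 1 - j))
      = (\<Sum>j=1..N. exp ((frequency \<rho> \<sigma> t j - frequency \<rho> \<sigma> t (N + 1 - k))\<^sup>2 * complex_of_real \<rho> / 2) * \<gamma> j)"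
    proof (rule sum.reindex_bij_witness[where i = "\<lambda>j. N + 1 - j" and j = "\<lambda>j. N + 1 - j"])
      fix j assume j: "j \<in> {1..N}"
      show "exp ((frequency \<rho> \<sigma> t (N + 1 - j) - frequency \<rho> \<sigma> t (N + 1 - k))\<^sup>2 * complex_of_real \<rho> / 2) * \<gamma> (N + 1 - j)
        = exp ((frequency \<rho> \<sigma> t j - frequency \<rho> \<sigma> t k)\<^sup>2 * complex_of_real \<rho> / 2) * \<gamma> (N + 1 - j)"
        unfolding fr[OF j] fr[OF k] by (simp add: power2_commute)
    qed auto
    also have "\<dots> = complex_of_real (sqrt (\<sigma> / (\<sigma> + \<rho>))) *
        exp (complex_of_real (\<sigma> * \<rho>) * (frequency \<rho> \<sigma> t (N + 1 - k))\<^sup>2 / complex_of_real (2 * (\<sigma> + \<rho>)))"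
      using sol k' unfolding solves_system_def by blast
    finally show "(\<Sum>j=1..N. exp ((frequency \<rho> \<sigma> t j - frequency \<rho> \<sigma> t k)\<^sup>2 * complex_of_real \<rho> / 2) * \<gamma> (N + 1 - j))
      = complex_of_real (sqrt (\<sigma> / (\<sigma> + \<rho>))) *
        exp (complex_of_real (\<sigma> * \<rho>) * (frequency \<rho> \<sigma> t k)\<^sup>2 / complex_of_real (2 * (\<sigma> + \<rho>)))"
      unfolding fr[OF k] by simp
  qed
qed

section \<open>The error of the trial coefficients and the final estimate\<close>

lemma (in hermite_nodes) quad_coeff_sums:
  assumes "0 \<le> \<tau>" "\<tau> < 1"
  shows "(\<lambda>n. \<tau> ^ n * quad_coeff n) sums
    (\<Sum>j=1..N. \<Sum>k=1..N. weight j * weight k *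
      (exp ((2 * t j * t k * \<tau> - \<tau>\<^sup>2 * ((t j)\<^sup>2 + (t k)\<^sup>2)) / (1 - \<tau>\<^sup>2)) / sqrt (1 - \<tau>\<^sup>2)))"
proof -
  have "(\<lambda>n. \<Sum>j=1..N. \<Sum>k=1..N. weight j * weight k * (2 ^ n / fact n * (he 1 n (t j) * he 1 n (t k)) * \<tau> ^ n)) sums
    (\<Sum>j=1..N. \<Sum>k=1..N. weight j * weight k *
      (exp ((2 * t j * t k * \<tau> - \<tau>\<^sup>2 * ((t j)\<^sup>2 + (t k)\<^sup>2)) / (1 - \<tau>\<^sup>2)) / sqrt (1 - \<tau>\<^sup>2)))"
    by (intro sums_sum sums_mult mehler) (use assms in auto)
  also have "(\<lambda>n. \<Sum>j=1..N. \<Sum>k=1..N. weight j * weight k * (2 ^ n / fact n * (he 1 n (t j) * he 1 n (t k)) * \<tau> ^ n))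
      = (\<lambda>n. \<tau> ^ n * quad_coeff n)"
    unfolding quad_coeff_def power2_eq_square sum_product
    by (simp add: sum_distrib_left mult_ac)
  finally show ?thesis .
qed

lemma one_minus_ratio_square:
  fixes \<rho> \<sigma> :: real
  assumes "\<rho> > 0" "\<sigma> > 0"
  shows "1 - (\<rho> / (\<rho> + \<sigma>))\<^sup>2 = \<sigma> * (2 * \<rho> + \<sigma>) / (\<rho> + \<sigma>)\<^sup>2"
proof -
  have "(\<rho> + \<sigma>)\<^sup>2 - \<rho>\<^sup>2 = \<sigma> * (2 * \<rho> + \<sigma>)" by (simp add: power2_eq_square algebra_simps)
  moreover have "1 - (\<rho> / (\<rho> + \<sigma>))\<^sup>2 = ((\<rho> + \<sigma>)\<^sup>2 - \<rho>\<^sup>2) / (\<rho> + \<sigma>)\<^sup>2"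
    using assms by (simp add: power_divide diff_divide_distrib)
  ultimately show ?thesis by simp
qed

text \<open>The trial coefficients come from applying the quadrature rule to the representation of the
  Gaussian as a superposition of exponentials.\<close>

lemma (in hermite_nodes) approx_error_trial:
  assumes "\<rho> > 0" "\<sigma> > 0"
  defines "\<tau> \<equiv> \<rho> / (\<rho> + \<sigma>)"
    and "v \<equiv> \<lambda>j. sqrt ((\<rho> + \<sigma>) / (2 * \<rho> + \<sigma>)) * weight j * exp (\<rho> / (2 * \<rho> + \<sigma>) * (t j)\<^sup>2)"
  shows "(approx_error \<rho> \<sigma> N (frequency \<rho> \<sigma> t) (\<lambda>j. of_real (v j)))\<^sup>2
    = sqrt (2 * pi * \<rho> * \<sigma> / (2 * \<rho> + \<sigma>)) * ((\<Sum>n. \<tau> ^ n * quad_coeff n) - 1)"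
proof -
  define \<theta> where "\<theta> j = freq_scale \<rho> \<sigma> * t j" for j
  define G where "G = sqrt (2 * pi * \<rho> * \<sigma> / (2 * \<rho> + \<sigma>))"
  define b where "b j = sqrt (2 * pi * \<rho> * \<sigma> / (\<rho> + \<sigma>)) * exp (- (\<rho> * \<sigma> * (\<theta> j)\<^sup>2 / (2 * (\<rho> + \<sigma>))))" for j
  define K where "K j k = sqrt (2 * pi * \<rho>) * exp (- (\<rho> / 2 * (\<theta> j - \<theta> k)\<^sup>2))" for j k
  define M where "M j k = exp ((2 * t j * t k * \<tau> - \<tau>\<^sup>2 * ((t j)\<^sup>2 + (t k)\<^sup>2)) / (1 - \<tau>\<^sup>2)) / sqrt (1 - \<tau>\<^sup>2)" for j k
  have pos: "\<rho> + \<sigma> > 0" "2 * \<rho> + \<sigma> > 0" "\<sigma> * (2 * \<rho> + \<sigma>) > 0" using assms(1,2) by auto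
  have nz: "\<rho> + \<sigma> \<noteq> 0" "2 * \<rho> + \<sigma> \<noteq> 0" using pos by auto
  have \<tau>: "0 \<le> \<tau>" "\<tau> < 1" using assms(1,2) by (auto simp: \<tau>_def)
  have \<tau>2: "1 - \<tau>\<^sup>2 = \<sigma> * (2 * \<rho> + \<sigma>) / (\<rho> + \<sigma>)\<^sup>2"
    unfolding \<tau>_def by (rule one_minus_ratio_square) (use assms(1,2) in auto)
  have \<theta>2: "(\<theta> j)\<^sup>2 = 2 * (\<rho> + \<sigma>) / (\<sigma> * (2 * \<rho> + \<sigma>)) * (t j)\<^sup>2" for j
    unfolding \<theta>_def power_mult_distrib freq_scale_square[OF assms(1,2)] ..
  \<comment> \<open>The exponential in \<open>v j\<close> cancels the Gaussian in
    \<open>b j\<close>, so each of the two linear terms of the squared error is \<open>G\<close>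
    times the sum of the weights.\<close>
  have vb: "v j * b j = G * weight j" for j
  proof -
    have ex: "\<rho> * \<sigma> * (\<theta> j)\<^sup>2 / (2 * (\<rho> + \<sigma>)) = \<rho> / (2 * \<rho> + \<sigma>) * (t j)\<^sup>2"
    proof -
      have "\<rho> * \<sigma> * (2 * S / (\<sigma> * P) * x) / (2 * S) = \<rho> / P * x" if "S \<noteq> 0" "P \<noteq> 0" for S P x
        using that assms(2) by simp
      from this[OF nz] show ?thesis unfolding \<theta>2 .
    qed
    have sG: "sqrt ((\<rho> + \<sigma>) / (2 * \<rho> + \<sigma>)) * sqrt (2 * pi * \<rho> * \<sigma> / (\<rho> + \<sigma>)) = G"
      unfolding G_def real_sqrt_mult[symmetric] using pos by simp
    have "v j * b j = G * weight j * (exp (\<rho> / (2 * \<rho> + \<sigma>) * (t j)\<^sup>2) * exp (- (\<rho> / (2 * \<rho> + \<sigma>) * (t j)\<^sup>2)))"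
    proof -
      have reorder: "s1 * w * e1 * (s2 * e2) = (s1 * s2) * w * (e1 * e2)" for s1 s2 w e1 e2 :: real by simp
      show ?thesis unfolding v_def b_def ex by (subst reorder) (simp only: sG)
    qed
    then show ?thesis by (simp flip: exp_add)
  qed
  \<comment> \<open>The scale of the frequencies is such that the exponents of \<open>v j\<close>,
    \<open>v k\<close> and the kernel add up to the exponent in Mehler's formula at \<tau>.\<close>
  have vK: "v j * v k * K j k = G * (weight j * weight k * M j k)" for j k
  proof -
    have e: "\<rho> / (2 * \<rho> + \<sigma>) * (t j)\<^sup>2 + \<rho> / (2 * \<rho> + \<sigma>) * (t k)\<^sup>2 - \<rho> / 2 * (\<theta> j - \<theta> k)\<^sup>2
        = (2 * t j * t k * \<tau> - \<tau>\<^sup>2 * ((t j)\<^sup>2 + (t k)\<^sup>2)) / (1 - \<tau>\<^sup>2)"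
    proof -
      define D where "D = \<sigma> * (2 * \<rho> + \<sigma>)"
      have D: "D \<noteq> 0" using pos(2) assms(2) by (simp add: D_def)
      have "\<rho> / 2 * (\<theta> j - \<theta> k)\<^sup>2 = \<rho> / 2 * (freq_scale \<rho> \<sigma>)\<^sup>2 * (t j - t k)\<^sup>2"
        by (simp add: \<theta>_def power_mult_distrib flip: right_diff_distrib)
      also have "\<dots> = \<rho> * (\<rho> + \<sigma>) / D * (t j - t k)\<^sup>2"
      proof -
        have "\<rho> / 2 * (2 * S / D) * x = \<rho> * S / D * x" for S x by simp
        then show ?thesis unfolding freq_scale_square[OF assms(1,2)] D_def[symmetric] .
      qed
      finally have 1: "\<rho> / 2 * (\<theta> j - \<theta> k)\<^sup>2 = \<rho> * (\<rho> + \<sigma>) * (t j - t k)\<^sup>2 / D" by simp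
      have 2: "\<rho> / (2 * \<rho> + \<sigma>) = \<rho> * \<sigma> / D" using assms(1,2) pos by (simp add: D_def)
      have "(2 * t j * t k * \<tau> - \<tau>\<^sup>2 * ((t j)\<^sup>2 + (t k)\<^sup>2)) / (1 - \<tau>\<^sup>2)
          = (2 * t j * t k * (\<tau> * (\<rho> + \<sigma>)\<^sup>2) - \<tau>\<^sup>2 * (\<rho> + \<sigma>)\<^sup>2 * ((t j)\<^sup>2 + (t k)\<^sup>2)) / D"
      proof -
        have "(x * \<tau> - \<tau>\<^sup>2 * y) / (D / S) = (x * (\<tau> * S) - \<tau>\<^sup>2 * S * y) / D" if "S \<noteq> 0" for x y S
          using that D by (simp add: field_simps)
        from this[OF power_not_zero[OF nz(1), of 2]] show ?thesis unfolding \<tau>2 D_def[symmetric] .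
      qed
      also have "\<tau> * (\<rho> + \<sigma>)\<^sup>2 = \<rho> * (\<rho> + \<sigma>)" using nz by (simp add: \<tau>_def power2_eq_square)
      also have "\<tau>\<^sup>2 * (\<rho> + \<sigma>)\<^sup>2 = \<rho>\<^sup>2" using nz by (simp add: \<tau>_def power_divide)
      finally have 3: "(2 * t j * t k * \<tau> - \<tau>\<^sup>2 * ((t j)\<^sup>2 + (t k)\<^sup>2)) / (1 - \<tau>\<^sup>2)
          = (2 * t j * t k * (\<rho> * (\<rho> + \<sigma>)) - \<rho>\<^sup>2 * ((t j)\<^sup>2 + (t k)\<^sup>2)) / D" .
      have "\<rho> * \<sigma> * (t j)\<^sup>2 + \<rho> * \<sigma> * (t k)\<^sup>2 - \<rho> * (\<rho> + \<sigma>) * (t j - t k)\<^sup>2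
          = 2 * t j * t k * (\<rho> * (\<rho> + \<sigma>)) - \<rho>\<^sup>2 * ((t j)\<^sup>2 + (t k)\<^sup>2)"
        by (simp add: power2_eq_square algebra_simps)
      then show ?thesis
        unfolding 1 2 3 by (simp only: times_divide_eq_left add_divide_distrib[symmetric] diff_divide_distrib[symmetric])
    qed
    have s: "sqrt ((\<rho> + \<sigma>) / (2 * \<rho> + \<sigma>)) * sqrt ((\<rho> + \<sigma>) / (2 * \<rho> + \<sigma>)) * sqrt (2 * pi * \<rho>) = G / sqrt (1 - \<tau>\<^sup>2)"
    proof -
      have G: "G / sqrt (1 - \<tau>\<^sup>2) = sqrt (2 * pi * \<rho> * ((\<rho> + \<sigma>) / (2 * \<rho> + \<sigma>))\<^sup>2)"
      proof -
        have "2 * pi * \<rho> * \<sigma> / P / (\<sigma> * P / S\<^sup>2) = 2 * pi * \<rho> * (S / P)\<^sup>2" if "S \<noteq> 0" "P \<noteq> 0" for S P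
          using assms(2) that by (simp add: power2_eq_square)
        from this[OF nz] show ?thesis unfolding G_def \<tau>2 real_sqrt_divide[symmetric] by (simp only:)
      qed
      have "sqrt A * sqrt A * sqrt c = sqrt (c * A\<^sup>2)" if "A \<ge> 0" for A c
        using that by (simp add: real_sqrt_mult)
      then have "sqrt ((\<rho> + \<sigma>) / (2 * \<rho> + \<sigma>)) * sqrt ((\<rho> + \<sigma>) / (2 * \<rho> + \<sigma>)) * sqrt (2 * pi * \<rho>)
          = sqrt (2 * pi * \<rho> * ((\<rho> + \<sigma>) / (2 * \<rho> + \<sigma>))\<^sup>2)"
        using pos by (simp only: divide_nonneg_nonneg less_imp_le)
      with G show ?thesis by (simp only:)
    qed
    have "v j * v k * K j k = (sqrt ((\<rho> + \<sigma>) / (2 * \<rho> + \<sigma>)) * sqrt ((\<rho> + \<sigma>) / (2 * \<rho> + \<sigma>)) * sqrt (2 * pi * \<rho>))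
      * (weight j * weight k) * (exp (\<rho> / (2 * \<rho> + \<sigma>) * (t j)\<^sup>2) * exp (\<rho> / (2 * \<rho> + \<sigma>) * (t k)\<^sup>2) * exp (- (\<rho> / 2 * (\<theta> j - \<theta> k)\<^sup>2)))"
      unfolding v_def K_def by (simp only: mult_ac)
    also have "\<dots> = G / sqrt (1 - \<tau>\<^sup>2) * (weight j * weight k) * exp ((2 * t j * t k * \<tau> - \<tau>\<^sup>2 * ((t j)\<^sup>2 + (t k)\<^sup>2)) / (1 - \<tau>\<^sup>2))"
      unfolding s e[symmetric] by (simp only: diff_conv_add_uminus exp_add)
    finally show ?thesis by (simp add: M_def)
  qed
  have "complex_of_real ((approx_error \<rho> \<sigma> N (frequency \<rho> \<sigma> t) (\<lambda>j. of_real (v j)))\<^sup>2)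
     = complex_of_real (G - (\<Sum>j=1..N. v j * b j) - (\<Sum>j=1..N. v j * b j) + (\<Sum>j=1..N. \<Sum>k=1..N. v j * v k * K j k))"
    unfolding approx_error_square[OF assms(1,2)] exp_sum_error_square_def
      \<theta>_def[symmetric] G_def[symmetric] b_def[symmetric] K_def[symmetric]
    by (simp only: of_real_add of_real_diff of_real_sum of_real_mult complex_cnj_complex_of_real)
  also have "(\<Sum>j=1..N. v j * b j) = G * (\<Sum>j=1..N. weight j)"
    unfolding vb sum_distrib_left ..
  also have "(\<Sum>j=1..N. weight j) = 1" by (rule sum_weight)
  also have "(\<Sum>j=1..N. \<Sum>k=1..N. v j * v k * K j k) = G * (\<Sum>n. \<tau> ^ n * quad_coeff n)"
    unfolding vK sum_distrib_left[symmetric] M_def sums_unique[OF quad_coeff_sums[OF \<tau>]] ..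
  finally have "(approx_error \<rho> \<sigma> N (frequency \<rho> \<sigma> t) (\<lambda>j. of_real (v j)))\<^sup>2
      = G - G * 1 - G * 1 + G * (\<Sum>n. \<tau> ^ n * quad_coeff n)"
    by (simp only: of_real_eq_iff)
  then show ?thesis by (simp add: G_def algebra_simps)
qed

lemma approx_error_0:
  assumes "\<rho> > 0" "\<sigma> > 0"
  shows "(approx_error \<rho> \<sigma> N (frequency \<rho> \<sigma> t) (\<lambda>j. 0))\<^sup>2 = sqrt (2 * pi * \<rho> * \<sigma> / (2 * \<rho> + \<sigma>))"
proof -
  have "complex_of_real ((approx_error \<rho> \<sigma> N (frequency \<rho> \<sigma> t) (\<lambda>j. 0))\<^sup>2)
      = complex_of_real (sqrt (2 * pi * \<rho> * \<sigma> / (2 * \<rho> + \<sigma>)))"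
    unfolding approx_error_square[OF assms] exp_sum_error_square_def by simp
  then show ?thesis by (simp only: of_real_eq_iff)
qed

text \<open>The spare factor \<open>24/25\<close> has already absorbed the powers of
  \<open>N\<close>, so the rate comes out without the factor \<open>N powr (3/4)\<close>.\<close>

lemma approx_error_bound:
  assumes "\<rho> > 0"
  obtains c where "c > 0"
    "\<And>\<sigma> N t \<gamma>. \<sigma> > 0 \<Longrightarrow> N \<ge> 1 \<Longrightarrow> hermite_zeros_desc N t \<Longrightarrow>
      solves_system \<rho> \<sigma> N (frequency \<rho> \<sigma> t) \<gamma> \<Longrightarrow>
      approx_error \<rho> \<sigma> N (frequency \<rho> \<sigma> t) \<gamma> \<le> c * (\<rho> / \<sigma> / sqrt (2 * (2 * (\<rho> / \<sigma>) + 1))) ^ N"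
proof -
  obtain K where K: "\<And>N. real N ^ 2 * (24/25) ^ N \<le> K" using bounded_square_mult_power by blast
  have K0: "K \<ge> 0" using K[of 0] by simp
  \<comment> \<open>Free of \<sigma>, as the squared norm of the Gaussian is at most
    \<open>sqrt (2 * pi * \<rho>)\<close>. The summand 1 serves the case of zero
    coefficients.\<close>
  define C where "C = sqrt (2 * pi * \<rho>) * (468 * exp 1 * K + 1)"
  have C: "C > 0" unfolding C_def using assms K0 by (intro mult_pos_pos add_nonneg_pos) auto
  show thesis
  proof (rule that[of "sqrt C"])
    show "sqrt C > 0" using C by simp
    fix \<sigma> N t \<gamma>
    assume \<sigma>: "\<sigma> > 0" and N: "N \<ge> 1" and z: "hermite_zeros_desc N t"
      and sol: "solves_system \<rho> \<sigma> N (frequency \<rho> \<sigma> t) \<gamma>"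
    interpret hermite_nodes N t
    proof
      show "inj_on t {1..N}" by (rule hermite_zeros_desc_inj[OF z])
      show "hermite N (t j) = 0" if "j \<in> {1..N}" for j
        using z that unfolding hermite_zeros_desc_def by blast
    qed (rule N)
    define \<tau> where "\<tau> = \<rho> / (\<rho> + \<sigma>)"
    define T where "T = \<tau>\<^sup>2 / (2 * (1 - \<tau>\<^sup>2))"
    define B where "B = \<rho> / \<sigma> / sqrt (2 * (2 * (\<rho> / \<sigma>) + 1))"
    define e where "e = approx_error \<rho> \<sigma> N (frequency \<rho> \<sigma> t) \<gamma>"
    have \<tau>: "0 < \<tau>" "\<tau> < 1" using assms \<sigma> by (auto simp: \<tau>_def)
    have \<tau>2: "1 - \<tau>\<^sup>2 > 0" using \<tau> by (simp add: abs_square_less_1)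
    have B0: "B \<ge> 0" using assms \<sigma> by (simp add: B_def)
    have T: "T = B\<^sup>2"
    proof -
      have "1 - \<tau>\<^sup>2 = \<sigma> * (2 * \<rho> + \<sigma>) / (\<rho> + \<sigma>)\<^sup>2"
        unfolding \<tau>_def by (rule one_minus_ratio_square) (use assms \<sigma> in auto)
      then have "T = \<rho>\<^sup>2 / (2 * (\<sigma> * (2 * \<rho> + \<sigma>)))"
        using assms \<sigma> by (simp add: T_def \<tau>_def power_divide)
      moreover have "B\<^sup>2 = (\<rho> / \<sigma>)\<^sup>2 / (2 * (2 * (\<rho> / \<sigma>) + 1))"
        
      proof -
        have "(sqrt (2 * (2 * (\<rho> / \<sigma>) + 1)))\<^sup>2 = 2 * (2 * (\<rho> / \<sigma>) + 1)"
          using assms \<sigma> by (intro real_sqrt_pow2) simp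
        then show ?thesis unfolding B_def by (subst power_divide) simp
      qed
      moreover have "(\<rho> / \<sigma>)\<^sup>2 / (2 * (2 * (\<rho> / \<sigma>) + 1)) = \<rho>\<^sup>2 / (2 * (\<sigma> * (2 * \<rho> + \<sigma>)))"
      proof -
        have "2 * (2 * (\<rho> / \<sigma>) + 1) = 2 * (2 * \<rho> + \<sigma>) / \<sigma>" using \<sigma> by (simp add: field_simps)
        then show ?thesis using assms \<sigma> by (simp add: power_divide power2_eq_square)
      qed
      ultimately show ?thesis by simp
    qed
    have G: "0 \<le> sqrt (2 * pi * \<rho> * \<sigma> / (2 * \<rho> + \<sigma>))" "sqrt (2 * pi * \<rho> * \<sigma> / (2 * \<rho> + \<sigma>)) \<le> sqrt (2 * pi * \<rho>)"
    proof -
      have "2 * pi * \<rho> * (\<sigma> / (2 * \<rho> + \<sigma>)) \<le> 2 * pi * \<rho> * 1"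
        using assms \<sigma> by (intro mult_left_mono) auto
      then show "sqrt (2 * pi * \<rho> * \<sigma> / (2 * \<rho> + \<sigma>)) \<le> sqrt (2 * pi * \<rho>)"
        by (intro real_sqrt_le_mono) (simp only: times_divide_eq_right mult_1_right)
    qed (use assms \<sigma> in simp)
    have "e\<^sup>2 \<le> C * T ^ N"
    \<comment> \<open>The threshold 2/3 is the value of \<open>\<tau>^2\<close> at which
      \<open>T = 1\<close>.\<close>
    proof (cases "\<tau>\<^sup>2 \<le> 2 / 3")
      case True
      have "e\<^sup>2 \<le> sqrt (2 * pi * \<rho> * \<sigma> / (2 * \<rho> + \<sigma>)) * ((\<Sum>n. \<tau> ^ n * quad_coeff n) - 1)"
        unfolding e_def \<tau>_def approx_error_trial[OF assms \<sigma>, symmetric]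
        by (rule approx_error_minimal[OF assms \<sigma> sol])
      also have "\<dots> \<le> sqrt (2 * pi * \<rho> * \<sigma> / (2 * \<rho> + \<sigma>)) * (468 * exp 1 * K * T ^ N)"
        using suminf_quad_coeff_le[OF \<tau>(1) True K] G(1) unfolding T_def by (intro mult_left_mono) auto
      also have "\<dots> \<le> sqrt (2 * pi * \<rho>) * ((468 * exp 1 * K + 1) * T ^ N)"
        using G K0 B0 unfolding T by (intro mult_mono) auto
      finally show ?thesis by (simp add: C_def)
    next
      case False
      have "T \<ge> 1" using False \<tau>2 by (simp add: T_def)
      then have T1: "T ^ N \<ge> 1" by (rule one_le_power)
      have "e\<^sup>2 \<le> sqrt (2 * pi * \<rho> * \<sigma> / (2 * \<rho> + \<sigma>))"
        unfolding e_def approx_error_0[OF assms \<sigma>, of N t, symmetric]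
        by (rule approx_error_minimal[OF assms \<sigma> sol])
      also have "\<dots> \<le> sqrt (2 * pi * \<rho>) * 1" using G by simp
      also have "\<dots> \<le> C" unfolding C_def using assms K0 by (intro mult_left_mono) auto
      also have "\<dots> \<le> C * T ^ N" using C T1 by simp
      finally show ?thesis .
    qed
    also have "C * T ^ N = (sqrt C * B ^ N)\<^sup>2"
      unfolding T using C by (simp add: power_mult_distrib mult.commute flip: power_mult)
    finally have "e \<le> sqrt C * B ^ N"
      by (rule power2_le_imp_le) (use C B0 in simp)
    then show "approx_error \<rho> \<sigma> N (frequency \<rho> \<sigma> t) \<gamma> \<le> sqrt C * (\<rho> / \<sigma> / sqrt (2 * (2 * (\<rho> / \<sigma>) + 1))) ^ N"
      by (simp only: e_def B_def)
  qed
qed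

text \<open>The step \<open>(n + 1)^3 \<le> 3 * n^3\<close> fails at 2 and holds from 3 on, where
  the claim starts with equality.\<close>

lemma cube_le_three_power: "N \<ge> 1 \<Longrightarrow> N ^ 3 \<le> (3 ^ N :: nat)"
proof -
  have base: "N ^ 3 \<le> (3 ^ N :: nat)" if "N \<ge> 3" for N
    using that
  proof (induction N rule: dec_induct)
    case (step n)
    have "3 * (n * n) \<le> n * (n * n)" "3 * n \<le> n * n"
      using step.hyps by (intro mult_le_mono1; simp)+
    moreover have "Suc n ^ 3 = n * (n * n) + 3 * (n * n) + 3 * n + 1"
      by (simp add: power3_eq_cube algebra_simps)
    moreover have "3 * n ^ 3 = 3 * (n * (n * n))" by (simp add: power3_eq_cube)
    ultimately have "Suc n ^ 3 \<le> 3 * n ^ 3" using step.hyps by linarith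
    then show ?case using step.IH by simp
  qed simp
  assume "N \<ge> 1"
  then consider "N = 1" | "N = 2" | "N \<ge> 3" by linarith
  then show ?thesis using base by cases auto
qed

lemma powr_three_quarters_le: "N \<ge> 1 \<Longrightarrow> real N powr (3 / 4) \<le> (3 powr (1 / 4)) ^ N"
proof -
  assume N: "N \<ge> 1"
  have "real N powr (3 / 4) = (real N powr 3) powr (1 / 4)" by (simp only: powr_powr) simp
  also have "real N powr 3 = real (N ^ 3)" using N by simp
  also have "real (N ^ 3) powr (1 / 4) \<le> real (3 ^ N) powr (1 / 4)"
    using cube_le_three_power[OF N] by (intro powr_mono2) (auto simp: of_nat_le_iff simp del: of_nat_power)
  also have "real (3 ^ N) powr (1 / 4) = (3 powr (1 / 4)) ^ N"
    by (simp add: powr_power powr_powr mult.commute flip: powr_realpow)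
  finally show ?thesis .
qed

theorem theorem3p1:
  fixes \<rho> :: real
  assumes "\<rho> > 0"
  shows
    "(\<exists>c::real. c > 0 \<and>
        (\<forall>\<sigma>::real. \<sigma> > 0 \<longrightarrow>
          (\<forall>(N::nat) (t :: nat \<Rightarrow> real) (\<gamma> :: nat \<Rightarrow> complex).
             N \<ge> 1 \<longrightarrow> hermite_zeros_desc N t \<longrightarrow>
             solves_system \<rho> \<sigma> N (frequency \<rho> \<sigma> t) \<gamma> \<longrightarrow>
             (let r = \<rho> / \<sigma> in
                (\<forall>j\<in>{1..N}. \<gamma> j = \<gamma> (N + 1 - j)) \<and>
                approx_error \<rho> \<sigma> N (frequency \<rho> \<sigma> t) \<gamma>
                  < c * (r / sqrt (2 * (2 * r + 1))) ^ N * real N powr (3 / 4) \<and>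
                c * (r / sqrt (2 * (2 * r + 1))) ^ N * real N powr (3 / 4)
                  \<le> c * (3 powr (1 / 4) * r / sqrt (2 * (2 * r + 1))) ^ N))))
     \<and>
     (\<forall>\<sigma>::real. \<sigma> > 0 \<longrightarrow> \<rho> / \<sigma> < 2 + sqrt 6 \<longrightarrow>
        (\<exists>C q :: real. C > 0 \<and> 0 < q \<and> q < 1 \<and>
          (\<forall>(N::nat) (t :: nat \<Rightarrow> real) (\<gamma> :: nat \<Rightarrow> complex).
             N \<ge> 1 \<longrightarrow> hermite_zeros_desc N t \<longrightarrow>
             solves_system \<rho> \<sigma> N (frequency \<rho> \<sigma> t) \<gamma> \<longrightarrow>
             approx_error \<rho> \<sigma> N (frequency \<rho> \<sigma> t) \<gamma> \<le> C * q ^ N)))"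
proof (intro conjI)
  obtain c where c: "c > 0" and bound: "\<And>\<sigma> N t \<gamma>. \<sigma> > 0 \<Longrightarrow> N \<ge> 1 \<Longrightarrow> hermite_zeros_desc N t \<Longrightarrow>
      solves_system \<rho> \<sigma> N (frequency \<rho> \<sigma> t) \<gamma> \<Longrightarrow>
      approx_error \<rho> \<sigma> N (frequency \<rho> \<sigma> t) \<gamma> \<le> c * (\<rho> / \<sigma> / sqrt (2 * (2 * (\<rho> / \<sigma>) + 1))) ^ N"
    using approx_error_bound[OF assms] by blast
  show "\<exists>c::real. c > 0 \<and>
        (\<forall>\<sigma>::real. \<sigma> > 0 \<longrightarrow>
          (\<forall>(N::nat) (t :: nat \<Rightarrow> real) (\<gamma> :: nat \<Rightarrow> complex).
             N \<ge> 1 \<longrightarrow> hermite_zeros_desc N t \<longrightarrow>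
             solves_system \<rho> \<sigma> N (frequency \<rho> \<sigma> t) \<gamma> \<longrightarrow>
             (let r = \<rho> / \<sigma> in
                (\<forall>j\<in>{1..N}. \<gamma> j = \<gamma> (N + 1 - j)) \<and>
                approx_error \<rho> \<sigma> N (frequency \<rho> \<sigma> t) \<gamma>
                  < c * (r / sqrt (2 * (2 * r + 1))) ^ N * real N powr (3 / 4) \<and>
                c * (r / sqrt (2 * (2 * r + 1))) ^ N * real N powr (3 / 4)
                  \<le> c * (3 powr (1 / 4) * r / sqrt (2 * (2 * r + 1))) ^ N)))"
    unfolding Let_def
  \<comment> \<open>Doubling the constant makes the inequality strict, because the base of the power
    is positive.\<close>
  proof (intro exI[of _ "2 * c"] conjI allI impI)
    show "2 * c > 0" using c by simp
    fix \<sigma> :: real and N :: nat and t :: "nat \<Rightarrow> real" and \<gamma> :: "nat \<Rightarrow> complex"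
    assume \<sigma>: "\<sigma> > 0" and N: "N \<ge> 1" and z: "hermite_zeros_desc N t"
      and sol: "solves_system \<rho> \<sigma> N (frequency \<rho> \<sigma> t) \<gamma>"
    define B where "B = \<rho> / \<sigma> / sqrt (2 * (2 * (\<rho> / \<sigma>) + 1))"
    have B: "B > 0" using assms \<sigma> by (simp add: B_def add_pos_pos)
    show "\<forall>j\<in>{1..N}. \<gamma> j = \<gamma> (N + 1 - j)"
      using solution_symmetric[OF assms \<sigma> z _ sol] by blast
    have "approx_error \<rho> \<sigma> N (frequency \<rho> \<sigma> t) \<gamma> \<le> c * B ^ N"
      unfolding B_def by (rule bound[OF \<sigma> N z sol])
    also have "\<dots> < 2 * c * B ^ N" using c B by simp
    also have "\<dots> \<le> 2 * c * B ^ N * real N powr (3 / 4)"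
      using c B N by (intro mult_left_mono[of 1 _ "2 * c * B ^ N", simplified mult_1_right] ge_one_powr_ge_zero) auto
    finally show "approx_error \<rho> \<sigma> N (frequency \<rho> \<sigma> t) \<gamma>
        < 2 * c * (\<rho> / \<sigma> / sqrt (2 * (2 * (\<rho> / \<sigma>) + 1))) ^ N * real N powr (3 / 4)"
      unfolding B_def .
    have "2 * c * B ^ N * real N powr (3 / 4) \<le> 2 * c * B ^ N * (3 powr (1 / 4)) ^ N"
      using c B by (intro mult_left_mono powr_three_quarters_le[OF N]) auto
    also have "\<dots> = 2 * c * (3 powr (1 / 4) * (\<rho> / \<sigma>) / sqrt (2 * (2 * (\<rho> / \<sigma>) + 1))) ^ N"
    proof -
      have "3 powr (1 / 4) * (\<rho> / \<sigma>) / sqrt (2 * (2 * (\<rho> / \<sigma>) + 1)) = B * 3 powr (1 / 4)"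
        unfolding B_def by (simp only: times_divide_eq_right times_divide_eq_left mult.commute)
      then show ?thesis by (simp only: power_mult_distrib mult.assoc)
    qed
    finally show "2 * c * (\<rho> / \<sigma> / sqrt (2 * (2 * (\<rho> / \<sigma>) + 1))) ^ N * real N powr (3 / 4)
        \<le> 2 * c * (3 powr (1 / 4) * (\<rho> / \<sigma>) / sqrt (2 * (2 * (\<rho> / \<sigma>) + 1))) ^ N"
      unfolding B_def .
  qed
  show "\<forall>\<sigma>::real. \<sigma> > 0 \<longrightarrow> \<rho> / \<sigma> < 2 + sqrt 6 \<longrightarrow>
        (\<exists>C q :: real. C > 0 \<and> 0 < q \<and> q < 1 \<and>
          (\<forall>(N::nat) (t :: nat \<Rightarrow> real) (\<gamma> :: nat \<Rightarrow> complex).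
             N \<ge> 1 \<longrightarrow> hermite_zeros_desc N t \<longrightarrow>
             solves_system \<rho> \<sigma> N (frequency \<rho> \<sigma> t) \<gamma> \<longrightarrow>
             approx_error \<rho> \<sigma> N (frequency \<rho> \<sigma> t) \<gamma> \<le> C * q ^ N))"
  proof (intro allI impI)
    fix \<sigma> :: real assume \<sigma>: "\<sigma> > 0" and r: "\<rho> / \<sigma> < 2 + sqrt 6"
    define R where "R = \<rho> / \<sigma>"
    have R: "R > 0" "R < 2 + sqrt 6" using assms \<sigma> r by (auto simp: R_def)
    have "R\<^sup>2 < 2 * (2 * R + 1)"
    proof -
      \<comment> \<open>The base is below 1 exactly if \<open>(R - 2)^2 < 6\<close>; this inequality
        handles small \<open>R\<close>, where \<open>R - 2\<close> is negative.\<close>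
      have "2 < sqrt 6" by (rule real_less_rsqrt) simp
      then have "(R - 2)\<^sup>2 < (sqrt 6)\<^sup>2"
        using R by (intro power2_strict_mono) auto
      then show ?thesis by (simp add: power2_eq_square algebra_simps)
    qed
    then have "R < sqrt (2 * (2 * R + 1))" by (rule real_less_rsqrt)
    then have "R / sqrt (2 * (2 * R + 1)) < 1" using R by (subst divide_less_eq_1_pos) auto
    moreover have "0 < R / sqrt (2 * (2 * R + 1))" using R by simp
    ultimately show "\<exists>C q :: real. C > 0 \<and> 0 < q \<and> q < 1 \<and>
          (\<forall>(N::nat) (t :: nat \<Rightarrow> real) (\<gamma> :: nat \<Rightarrow> complex).
             N \<ge> 1 \<longrightarrow> hermite_zeros_desc N t \<longrightarrow>
             solves_system \<rho> \<sigma> N (frequency \<rho> \<sigma> t) \<gamma> \<longrightarrow>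
             approx_error \<rho> \<sigma> N (frequency \<rho> \<sigma> t) \<gamma> \<le> C * q ^ N)"
      using c bound[OF \<sigma>] unfolding R_def
      by (intro exI[of _ c] exI[of _ "\<rho> / \<sigma> / sqrt (2 * (2 * (\<rho> / \<sigma>) + 1))"]) blast
  qed
qed

end
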